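(* Uniqueness of the Fukushima type decomposition can fail if martingales on $[\![0,\zeta[\![$ are used. That is: there exist a quasi-regular semi-Dirichlet form $(\mathcal{E},D(\mathcal{E}))$ on some $L^2(E;m)$ with properly associated $m$-tight special standard process $\mathbf{M}$, satisfying (A) there exist $\{V_n\}\in\Theta$ and locally bounded functions $C_n$ on $\mathbb{R}$ such that for each $n$, if $u,v\in D(\mathcal{E})_{V_n,b}$, then $uv\in D(\mathcal{E})$ and $\mathcal{E}(uv,uv)\le C_n(\|u\|_\infty+\|v\|_\infty)(\mathcal{E}_1(u,u)+\mathcal{E}_1(v,v))$, and a function $u\in D(\mathcal{E})_{loc}$ for which $\int_E(\tilde u(x)-\tilde u(y))^2J(dy,dx)$ is a smooth measure, such that there are two decompositions $$\tilde u(X_t)-\tilde u(X_0)=M_t+N_t=M'_t+N'_t,\quad t\ge0,\quad P_x\text{-a.s. for }\mathcal{E}\text{-q.e. }x\in E,$$ with $M,M'\in\mathcal{M}^{[\![0,\zeta[\![}_{loc}$ and $N,N'\in\mathcal{L}_c$, where $N$ and $N'$ are not equivalent as local AFs.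
   Context: Setting. $E$ is a metrizable Lusin space and $m$ a $\sigma$-finite positive measure on $\mathcal{B}(E)$. A semi-Dirichlet form on $L^2(E;m)$ is a coercive closed form $(\mathcal{E},D(\mathcal{E}))$ such that $u\in D(\mathcal{E})$ implies $u^+\wedge1\in D(\mathcal{E})$ and $\mathcal{E}(u+u^+\wedge1,u-u^+\wedge1)\ge0$; $\mathcal{E}_1(u,v)=\mathcal{E}(u,v)+(u,v)_{L^2(E;m)}$. Quasi-regularity, $\mathcal{E}$-nests, $\mathcal{E}$-exceptional sets, q.e., $\mathcal{E}$-quasi-open sets and $\mathcal{E}$-quasi-continuity are the standard notions. $\mathbf{M}=(\Omega,\mathcal{F},(\mathcal{F}_t),(X_t),(P_x)_{x\in E_\Delta})$ is an $m$-tight special standard process with cemetery $\Delta$ and lifetime $\zeta$, properly associated with the form: $P_tf$ is an $\mathcal{E}$-quasi-continuous $m$-version of $T_tf$ for $f\in\mathcal{B}_b(E)\cap L^2(E;m)$, $t>0$, where $(T_t)$ is the semigroup of the form. $\tilde u$ denotes an $\mathcal{E}$-quasi-continuous $m$-version of $u$; functions are extended by $0$ at $\Delta$. $\tau_B=\inf\{t>0:X_t\notin B\}$. $\Theta$ is the set of sequences $\{V_n\}$ of $\mathcal{E}$-quasi-open sets with $V_n\subset V_{n+1}$ q.e. for all $n$ and $E=\bigcup_nV_n$ q.e. $D(\mathcal{E})_{loc}$ is the set of $u$ for which there exist $\{V_n\}\in\Theta$ and $\{u_n\}\subset D(\mathcal{E})$ with $u=u_n$ $m$-a.e. on $V_n$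 for all $n$. For quasi-open $V$, $D(\mathcal{E})_{V,b}$ is the set of bounded $u\in D(\mathcal{E})$ with $\tilde u=0$ q.e. on $E\setminus V$. A positive measure $\mu$ on $(E,\mathcal{B}(E))$ is smooth if it charges no $\mathcal{E}$-exceptional Borel set and there is an $\mathcal{E}$-nest $\{F_k\}$ of compact sets with $\mu(F_k)<\infty$ for all $k$. $J$ is the jump measure of the form: $J(dy,dx)=N(x,dy)\mu_H(dx)$ on $E\times E$, with $(N(x,dy),H)$ a Lévy system of $X$ and $\mu_H$ the Revuz measure of $H$. A local AF is an adapted family $(A_t)$ for which there are a defining set $\Lambda\in\mathcal{F}$ and an $\mathcal{E}$-exceptional set $N$ with $P_x[\Lambda]=1$ for $x\in E\setminus N$, $\theta_t\Lambda\subset\Lambda$ for $t>0$, and on $\Lambda$: $t\mapsto A_t$ is right continuous on $(0,\infty)$ with left limits on $(0,\zeta)$, $A_0=0$, $|A_t|<\infty$ for $t<\zeta$, $A_t=A_\zeta$ for $t\ge\zeta$, and $A_{t+s}=A_t+A_s\circ\theta_t$ whenever $t+s<\zeta$. Local AFs $A^{(1)},A^{(2)}$ are equivalent if for q.e. $x\in E$, $P_x(A^{(1)}_t=A^{(2)}_t;\,t<\zeta)=P_x(t<\zeta)$ for all $t\ge0$. $\mathcal{L}_c$ is the set of local AFs $N$ for which there is $\{E_n\}\in\Theta$ such that for every $n$, $t\mapsto N_{t\wedge\tau_{E_n}}$ is continuous and of zero quadratic variation (for a process $Y$: for every $T>0$, $\sum_{k=1}^{[rT]}(Y_{(k+1)/r}-Y_{k/r})^2\to0$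 as $r\to\infty$ in $P_m$, i.e. in probability under $P_{g\cdot m}$ for every probability density $g$ with respect to $m$). $\mathcal{M}^{[\![0,\zeta[\![}_{loc}$ is the set of local AFs $M$ that are locally square integrable martingales on $B:=[\![0,\zeta[\![$ (under $P_x$ for q.e. $x$): there are stopping times $T_n\uparrow\zeta$ with $\bigcup_n[\![0,T_n]\!]\supset B$ and locally square integrable martingales $M^n$ with $(M1_B)_{t\wedge T_n}=(M^n1_B)_{t\wedge T_n}$ for all $n$ and $t>0$. *)

theory Defs
  imports "HOL-Probability.Probability"
begin

section \<open>State spaces\<close>

definition borel_of :: "'a topology \<Rightarrow> 'a measure" where
  "borel_of T = sigma (topspace T) {U. openin T U}"

text \<open>Metrizable Lusin: homeomorphic to a Borel subset of a Polish space.  A Polish space has at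
  most continuum many points, so letting its carrier range over subsets of the type of reals
  (with an arbitrary topology) loses nothing.\<close>

definition metrizable_lusin :: "'a topology \<Rightarrow> bool" where
  "metrizable_lusin T \<longleftrightarrow>
     (\<exists>(Q :: real topology) B. completely_metrizable_space Q \<and> separable_space Q \<and>
        B \<in> sets (borel_of Q) \<and> T homeomorphic_space subtopology Q B)"

text \<open>The cemetery is \<^term>\<open>None\<close>, adjoined to the state space as an isolated point.\<close>

definition cem_top :: "'a topology \<Rightarrow> 'a option topology" where
  "cem_top T = topology (\<lambda>U. U \<subseteq> insert None (Some ` topspace T) \<and> openin T {x. Some x \<in> U})"

lemma istopology_cem_top:
  "istopology (\<lambda>U. U \<subseteq> insert None (Some ` topspace T) \<and> openin T {x. Some x \<in> U})"
proof -
  have 1: "{x. Some x \<in> U \<inter> V} = {x. Some x \<in> U} \<inter> {x. Some x \<in> V}" for U V :: "'a option set"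
    by auto
  have 2: "{x. Some x \<in> \<Union>K} = \<Union>((\<lambda>U. {x. Some x \<in> U}) ` K)" for K :: "'a option set set"
    by auto
  show ?thesis
    unfolding istopology_def 1 2 by (blast intro: openin_Int openin_Union)
qed

lemma openin_cem_top:
  "openin (cem_top T) U \<longleftrightarrow> U \<subseteq> insert None (Some ` topspace T) \<and> openin T {x. Some x \<in> U}"
  unfolding cem_top_def by (simp add: topology_inverse'[OF istopology_cem_top])

lemma topspace_cem_top: "topspace (cem_top T) = insert None (Some ` topspace T)"
proof
  show "topspace (cem_top T) \<subseteq> insert None (Some ` topspace T)"
    using openin_topspace[of "cem_top T"] unfolding openin_cem_top by blast
  have "{x. Some x \<in> insert None (Some ` topspace T)} = topspace T" by auto
  hence "openin (cem_top T) (insert None (Some ` topspace T))"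
    unfolding openin_cem_top by simp
  thus "insert None (Some ` topspace T) \<subseteq> topspace (cem_top T)"
    by (rule openin_subset)
qed

text \<open>Extension of functions by 0 at the cemetery.\<close>

abbreviation ext0 :: "('a \<Rightarrow> 'b::zero) \<Rightarrow> 'a option \<Rightarrow> 'b" where
  "ext0 f \<equiv> case_option 0 f"

definition is_law :: "'a topology \<Rightarrow> 'a option measure \<Rightarrow> bool" where
  "is_law T \<nu> \<longleftrightarrow> prob_space \<nu> \<and> sets \<nu> = sets (borel_of (cem_top T))"

definition universally_measurable :: "'a topology \<Rightarrow> ('a option \<Rightarrow> ennreal) \<Rightarrow> bool" where
  "universally_measurable T f \<longleftrightarrow> (\<forall>\<nu>. is_law T \<nu> \<longrightarrow> f \<in> borel_measurable (completion \<nu>))"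


section \<open>Semi-Dirichlet forms\<close>

text \<open>Elements of \<open>L\<^sup>2(E;m)\<close> are represented by measurable functions; domains are closed under,
  and forms and operators respect, equality \<open>m\<close>-almost everywhere.\<close>

definition L2 :: "'a measure \<Rightarrow> ('a \<Rightarrow> real) set" where
  "L2 m = {u \<in> borel_measurable m. integrable m (\<lambda>x. (u x)\<^sup>2)}"

definition l2_inner :: "'a measure \<Rightarrow> ('a \<Rightarrow> real) \<Rightarrow> ('a \<Rightarrow> real) \<Rightarrow> real" where
  "l2_inner m u v = (\<integral>x. u x * v x \<partial>m)"

definition l2_norm :: "'a measure \<Rightarrow> ('a \<Rightarrow> real) \<Rightarrow> real" where
  "l2_norm m u = sqrt (l2_inner m u u)"

record 'a form_space =
  ftop :: "'a topology"
  fmeas :: "'a measure"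
  fdom :: "('a \<Rightarrow> real) set"
  fen :: "('a \<Rightarrow> real) \<Rightarrow> ('a \<Rightarrow> real) \<Rightarrow> real"

abbreviation pts :: "'a form_space \<Rightarrow> 'a set" where
  "pts S \<equiv> topspace (ftop S)"

definition en1 :: "'a form_space \<Rightarrow> ('a \<Rightarrow> real) \<Rightarrow> ('a \<Rightarrow> real) \<Rightarrow> real" where
  "en1 S u v = fen S u v + l2_inner (fmeas S) u v"

definition en1_dense :: "'a form_space \<Rightarrow> ('a \<Rightarrow> real) set \<Rightarrow> bool" where
  "en1_dense S D0 \<longleftrightarrow>
     (\<forall>u\<in>fdom S. \<forall>\<epsilon>>0. \<exists>v\<in>D0. en1 S (\<lambda>x. u x - v x) (\<lambda>x. u x - v x) < \<epsilon>)"

definition coercive_closed_form :: "'a form_space \<Rightarrow> bool" where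
  "coercive_closed_form S \<longleftrightarrow>
     (let m = fmeas S; D = fdom S; E = fen S in
      D \<subseteq> L2 m \<and>
      (\<forall>u\<in>D. \<forall>v\<in>borel_measurable m. (AE x in m. u x = v x) \<longrightarrow> v \<in> D) \<and>
      (\<forall>u\<in>D. \<forall>v\<in>D. \<forall>u'\<in>D. \<forall>v'\<in>D.
         (AE x in m. u x = u' x) \<longrightarrow> (AE x in m. v x = v' x) \<longrightarrow> E u v = E u' v') \<and>
      (\<lambda>_. 0) \<in> D \<and>
      (\<forall>u\<in>D. \<forall>v\<in>D. \<forall>a b. (\<lambda>x. a * u x + b * v x) \<in> D) \<and>
      (\<forall>u\<in>D. \<forall>v\<in>D. \<forall>w\<in>D. \<forall>a b.
         E (\<lambda>x. a * u x + b * v x) w = a * E u w + b * E v w \<and>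
         E w (\<lambda>x. a * u x + b * v x) = a * E w u + b * E w v) \<and>
      (\<forall>f\<in>L2 m. \<forall>\<epsilon>>0. \<exists>u\<in>D. l2_norm m (\<lambda>x. f x - u x) < \<epsilon>) \<and>
      (\<forall>u\<in>D. 0 \<le> E u u) \<and>
      (\<forall>U :: nat \<Rightarrow> 'a \<Rightarrow> real. (\<forall>n. U n \<in> D) \<longrightarrow>
         (\<forall>\<epsilon>>0. \<exists>K. \<forall>i\<ge>K. \<forall>j\<ge>K. en1 S (\<lambda>x. U i x - U j x) (\<lambda>x. U i x - U j x) < \<epsilon>) \<longrightarrow>
         (\<exists>u\<in>D. (\<lambda>n. en1 S (\<lambda>x. U n x - u x) (\<lambda>x. U n x - u x)) \<longlonglongrightarrow> 0)) \<and>
      (\<exists>K>0. \<forall>u\<in>D. \<forall>v\<in>D. \<bar>en1 S u v\<bar> \<le> K * sqrt (en1 S u u) * sqrt (en1 S v v)))"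

definition unit_cut :: "('a \<Rightarrow> real) \<Rightarrow> 'a \<Rightarrow> real" where
  "unit_cut u x = min (max (u x) 0) 1"

definition semi_dirichlet_form :: "'a form_space \<Rightarrow> bool" where
  "semi_dirichlet_form S \<longleftrightarrow>
     metrizable_lusin (ftop S) \<and>
     sets (fmeas S) = sets (borel_of (ftop S)) \<and> sigma_finite_measure (fmeas S) \<and>
     coercive_closed_form S \<and>
     (\<forall>u\<in>fdom S. unit_cut u \<in> fdom S \<and>
        0 \<le> fen S (\<lambda>x. u x + unit_cut u x) (\<lambda>x. u x - unit_cut u x))"

text \<open>The semigroup of the form: the strongly continuous contraction semigroup whose generator
  \<open>L\<close> has \<open>u \<in> D(L)\<close>, \<open>L u = w\<close> iff \<open>u \<in> D(\<E>)\<close> and \<open>\<E>(u,v) = (-w,v)\<close> for all \<open>v \<in> D(\<E>)\<close>.\<close>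

definition form_semigroup ::
  "'a form_space \<Rightarrow> (real \<Rightarrow> ('a \<Rightarrow> real) \<Rightarrow> 'a \<Rightarrow> real) \<Rightarrow> bool" where
  "form_semigroup S Tt \<longleftrightarrow>
     (let m = fmeas S in
      (\<forall>t>0. \<forall>f\<in>L2 m. Tt t f \<in> L2 m \<and> l2_norm m (Tt t f) \<le> l2_norm m f) \<and>
      (\<forall>t>0. \<forall>f\<in>L2 m. \<forall>g\<in>L2 m. (AE x in m. f x = g x) \<longrightarrow> (AE x in m. Tt t f x = Tt t g x)) \<and>
      (\<forall>t>0. \<forall>f\<in>L2 m. \<forall>g\<in>L2 m. \<forall>a b.
         AE x in m. Tt t (\<lambda>y. a * f y + b * g y) x = a * Tt t f x + b * Tt t g x) \<and>
      (\<forall>t>0. \<forall>s>0. \<forall>f\<in>L2 m. AE x in m. Tt (t + s) f x = Tt t (Tt s f) x) \<and>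
      (\<forall>f\<in>L2 m. ((\<lambda>t. l2_norm m (\<lambda>x. Tt t f x - f x)) \<longlongrightarrow> 0) (at_right 0)) \<and>
      (\<forall>u\<in>L2 m. \<forall>w\<in>L2 m.
         ((\<lambda>t. l2_norm m (\<lambda>x. (Tt t u x - u x) / t - w x)) \<longlongrightarrow> 0) (at_right 0) \<longleftrightarrow>
         (u \<in> fdom S \<and> (\<forall>v\<in>fdom S. fen S u v = - l2_inner m w v))))"

text \<open>\<open>h\<close> is \<open>\<gamma>\<close>-co-excessive; in the definition \<open>w\<close> is the image of \<open>h\<close> under the adjoint of
  \<^term>\<open>Tt t\<close>.\<close>

definition co_excessive :: "'a form_space \<Rightarrow> real \<Rightarrow> ('a \<Rightarrow> real) \<Rightarrow> bool" where
  "co_excessive S \<gamma> h \<longleftrightarrow>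
     (let m = fmeas S in
      h \<in> L2 m \<and> (AE x in m. 0 \<le> h x) \<and>
      (\<exists>Tt. form_semigroup S Tt \<and>
         (\<forall>t>0. \<forall>w\<in>L2 m. (\<forall>f\<in>L2 m. l2_inner m (Tt t f) h = l2_inner m f w) \<longrightarrow>
            (AE x in m. exp (- \<gamma> * t) * w x \<le> h x))))"


section \<open>Quasi notions\<close>

definition form_nest :: "'a form_space \<Rightarrow> (nat \<Rightarrow> 'a set) \<Rightarrow> bool" where
  "form_nest S F \<longleftrightarrow>
     (\<forall>k. closedin (ftop S) (F k) \<and> F k \<subseteq> F (Suc k)) \<and>
     en1_dense S (\<Union>k. {u\<in>fdom S. AE x in fmeas S. x \<notin> F k \<longrightarrow> u x = 0})"

definition exceptional :: "'a form_space \<Rightarrow> 'a set \<Rightarrow> bool" where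
  "exceptional S N \<longleftrightarrow> (\<exists>F. form_nest S F \<and> N \<subseteq> (\<Inter>k. pts S - F k))"

definition qe :: "'a form_space \<Rightarrow> ('a \<Rightarrow> bool) \<Rightarrow> bool" where
  "qe S P \<longleftrightarrow> exceptional S {x\<in>pts S. \<not> P x}"

definition quasi_open :: "'a form_space \<Rightarrow> 'a set \<Rightarrow> bool" where
  "quasi_open S V \<longleftrightarrow> V \<subseteq> pts S \<and>
     (\<exists>F. form_nest S F \<and> (\<forall>k. openin (subtopology (ftop S) (F k)) (V \<inter> F k)))"

definition quasi_continuous :: "'a form_space \<Rightarrow> ('a \<Rightarrow> real) \<Rightarrow> bool" where
  "quasi_continuous S f \<longleftrightarrow>
     (\<exists>F. form_nest S F \<and> (\<forall>k. continuous_map (subtopology (ftop S) (F k)) euclideanreal f))"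

definition qc_version :: "'a form_space \<Rightarrow> ('a \<Rightarrow> real) \<Rightarrow> ('a \<Rightarrow> real) \<Rightarrow> bool" where
  "qc_version S u ut \<longleftrightarrow> quasi_continuous S ut \<and> (AE x in fmeas S. ut x = u x)"

definition quasi_regular :: "'a form_space \<Rightarrow> bool" where
  "quasi_regular S \<longleftrightarrow>
     (\<exists>F. form_nest S F \<and> (\<forall>k. compactin (ftop S) (F k))) \<and>
     (\<exists>D0\<subseteq>fdom S. en1_dense S D0 \<and> (\<forall>u\<in>D0. \<exists>ut. qc_version S u ut)) \<and>
     (\<exists>(U :: nat \<Rightarrow> 'a \<Rightarrow> real) Ut N. exceptional S N \<and>
        (\<forall>n. U n \<in> fdom S \<and> qc_version S (U n) (Ut n)) \<and>
        (\<forall>x\<in>pts S - N. \<forall>y\<in>pts S - N. x \<noteq> y \<longrightarrow> (\<exists>n. Ut n x \<noteq> Ut n y)))"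

definition Theta :: "'a form_space \<Rightarrow> (nat \<Rightarrow> 'a set) set" where
  "Theta S = {V. (\<forall>n. quasi_open S (V n)) \<and>
                 (\<forall>n. qe S (\<lambda>x. x \<in> V n \<longrightarrow> x \<in> V (Suc n))) \<and>
                 qe S (\<lambda>x. x \<in> (\<Union>n. V n))}"

definition dom_loc :: "'a form_space \<Rightarrow> ('a \<Rightarrow> real) set" where
  "dom_loc S = {u. \<exists>V\<in>Theta S. \<exists>U :: nat \<Rightarrow> 'a \<Rightarrow> real.
     (\<forall>n. U n \<in> fdom S \<and> (AE x in fmeas S. x \<in> V n \<longrightarrow> u x = U n x))}"

definition dom_Vb :: "'a form_space \<Rightarrow> 'a set \<Rightarrow> ('a \<Rightarrow> real) set" where
  "dom_Vb S V = {u\<in>fdom S. (\<exists>c. AE x in fmeas S. \<bar>u x\<bar> \<le> c) \<and>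
     (\<exists>ut. qc_version S u ut \<and> qe S (\<lambda>x. x \<notin> V \<longrightarrow> ut x = 0))}"

definition sup_norm :: "'a measure \<Rightarrow> ('a \<Rightarrow> real) \<Rightarrow> real" where
  "sup_norm m u = real_of_ereal (esssup m (\<lambda>x. ereal \<bar>u x\<bar>))"

definition locally_bounded :: "(real \<Rightarrow> real) \<Rightarrow> bool" where
  "locally_bounded C \<longleftrightarrow> (\<forall>r. \<exists>\<delta>>0. bounded (C ` ball r \<delta>))"

definition condition_A :: "'a form_space \<Rightarrow> bool" where
  "condition_A S \<longleftrightarrow>
     (\<exists>V\<in>Theta S. \<exists>C :: nat \<Rightarrow> real \<Rightarrow> real. \<forall>n. locally_bounded (C n) \<and>
        (\<forall>u\<in>dom_Vb S (V n). \<forall>v\<in>dom_Vb S (V n).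
           (\<lambda>x. u x * v x) \<in> fdom S \<and>
           fen S (\<lambda>x. u x * v x) (\<lambda>x. u x * v x)
             \<le> C n (sup_norm (fmeas S) u + sup_norm (fmeas S) v) * (en1 S u u + en1 S v v)))"

definition smooth_measure :: "'a form_space \<Rightarrow> 'a measure \<Rightarrow> bool" where
  "smooth_measure S \<mu> \<longleftrightarrow> sets \<mu> = sets (borel_of (ftop S)) \<and>
     (\<forall>N\<in>sets \<mu>. exceptional S N \<longrightarrow> emeasure \<mu> N = 0) \<and>
     (\<exists>F. form_nest S F \<and> (\<forall>k. compactin (ftop S) (F k) \<and> emeasure \<mu> (F k) < \<infinity>))"


section \<open>Markov processes\<close>

text \<open>Deterministic times are reals (only nonnegative ones matter), random times have values in
  \<open>[0,\<infinity>]\<close>.  \<open>amb\<close> carries the sample space and the \<open>\<sigma>\<close>-algebra on which the laws \<open>P\<^sub>x\<close>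
  live.\<close>

record ('a, 'w) process =
  amb :: "'w measure"
  path :: "real \<Rightarrow> 'w \<Rightarrow> 'a option"
  law :: "'a option \<Rightarrow> 'w measure"
  shift :: "real \<Rightarrow> 'w \<Rightarrow> 'w"

abbreviation samples :: "('a, 'w) process \<Rightarrow> 'w set" where
  "samples M \<equiv> space (amb M)"

definition path_at :: "('a, 'w) process \<Rightarrow> ennreal \<Rightarrow> 'w \<Rightarrow> 'a option" where
  "path_at M s \<omega> = (if s = \<infinity> then None else path M (enn2real s) \<omega>)"

definition stopped :: "(real \<Rightarrow> 'w \<Rightarrow> 'b) \<Rightarrow> ('w \<Rightarrow> ennreal) \<Rightarrow> real \<Rightarrow> 'w \<Rightarrow> 'b" where
  "stopped Y \<tau> t \<omega> = Y (enn2real (min (ennreal t) (\<tau> \<omega>))) \<omega>"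

definition lifetime :: "('a, 'w) process \<Rightarrow> 'w \<Rightarrow> ennreal" where
  "lifetime M \<omega> = Inf {ennreal t | t. 0 \<le> t \<and> path M t \<omega> = None}"

definition hitting_time :: "('a, 'w) process \<Rightarrow> 'a option set \<Rightarrow> 'w \<Rightarrow> ennreal" where
  "hitting_time M B \<omega> = Inf {ennreal t | t. 0 < t \<and> path M t \<omega> \<in> B}"

definition exit_time :: "('a, 'w) process \<Rightarrow> 'a set \<Rightarrow> 'w \<Rightarrow> ennreal" where
  "exit_time M B = hitting_time M (- (Some ` B))"

text \<open>\<open>P\<^sub>\<nu> = \<integral> P\<^sub>x \<nu>(dx)\<close>; the completion enters because \<open>x \<mapsto> P\<^sub>x(\<Lambda>)\<close> is only universally
  measurable.\<close>

definition law_from :: "('a, 'w) process \<Rightarrow> 'a option measure \<Rightarrow> 'w measure" where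
  "law_from M \<nu> = measure_of (samples M) (sets (amb M))
     (\<lambda>\<Lambda>. \<integral>\<^sup>+x. emeasure (law M x) \<Lambda> \<partial>completion \<nu>)"

text \<open>The law started from a measure \<open>g \<cdot> m\<close> on the state space.\<close>

definition law_dens :: "'a form_space \<Rightarrow> ('a, 'w) process \<Rightarrow> ('a \<Rightarrow> ennreal) \<Rightarrow> 'w measure" where
  "law_dens S M g = law_from M (distr (density (fmeas S) g) (borel_of (cem_top (ftop S))) Some)"

text \<open>The filtration is the minimum completed admissible one: \<open>nat_filt\<close> is the natural
  filtration, \<open>law_filt\<close> its completion under \<open>P\<^sub>\<nu>\<close>, and \<open>filt\<close> the intersection of these
  completions over all initial laws.  The index \<open>\<infinity>\<close> gives the terminal \<open>\<sigma>\<close>-algebras.\<close>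

definition nat_filt :: "'a topology \<Rightarrow> ('a, 'w) process \<Rightarrow> ennreal \<Rightarrow> 'w measure" where
  "nat_filt T M t = sigma (samples M)
     {path M s -` A \<inter> samples M | s A. 0 \<le> s \<and> ennreal s \<le> t \<and> A \<in> sets (borel_of (cem_top T))}"

definition law_filt ::
  "'a topology \<Rightarrow> ('a, 'w) process \<Rightarrow> 'a option measure \<Rightarrow> ennreal \<Rightarrow> 'w measure" where
  "law_filt T M \<nu> t = sigma (samples M)
     {A. A \<subseteq> samples M \<and>
         (\<exists>B\<in>sets (nat_filt T M t). \<exists>N\<in>sets (nat_filt T M \<infinity>).
            emeasure (law_from M \<nu>) N = 0 \<and> (A - B) \<union> (B - A) \<subseteq> N)}"

definition filt :: "'a topology \<Rightarrow> ('a, 'w) process \<Rightarrow> ennreal \<Rightarrow> 'w measure" where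
  "filt T M t = sigma (samples M) {A. \<forall>\<nu>. is_law T \<nu> \<longrightarrow> A \<in> sets (law_filt T M \<nu> t)}"

definition right_process :: "'a topology \<Rightarrow> ('a, 'w) process \<Rightarrow> bool" where
  "right_process T M \<longleftrightarrow>
     (let ET = cem_top T; BE = borel_of ET; \<Omega> = samples M in
      (\<forall>x\<in>topspace ET. prob_space (law M x) \<and> sets (law M x) = sets (amb M)) \<and>
      (\<forall>\<Lambda>\<in>sets (amb M). universally_measurable T (\<lambda>x. emeasure (law M x) \<Lambda>)) \<and>
      (\<forall>t\<ge>0. path M t \<in> measurable (amb M) BE) \<and>
      sets (filt T M \<infinity>) \<subseteq> sets (amb M) \<and>
      (\<forall>\<omega>\<in>\<Omega>. \<forall>t\<ge>0. path M t \<omega> = None \<longleftrightarrow> lifetime M \<omega> \<le> ennreal t) \<and>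
      (\<forall>\<omega>\<in>\<Omega>. \<forall>t\<ge>0. shift M t \<omega> \<in> \<Omega> \<and> (\<forall>s\<ge>0. path M s (shift M t \<omega>) = path M (s + t) \<omega>)) \<and>
      (\<forall>x\<in>topspace ET. AE \<omega> in law M x. path M 0 \<omega> = x) \<and>
      (\<forall>\<omega>\<in>\<Omega>. \<forall>t\<ge>0. limitin ET (\<lambda>s. path M s \<omega>) (path M t \<omega>) (at_right t)) \<and>
      (\<forall>t<\<infinity>. sets (filt T M t) = (\<Inter>s\<in>{t<..}. sets (filt T M s))) \<and>
      (\<forall>\<nu> \<sigma> A t. is_law T \<nu> \<longrightarrow> stopping_time (filt T M) \<sigma> \<longrightarrow> A \<in> sets BE \<longrightarrow> 0 \<le> t \<longrightarrow>
         (AE \<omega> in law_from M \<nu>.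
            real_cond_exp (law_from M \<nu>) (filtration.pre_sigma \<Omega> (filt T M) \<sigma>)
              (indicator {\<omega>'\<in>\<Omega>. path_at M (\<sigma> \<omega>' + ennreal t) \<omega>' \<in> A}) \<omega>
            = measure (law M (path_at M (\<sigma> \<omega>) \<omega>)) {\<omega>'\<in>\<Omega>. path M t \<omega>' \<in> A})))"

definition special_standard :: "'a topology \<Rightarrow> ('a, 'w) process \<Rightarrow> bool" where
  "special_standard T M \<longleftrightarrow> right_process T M \<and>
     (\<forall>\<nu>. is_law T \<nu> \<longrightarrow>
        (AE \<omega> in law_from M \<nu>. \<forall>t>0. ennreal t < lifetime M \<omega> \<longrightarrow>
           (\<exists>l\<in>topspace T. limitin (cem_top T) (\<lambda>s. path M s \<omega>) (Some l) (at_left t))) \<and>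
        (\<forall>(\<tau> :: 'w \<Rightarrow> ennreal) (\<tau>s :: nat \<Rightarrow> 'w \<Rightarrow> ennreal).
           stopping_time (law_filt T M \<nu>) \<tau> \<longrightarrow>
           (\<forall>n. stopping_time (law_filt T M \<nu>) (\<tau>s n)) \<longrightarrow>
           (\<forall>\<omega>\<in>samples M. incseq (\<lambda>n. \<tau>s n \<omega>) \<and> (\<lambda>n. \<tau>s n \<omega>) \<longlonglongrightarrow> \<tau> \<omega>) \<longrightarrow>
           (AE \<omega> in law_from M \<nu>. \<tau> \<omega> < lifetime M \<omega> \<longrightarrow>
              limitin (cem_top T) (\<lambda>n. path_at M (\<tau>s n \<omega>) \<omega>) (path_at M (\<tau> \<omega>) \<omega>) sequentially) \<and>
           (\<lambda>\<omega>. path_at M (\<tau> \<omega>) \<omega>) \<in>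
             measurable
               (sigma (samples M)
                  (\<Union>n. sets (filtration.pre_sigma (samples M) (law_filt T M \<nu>) (\<tau>s n))))
               (borel_of (cem_top T))))"

definition m_tight :: "'a form_space \<Rightarrow> ('a, 'w) process \<Rightarrow> bool" where
  "m_tight S M \<longleftrightarrow>
     (\<exists>K :: nat \<Rightarrow> 'a set. (\<forall>n. compactin (ftop S) (K n) \<and> K n \<subseteq> K (Suc n)) \<and>
        (AE x in fmeas S. AE \<omega> in law M (Some x).
           \<not> (SUP n. hitting_time M (Some ` (pts S - K n)) \<omega>) < lifetime M \<omega>))"

definition properly_associated :: "'a form_space \<Rightarrow> ('a, 'w) process \<Rightarrow> bool" where
  "properly_associated S M \<longleftrightarrow>
     (\<exists>Tt. form_semigroup S Tt \<and>
        (\<forall>f t. f \<in> borel_measurable (borel_of (ftop S)) \<longrightarrow> (\<exists>c. \<forall>x\<in>pts S. \<bar>f x\<bar> \<le> c) \<longrightarrow>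
           f \<in> L2 (fmeas S) \<longrightarrow> 0 < t \<longrightarrow>
           qc_version S (Tt t f) (\<lambda>x. \<integral>\<omega>. ext0 f (path M t \<omega>) \<partial>law M (Some x))))"


section \<open>Additive functionals\<close>

text \<open>Additive functionals take extended real values, since they are only required to be finite
  before the lifetime.\<close>

definition local_af :: "'a form_space \<Rightarrow> ('a, 'w) process \<Rightarrow> (real \<Rightarrow> 'w \<Rightarrow> ereal) \<Rightarrow> bool" where
  "local_af S M A \<longleftrightarrow>
     (\<forall>t\<ge>0. A t \<in> borel_measurable (filt (ftop S) M (ennreal t))) \<and>
     (\<exists>\<Lambda>\<in>sets (amb M). \<exists>N. exceptional S N \<and>
        (\<forall>x\<in>pts S - N. emeasure (law M (Some x)) \<Lambda> = 1) \<and>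
        (\<forall>t>0. shift M t ` \<Lambda> \<subseteq> \<Lambda>) \<and>
        (\<forall>\<omega>\<in>\<Lambda>.
           (\<forall>t>0. ((\<lambda>s. A s \<omega>) \<longlongrightarrow> A t \<omega>) (at_right t)) \<and>
           (\<forall>t>0. ennreal t < lifetime M \<omega> \<longrightarrow> (\<exists>l. ((\<lambda>s. A s \<omega>) \<longlongrightarrow> ereal l) (at_left t))) \<and>
           A 0 \<omega> = 0 \<and>
           (\<forall>t\<ge>0. ennreal t < lifetime M \<omega> \<longrightarrow> \<bar>A t \<omega>\<bar> < \<infinity>) \<and>
           (\<forall>t\<ge>0. lifetime M \<omega> \<le> ennreal t \<longrightarrow> A t \<omega> = A (enn2real (lifetime M \<omega>)) \<omega>) \<and>
           (\<forall>t\<ge>0. \<forall>s\<ge>0. ennreal (t + s) < lifetime M \<omega> \<longrightarrow>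
              A (t + s) \<omega> = A t \<omega> + A s (shift M t \<omega>))))"

definition af_equivalent ::
  "'a form_space \<Rightarrow> ('a, 'w) process \<Rightarrow> (real \<Rightarrow> 'w \<Rightarrow> ereal) \<Rightarrow> (real \<Rightarrow> 'w \<Rightarrow> ereal) \<Rightarrow> bool" where
  "af_equivalent S M A B \<longleftrightarrow>
     qe S (\<lambda>x. \<forall>t\<ge>0.
       emeasure (law M (Some x)) {\<omega>\<in>samples M. A t \<omega> = B t \<omega> \<and> ennreal t < lifetime M \<omega>}
       = emeasure (law M (Some x)) {\<omega>\<in>samples M. ennreal t < lifetime M \<omega>})"

text \<open>Convergence to 0 in probability under \<open>P\<^bsub>g\<cdot>m\<^esub>\<close> for every probability density \<open>g\<close>.  The
  outer measure is used because exit times from quasi-open (possibly non-Borel) sets need only be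
  measurable up to \<open>P\<^bsub>g\<cdot>m\<^esub>\<close>-null sets.\<close>

definition zero_quadratic_variation ::
  "'a form_space \<Rightarrow> ('a, 'w) process \<Rightarrow> (real \<Rightarrow> 'w \<Rightarrow> ereal) \<Rightarrow> bool" where
  "zero_quadratic_variation S M Y \<longleftrightarrow>
     (\<forall>g :: 'a \<Rightarrow> ennreal. g \<in> borel_measurable (fmeas S) \<longrightarrow> (\<integral>\<^sup>+x. g x \<partial>fmeas S) = 1 \<longrightarrow>
       (\<forall>T>0. \<forall>\<epsilon>>0.
         ((\<lambda>r :: real. outer_measure_of (law_dens S M g)
             {\<omega>\<in>samples M.
                ereal \<epsilon> < (\<Sum>k=1..nat \<lfloor>r * T\<rfloor>. (Y (real (k + 1) / r) \<omega> - Y (real k / r) \<omega>)\<^sup>2)})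
          \<longlongrightarrow> 0) at_top))"

definition class_Lc :: "'a form_space \<Rightarrow> ('a, 'w) process \<Rightarrow> (real \<Rightarrow> 'w \<Rightarrow> ereal) set" where
  "class_Lc S M = {N. local_af S M N \<and>
     (\<exists>E\<in>Theta S. \<forall>n.
        qe S (\<lambda>x. AE \<omega> in law M (Some x).
                continuous_on {0..} (\<lambda>t. stopped N (exit_time M (E n)) t \<omega>)) \<and>
        zero_quadratic_variation S M (stopped N (exit_time M (E n))))}"


section \<open>Martingales\<close>

text \<open>Here \<open>F\<close> is a filtration indexed by \<open>[0,\<infinity>]\<close> and processes are indexed by real time.\<close>

definition cadlag :: "(real \<Rightarrow> real) \<Rightarrow> bool" where
  "cadlag y \<longleftrightarrow> (\<forall>t\<ge>0. (y \<longlongrightarrow> y t) (at_right t)) \<and> (\<forall>t>0. \<exists>l. (y \<longlongrightarrow> l) (at_left t))"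

definition martingale :: "'w measure \<Rightarrow> (ennreal \<Rightarrow> 'w measure) \<Rightarrow> (real \<Rightarrow> 'w \<Rightarrow> real) \<Rightarrow> bool" where
  "martingale P F Y \<longleftrightarrow>
     (\<forall>t\<ge>0. Y t \<in> borel_measurable (F (ennreal t)) \<and> integrable P (Y t)) \<and>
     (AE \<omega> in P. cadlag (\<lambda>t. Y t \<omega>)) \<and>
     (\<forall>s\<ge>0. \<forall>t\<ge>s. AE \<omega> in P. real_cond_exp P (F (ennreal s)) (Y t) \<omega> = Y s \<omega>)"

definition square_integrable_martingale ::
  "'w measure \<Rightarrow> (ennreal \<Rightarrow> 'w measure) \<Rightarrow> (real \<Rightarrow> 'w \<Rightarrow> real) \<Rightarrow> bool" where
  "square_integrable_martingale P F Y \<longleftrightarrow> martingale P F Y \<and>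
     (\<exists>c. \<forall>t\<ge>0. integrable P (\<lambda>\<omega>. (Y t \<omega>)\<^sup>2) \<and> (\<integral>\<omega>. (Y t \<omega>)\<^sup>2 \<partial>P) \<le> c)"

definition locally_square_integrable_martingale ::
  "'w measure \<Rightarrow> (ennreal \<Rightarrow> 'w measure) \<Rightarrow> (real \<Rightarrow> 'w \<Rightarrow> real) \<Rightarrow> bool" where
  "locally_square_integrable_martingale P F Y \<longleftrightarrow>
     (\<forall>t\<ge>0. Y t \<in> borel_measurable (F (ennreal t))) \<and>
     (AE \<omega> in P. cadlag (\<lambda>t. Y t \<omega>)) \<and>
     (\<exists>R :: nat \<Rightarrow> 'w \<Rightarrow> ennreal. (\<forall>k. stopping_time F (R k)) \<and>
        (AE \<omega> in P. incseq (\<lambda>k. R k \<omega>) \<and> (SUP k. R k \<omega>) = \<infinity>) \<and>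
        (\<forall>k. square_integrable_martingale P F (\<lambda>t \<omega>. stopped Y (R k) t \<omega> - Y 0 \<omega>)))"

text \<open>\<open>Y 1\<^sub>B\<close> for \<open>B = \<lbrakk>0,\<zeta>\<lbrakk>\<close>.\<close>

definition restrict_life :: "('w \<Rightarrow> ennreal) \<Rightarrow> (real \<Rightarrow> 'w \<Rightarrow> ereal) \<Rightarrow> real \<Rightarrow> 'w \<Rightarrow> ereal" where
  "restrict_life \<zeta> Y t \<omega> = (if ennreal t < \<zeta> \<omega> then Y t \<omega> else 0)"

definition lsi_martingale_on_life ::
  "'w measure \<Rightarrow> (ennreal \<Rightarrow> 'w measure) \<Rightarrow> ('w \<Rightarrow> ennreal) \<Rightarrow> (real \<Rightarrow> 'w \<Rightarrow> ereal) \<Rightarrow> bool" where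
  "lsi_martingale_on_life P F \<zeta> Y \<longleftrightarrow>
     (\<exists>(R :: nat \<Rightarrow> 'w \<Rightarrow> ennreal) (Z :: nat \<Rightarrow> real \<Rightarrow> 'w \<Rightarrow> real).
        (\<forall>n. stopping_time F (R n)) \<and>
        (AE \<omega> in P. incseq (\<lambda>n. R n \<omega>) \<and> (\<lambda>n. R n \<omega>) \<longlonglongrightarrow> \<zeta> \<omega> \<and>
           (\<forall>t\<ge>0. ennreal t < \<zeta> \<omega> \<longrightarrow> (\<exists>n. ennreal t \<le> R n \<omega>))) \<and>
        (\<forall>n. locally_square_integrable_martingale P F (Z n)) \<and>
        (AE \<omega> in P. \<forall>n. \<forall>t>0.
           stopped (restrict_life \<zeta> Y) (R n) t \<omega>
           = stopped (restrict_life \<zeta> (\<lambda>s \<omega>. ereal (Z n s \<omega>))) (R n) t \<omega>))"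

definition class_Mloc :: "'a form_space \<Rightarrow> ('a, 'w) process \<Rightarrow> (real \<Rightarrow> 'w \<Rightarrow> ereal) set" where
  "class_Mloc S M = {Y. local_af S M Y \<and>
     qe S (\<lambda>x. lsi_martingale_on_life (law M (Some x)) (filt (ftop S) M) (lifetime M) Y)}"


section \<open>Levy systems, Revuz measures and the jump measure\<close>

definition pcaf :: "'a form_space \<Rightarrow> ('a, 'w) process \<Rightarrow> (real \<Rightarrow> 'w \<Rightarrow> ereal) \<Rightarrow> bool" where
  "pcaf S M A \<longleftrightarrow>
     (\<forall>t\<ge>0. A t \<in> borel_measurable (filt (ftop S) M (ennreal t))) \<and>
     (\<exists>\<Lambda>\<in>sets (amb M). \<exists>N. exceptional S N \<and>
        (\<forall>x\<in>pts S - N. emeasure (law M (Some x)) \<Lambda> = 1) \<and>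
        (\<forall>t>0. shift M t ` \<Lambda> \<subseteq> \<Lambda>) \<and>
        (\<forall>\<omega>\<in>\<Lambda>.
           continuous_on {0..} (\<lambda>t. A t \<omega>) \<and> (\<forall>t\<ge>0. 0 \<le> A t \<omega>) \<and>
           A 0 \<omega> = 0 \<and>
           (\<forall>t\<ge>0. ennreal t < lifetime M \<omega> \<longrightarrow> A t \<omega> < \<infinity>) \<and>
           (\<forall>t\<ge>0. lifetime M \<omega> \<le> ennreal t \<longrightarrow> A t \<omega> = A (enn2real (lifetime M \<omega>)) \<omega>) \<and>
           (\<forall>t\<ge>0. \<forall>s\<ge>0. A (t + s) \<omega> = A t \<omega> + A s (shift M t \<omega>))))"

text \<open>The Stieltjes integral \<open>\<integral>\<^sub>0\<^sup>t f(s) dA\<^sub>s\<close> of a positive continuous additive functional.  As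
  \<open>A\<close> may become infinite at the lifetime, the integral is taken over \<open>(0,r]\<close> with
  \<open>r \<le> t\<close>, \<open>r < \<zeta>\<close> and the supremum over \<open>r\<close> is formed.  Nothing is lost, since \<open>dA\<close> has no
  atom at \<open>\<zeta>\<close> and vanishes after it.\<close>

definition af_integral ::
  "('a, 'w) process \<Rightarrow> (real \<Rightarrow> 'w \<Rightarrow> ereal) \<Rightarrow> (real \<Rightarrow> ennreal) \<Rightarrow> real \<Rightarrow> 'w \<Rightarrow> ennreal" where
  "af_integral M A f t \<omega> =
     (SUP r\<in>{r. 0 \<le> r \<and> r \<le> t \<and> ennreal r < lifetime M \<omega>}.
        \<integral>\<^sup>+s\<in>{0<..r}. f s
          \<partial>interval_measure (\<lambda>s. real_of_ereal (A (min (max s 0) r) \<omega>)))"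

text \<open>Contribution \<open>f(X\<^bsub>s-\<^esub>, X\<^sub>s)\<close> of time \<open>s\<close>.  The left limit exists at all \<open>s < \<zeta>\<close> almost
  surely; should it fail to exist at \<open>s = \<zeta>\<close> then there is no contribution.\<close>

definition jump_term ::
  "'a topology \<Rightarrow> ('a, 'w) process \<Rightarrow> ('a option \<times> 'a option \<Rightarrow> ennreal) \<Rightarrow> 'w \<Rightarrow> real \<Rightarrow> ennreal" where
  "jump_term T M f \<omega> s =
     (if \<exists>l. limitin (cem_top T) (\<lambda>r. path M r \<omega>) l (at_left s)
      then f (THE l. limitin (cem_top T) (\<lambda>r. path M r \<omega>) l (at_left s), path M s \<omega>)
      else 0)"

definition levy_system ::
  "'a form_space \<Rightarrow> ('a, 'w) process \<Rightarrow> ('a option \<Rightarrow> 'a option measure) \<Rightarrow>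
     (real \<Rightarrow> 'w \<Rightarrow> ereal) \<Rightarrow> bool" where
  "levy_system S M Nk H \<longleftrightarrow>
     (let ET = cem_top (ftop S); BE = borel_of ET in
      pcaf S M H \<and>
      (\<forall>x\<in>topspace ET. sets (Nk x) = sets BE \<and> emeasure (Nk x) {x} = 0) \<and>
      (\<forall>A\<in>sets BE. (\<lambda>x. emeasure (Nk x) A) \<in> borel_measurable BE) \<and>
      qe S (\<lambda>x. \<forall>f t. f \<in> borel_measurable (BE \<Otimes>\<^sub>M BE) \<longrightarrow> (\<forall>z. f (z, z) = 0) \<longrightarrow> 0 \<le> t \<longrightarrow>
        (\<integral>\<^sup>+\<omega>. (\<integral>\<^sup>+s. jump_term (ftop S) M f \<omega> s \<partial>count_space {0<..t}) \<partial>law M (Some x))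
        = (\<integral>\<^sup>+\<omega>. af_integral M H (\<lambda>s. \<integral>\<^sup>+y. f (path M s \<omega>, y) \<partial>Nk (path M s \<omega>)) t \<omega>
             \<partial>law M (Some x))))"

text \<open>Revuz correspondence between smooth measures and positive continuous additive functionals:
  \<open>lim\<^bsub>t\<down>0\<^esub> E\<^bsub>h\<cdot>m\<^esub>[\<integral>\<^sub>0\<^sup>t f(X\<^sub>s) dA\<^sub>s] / t = \<integral> f h d\<mu>\<close> for all Borel \<open>f \<ge> 0\<close> and all
  \<open>\<gamma>\<close>-co-excessive \<open>h\<close> in the domain, \<open>\<gamma> \<ge> 0\<close>.\<close>

definition revuz_measure ::
  "'a form_space \<Rightarrow> ('a, 'w) process \<Rightarrow> (real \<Rightarrow> 'w \<Rightarrow> ereal) \<Rightarrow> 'a measure \<Rightarrow> bool" where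
  "revuz_measure S M A \<mu> \<longleftrightarrow> smooth_measure S \<mu> \<and>
     (\<forall>\<gamma>\<ge>0. \<forall>h\<in>fdom S. \<forall>ht. \<forall>f :: 'a \<Rightarrow> ennreal.
        co_excessive S \<gamma> h \<longrightarrow> qc_version S h ht \<longrightarrow>
        ht \<in> borel_measurable (borel_of (ftop S)) \<longrightarrow>
        f \<in> borel_measurable (borel_of (ftop S)) \<longrightarrow>
        ((\<lambda>t. (\<integral>\<^sup>+\<omega>. af_integral M A (\<lambda>s. ext0 f (path M s \<omega>)) t \<omega>
                 \<partial>law_dens S M (\<lambda>x. ennreal (h x))) / ennreal t)
         \<longlongrightarrow> (\<integral>\<^sup>+x. f x * ennreal (ht x) \<partial>\<mu>)) (at_right 0))"

text \<open>\<open>J(dy,dx) = N(x,dy) \<mu>\<^sub>H(dx)\<close>; the first coordinate is \<open>y\<close>, the second is \<open>x\<close>.\<close>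

definition jump_measure :: "'a form_space \<Rightarrow> ('a, 'w) process \<Rightarrow> ('a \<times> 'a) measure \<Rightarrow> bool" where
  "jump_measure S M J \<longleftrightarrow>
     sets J = sets (borel_of (ftop S) \<Otimes>\<^sub>M borel_of (ftop S)) \<and>
     (\<exists>Nk H \<mu>H. levy_system S M Nk H \<and> revuz_measure S M H \<mu>H \<and>
        (\<forall>C\<in>sets J. emeasure J C
           = (\<integral>\<^sup>+x. emeasure (Nk (Some x)) (Some ` {y. (y, x) \<in> C}) \<partial>\<mu>H)))"

text \<open>The measure \<open>B \<mapsto> \<integral>\<^sub>B \<integral>\<^sub>E (u(x) - u(y))\<^sup>2 J(dy,dx)\<close>.\<close>

definition jump_energy :: "'a form_space \<Rightarrow> ('a \<times> 'a) measure \<Rightarrow> ('a \<Rightarrow> real) \<Rightarrow> 'a measure" where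
  "jump_energy S J u =
     distr (density J (\<lambda>(y, x). ennreal ((u x - u y)\<^sup>2))) (borel_of (ftop S)) snd"

definition decomposition ::
  "'a form_space \<Rightarrow> ('a, 'w) process \<Rightarrow> ('a \<Rightarrow> real) \<Rightarrow>
     (real \<Rightarrow> 'w \<Rightarrow> ereal) \<Rightarrow> (real \<Rightarrow> 'w \<Rightarrow> ereal) \<Rightarrow> bool" where
  "decomposition S M u Y N \<longleftrightarrow>
     qe S (\<lambda>x. AE \<omega> in law M (Some x). \<forall>t\<ge>0.
       ereal (ext0 u (path M t \<omega>) - ext0 u (path M 0 \<omega>)) = Y t \<omega> + N t \<omega>)"

end

theory Submission
  imports Defs
begin

text \<open>The state space is a single point, killed at an exponential time \<open>\<zeta>\<close> of rate 1; the form is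
  \<open>\<E>(u,v) = u(0) v(0)\<close>.  The process \<open>1{\<zeta> \<le> t} - (t \<and> \<zeta>)\<close> is a martingale, and strictly
  before \<open>\<zeta>\<close> it equals \<open>- (t \<and> \<zeta>)\<close>.  Since a martingale on \<open>\<lbrakk>0,\<zeta>\<lbrakk>\<close> is only
  tested before \<open>\<zeta>\<close>, the continuous functional \<open>- (t \<and> \<zeta>)\<close> of bounded variation is such a
  martingale, while \<open>t \<and> \<zeta>\<close> has zero quadratic variation.  So already \<open>u = 0\<close> has the two
  decompositions \<open>0 = - (t \<and> \<zeta>) + (t \<and> \<zeta>)\<close> and \<open>0 = 0 + 0\<close>.\<close>

section \<open>The Dirichlet form of a single killed point\<close>

text \<open>On one point only the empty set is exceptional, so every quasi-everywhere statement is a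
  statement at 0 and the analytic side is algebra with the numbers u(0). The obstacle is
  probabilistic: the filtrations are completed under all initial laws. What tames them is that all
  sample points beyond t give the same path up to time t. Hence an event of time t is trivial on t <
  \<zeta>, stopping times are almost surely constant before \<zeta>, and the strong Markov property
  shrinks to the memoryless property. Rate 1 is forced by the form: its generator is multiplication
  by -1, its semigroup multiplication by exp(-t). Killing is the only jump and leads to the
  cemetery, so J = 0 although the Levy system is not zero. The localising times may all be equal to
  \<zeta>, because the restricted processes are set to 0 there; the jump that would tell the
  martingale from the continuous functional is erased.\<close>

lemma sets_borel_of_discrete: "sets (borel_of (discrete_topology X)) = Pow X"
proof -
  have "sigma_sets X (Pow X) = Pow X"
    by (rule sigma_algebra.sigma_sets_eq[OF sigma_algebra_Pow])
  moreover have "{U. openin (discrete_topology X) U} = Pow X" by auto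
  ultimately show ?thesis by (simp add: borel_of_def)
qed

lemma space_borel_of: "space (borel_of T) = topspace T"
  using openin_subset by (auto simp: borel_of_def space_measure_of_conv)

lemma cem_top_discrete:
  "cem_top (discrete_topology X) = discrete_topology (insert None (Some ` X))"
  by (rule topology_eq[THEN iffD2]) (auto simp: openin_cem_top)

text \<open>The carrier type is all of \<open>real\<close>, but two functions agree almost
  everywhere as soon as they agree at 0. So \<open>fdom\<close> is \<open>UNIV\<close>, and the
  energy is a pure killing term of rate 1.\<close>

definition killed_point_form :: "real form_space" where
  "killed_point_form =
     \<lparr>ftop = discrete_topology {0}, fmeas = count_space {0}, fdom = UNIV, fen = (\<lambda>u v. u 0 * v 0)\<rparr>"

lemma killed_point_form_simps [simp]:
  "ftop killed_point_form = discrete_topology {0}"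
  "fmeas killed_point_form = count_space {0}"
  "fdom killed_point_form = UNIV"
  "fen killed_point_form = (\<lambda>u v. u 0 * v 0)"
  by (simp_all add: killed_point_form_def)

lemma AE_count_space_point [simp]: "(AE x in count_space {a}. P x) \<longleftrightarrow> P a"
  by (simp add: AE_count_space)

lemma AE_killed_point_form [simp]: "(AE x in fmeas killed_point_form. P x) \<longleftrightarrow> P 0"
  unfolding killed_point_form_simps by (rule AE_count_space_point)

lemma L2_point [simp]: "L2 (count_space {a}) = UNIV"
  by (auto simp: L2_def integrable_count_space)

lemma l2_inner_point [simp]: "l2_inner (count_space {a}) u v = u a * v a"
  by (simp add: l2_inner_def lebesgue_integral_count_space_finite)

lemma l2_norm_point [simp]: "l2_norm (count_space {a}) u = \<bar>u a\<bar>"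
  by (simp add: l2_norm_def)

lemma en1_killed_point [simp]: "en1 killed_point_form u v = 2 * (u 0 * v 0)"
  by (simp add: en1_def)

lemma metrizable_lusin_point: "metrizable_lusin (discrete_topology {a :: real})"
  unfolding metrizable_lusin_def
proof (intro exI conjI)
  show "completely_metrizable_space (discrete_topology {a})"
    by (rule completely_metrizable_space_discrete_topology)
  show "separable_space (discrete_topology {a})"
    by (simp add: separable_space_discrete_topology)
  show "{a} \<in> sets (borel_of (discrete_topology {a}))"
    by (simp add: sets_borel_of_discrete)
  show "discrete_topology {a} homeomorphic_space subtopology (discrete_topology {a}) {a}"
    by (simp add: subtopology_discrete_topology homeomorphic_space_refl)
qed

lemma coercive_killed_point: "coercive_closed_form killed_point_form"
proof -
  have closed: "\<exists>u :: real \<Rightarrow> real. (\<lambda>n. 2 * ((U n 0 - u 0) * (U n 0 - u 0))) \<longlonglongrightarrow> 0"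
    if cauchy: "\<forall>\<epsilon>>0. \<exists>K. \<forall>i\<ge>K. \<forall>j\<ge>K. 2 * ((U i 0 - U j 0) * (U i 0 - U j 0)) < \<epsilon>"
    for U :: "nat \<Rightarrow> real \<Rightarrow> real"
  proof -
    have "Cauchy (\<lambda>n. U n 0)"
    proof (rule metric_CauchyI)
      fix e :: real assume "e > 0"
      \<comment> \<open>The tolerance is the square of e because \<open>en1\<close> is quadratic in
        the difference.\<close>
      then obtain K where K: "\<forall>i\<ge>K. \<forall>j\<ge>K. 2 * ((U i 0 - U j 0) * (U i 0 - U j 0)) < e\<^sup>2"
        using cauchy[rule_format, of "e\<^sup>2"] by auto
      have "dist (U i 0) (U j 0) < e" if "i \<ge> K" "j \<ge> K" for i j
      proof -
        have "2 * (U i 0 - U j 0)\<^sup>2 < e\<^sup>2" using K that by (simp add: power2_eq_square)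
        hence "\<bar>U i 0 - U j 0\<bar>\<^sup>2 < e\<^sup>2" using zero_le_power2[of "U i 0 - U j 0"]
          unfolding power2_abs by linarith
        thus ?thesis using \<open>e > 0\<close> by (simp add: dist_real_def power2_less_imp_less)
      qed
      thus "\<exists>M. \<forall>m\<ge>M. \<forall>n\<ge>M. dist (U m 0) (U n 0) < e" by blast
    qed
    then obtain l where "(\<lambda>n. U n 0) \<longlonglongrightarrow> l"
      using Cauchy_convergent convergent_def by blast
    hence "(\<lambda>n. 2 * ((U n 0 - l) * (U n 0 - l))) \<longlonglongrightarrow> 2 * ((l - l) * (l - l))"
      by (intro tendsto_intros)
    thus ?thesis by (intro exI[of _ "\<lambda>_. l"]) simp
  qed
  have dense: "\<exists>u :: real \<Rightarrow> real. \<bar>f 0 - u 0\<bar> < \<epsilon>" if "\<epsilon> > 0" for f :: "real \<Rightarrow> real" and \<epsilon>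
    using that by (intro exI[of _ f]) simp
  have CS: "\<bar>2 * (u 0 * v 0)\<bar> \<le> 1 * sqrt (2 * (u 0 * u 0)) * sqrt (2 * (v 0 * v 0))"
    for u v :: "real \<Rightarrow> real"
  proof -
    have "1 * sqrt (2 * (u 0 * u 0)) * sqrt (2 * (v 0 * v 0)) = (sqrt 2 * sqrt 2) * (\<bar>u 0\<bar> * \<bar>v 0\<bar>)"
      unfolding real_sqrt_mult real_sqrt_mult_self by (simp only: ac_simps) simp
    thus ?thesis by (simp add: abs_mult)
  qed
  have sector: "\<exists>K>0. \<forall>u v :: real \<Rightarrow> real. \<bar>2 * (u 0 * v 0)\<bar> \<le> K * sqrt (2 * (u 0 * u 0)) * sqrt (2 * (v 0 * v 0))"
    by (intro exI[of _ 1] conjI allI zero_less_one CS)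
  show ?thesis
    unfolding coercive_closed_form_def Let_def
    using sector closed dense
    by (simp add: algebra_simps)
qed

text \<open>The contraction inequality is a difference of squares, and cutting to the unit interval
  cannot increase the modulus.\<close>

lemma semi_dirichlet_killed_point: "semi_dirichlet_form killed_point_form"
proof -
  have "0 \<le> (u 0 + unit_cut u 0) * (u 0 - unit_cut u 0)" for u :: "real \<Rightarrow> real"
  proof -
    have "\<bar>unit_cut u 0\<bar> \<le> \<bar>u 0\<bar>" by (auto simp: unit_cut_def)
    hence "(unit_cut u 0)\<^sup>2 \<le> (u 0)\<^sup>2" by (simp add: abs_le_square_iff)
    thus ?thesis by (simp add: power2_eq_square algebra_simps)
  qed
  thus ?thesis
    unfolding semi_dirichlet_form_def
    using metrizable_lusin_point coercive_killed_point
    by (simp add: sets_borel_of_discrete sigma_finite_measure_count_space_finite)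
qed

section \<open>Nests, exceptional sets and quasi-regularity on one point\<close>

lemma form_nest_const: "form_nest killed_point_form (\<lambda>_. {0})"
proof -
  have "\<exists>v :: real \<Rightarrow> real. 2 * ((u 0 - v 0) * (u 0 - v 0)) < \<epsilon>" if "\<epsilon> > 0" for u :: "real \<Rightarrow> real" and \<epsilon>
    by (rule exI[of _ u]) (simp add: that)
  thus ?thesis by (simp add: form_nest_def en1_dense_def)
qed

text \<open>If no member of the nest contained 0, all functions supported by the nest would vanish
  at 0, and the constant 1 would stay at squared \<open>en1\<close> distance 2 from them.\<close>

lemma form_nest_point:
  assumes "form_nest killed_point_form F" shows "\<exists>k. 0 \<in> F k"
proof (rule ccontr)
  assume "\<not> ?thesis"
  moreover have "\<exists>v\<in>(\<Union>k. {u :: real \<Rightarrow> real. 0 \<notin> F k \<longrightarrow> u 0 = 0}). 2 * ((1 - v 0) * (1 - v 0)) < (1::real)"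
    using assms unfolding form_nest_def en1_dense_def
    by (auto dest!: spec[of _ "\<lambda>_. 1"] dest: spec[of _ "1::real"])
  ultimately show False by auto
qed

text \<open>This collapses the quasi notions: the point has positive capacity, so nothing but the
  empty set can be neglected.\<close>

lemma exceptional_killed_point [simp]: "exceptional killed_point_form N \<longleftrightarrow> N = {}"
proof
  assume "exceptional killed_point_form N"
  then obtain F where F: "form_nest killed_point_form F" "N \<subseteq> (\<Inter>k. {0} - F k)"
    by (auto simp: exceptional_def)
  show "N = {}" using form_nest_point[OF F(1)] F(2) by auto
next
  assume "N = {}"
  thus "exceptional killed_point_form N"
    unfolding exceptional_def using form_nest_const by blast
qed

lemma qe_killed_point [simp]: "qe killed_point_form P \<longleftrightarrow> P 0"
  by (auto simp: qe_def)

lemma quasi_open_killed_point: "quasi_open killed_point_form {0}"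
  unfolding quasi_open_def
  by (intro conjI exI[of _ "\<lambda>_. {0}"] form_nest_const) (auto simp: subtopology_discrete_topology)

lemma quasi_continuous_killed_point: "quasi_continuous killed_point_form f"
  unfolding quasi_continuous_def
  by (intro exI[of _ "\<lambda>_. {0}"] conjI form_nest_const)
    (auto simp: subtopology_discrete_topology continuous_map_def)

lemma qc_version_killed_point [simp]: "qc_version killed_point_form u v \<longleftrightarrow> v 0 = u 0"
  by (simp add: qc_version_def quasi_continuous_killed_point)

lemma Theta_killed_point: "(\<lambda>_. {0}) \<in> Theta killed_point_form"
  by (simp add: Theta_def quasi_open_killed_point)

lemma quasi_regular_killed_point: "quasi_regular killed_point_form"
  unfolding quasi_regular_def
proof (intro conjI)
  show "\<exists>F. form_nest killed_point_form F \<and> (\<forall>k. compactin (ftop killed_point_form) (F k))"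
    using form_nest_const by (auto simp: compactin_discrete_topology intro!: exI[of _ "\<lambda>_. {0}"])
  show "\<exists>D0\<subseteq>fdom killed_point_form. en1_dense killed_point_form D0 \<and>
          (\<forall>u\<in>D0. \<exists>ut. qc_version killed_point_form u ut)"
    using form_nest_const by (intro exI[of _ UNIV]) (auto simp: form_nest_def)
  show "\<exists>(U :: nat \<Rightarrow> real \<Rightarrow> real) Ut N. exceptional killed_point_form N \<and>
        (\<forall>n. U n \<in> fdom killed_point_form \<and> qc_version killed_point_form (U n) (Ut n)) \<and>
        (\<forall>x\<in>pts killed_point_form - N. \<forall>y\<in>pts killed_point_form - N. x \<noteq> y \<longrightarrow> (\<exists>n. Ut n x \<noteq> Ut n y))"
    \<comment> \<open>Separation of points is vacuous here, so the zero functions do.\<close>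
    by (intro exI[of _ "\<lambda>_ _. 0"] exI[of _ "{}"]) simp
qed

section \<open>Condition (A), the local domain and smooth measures\<close>

lemma sup_norm_point: "sup_norm (count_space {a}) u = \<bar>u a\<bar>"
proof -
  have "esssup (count_space {a}) (\<lambda>x. ereal \<bar>u x\<bar>) = esssup (count_space {a}) (\<lambda>_. ereal \<bar>u a\<bar>)"
    by (rule esssup_AE_cong) auto
  also have "\<dots> = ereal \<bar>u a\<bar>"
    by (rule esssup_const) simp
  finally show ?thesis by (simp add: sup_norm_def)
qed

lemma condition_A_killed_point: "condition_A killed_point_form"
  unfolding condition_A_def
\<comment> \<open>The energy of the product is the square of u(0) v(0), bounded by the squared sup
  norm of u times the energy of v; hence the choice of r squared.\<close>
proof (intro bexI[OF _ Theta_killed_point] exI[of _ "\<lambda>_ r. r\<^sup>2"] allI conjI ballI)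
  show "locally_bounded (\<lambda>r. r\<^sup>2)"
    unfolding locally_bounded_def
  proof
    fix r :: real
    have "compact ((\<lambda>r. r\<^sup>2) ` cball r 1)"
      by (intro compact_continuous_image continuous_intros) simp
    hence "bounded ((\<lambda>r. r\<^sup>2) ` ball r 1)"
      by (meson bounded_subset compact_imp_bounded image_mono ball_subset_cball)
    thus "\<exists>\<delta>>0. bounded ((\<lambda>r. r\<^sup>2) ` ball r \<delta>)" using zero_less_one by blast
  qed
next
  fix u v :: "real \<Rightarrow> real"
  have "(u 0 * v 0) * (u 0 * v 0) = \<bar>u 0\<bar>\<^sup>2 * (v 0 * v 0)"
    by (simp add: power2_eq_square)
  also have "\<dots> \<le> (\<bar>u 0\<bar> + \<bar>v 0\<bar>)\<^sup>2 * (2 * (u 0 * u 0) + 2 * (v 0 * v 0))"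
    by (intro mult_mono power_mono) auto
  finally show "fen killed_point_form (\<lambda>x. u x * v x) (\<lambda>x. u x * v x)
      \<le> (sup_norm (fmeas killed_point_form) u + sup_norm (fmeas killed_point_form) v)\<^sup>2 *
        (en1 killed_point_form u u + en1 killed_point_form v v)"
    by (simp add: sup_norm_point)
qed simp

lemma dom_loc_killed_point: "u \<in> dom_loc killed_point_form"
  unfolding dom_loc_def using Theta_killed_point by (auto intro!: bexI exI[of _ "\<lambda>_. u"])

text \<open>Since only the empty set is exceptional, smoothness amounts to finite mass of the
  compact set {0}.\<close>

lemma smooth_killed_point:
  assumes "sets \<mu> = Pow {0}" "emeasure \<mu> {0} < \<infinity>"
  shows "smooth_measure killed_point_form \<mu>"
  unfolding smooth_measure_def using assms form_nest_const
  by (auto simp: sets_borel_of_discrete compactin_discrete_topology intro!: exI[of _ "\<lambda>_. {0}"])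

lemma form_semigroup_killed_point:
  "form_semigroup killed_point_form (\<lambda>t f x. exp (- t) * f x)"
proof -
  have lim: "((\<lambda>t::real. (exp (- t) - 1) / t) \<longlongrightarrow> -1) (at_right 0)"
  proof -
    have "((\<lambda>t::real. exp (- t)) has_field_derivative -1) (at 0)"
      by (auto intro!: derivative_eq_intros)
    hence "((\<lambda>t::real. (exp (- t) - 1) / t) \<longlongrightarrow> -1) (at 0)"
      by (simp add: has_field_derivative_iff)
    thus ?thesis by (rule tendsto_mono[OF at_le, rotated]) simp
  qed
  \<comment> \<open>The difference quotient tends to - u(0), so w is the image of u under the
    generator iff w(0) = - u(0). The form identity yields the same equation when tested with the
    constant 1.\<close>
  have gen: "((\<lambda>t. \<bar>(exp (- t) * u 0 - u 0) / t - w 0\<bar>) \<longlongrightarrow> 0) (at_right 0) \<longleftrightarrow>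
      (\<forall>v :: real \<Rightarrow> real. u 0 * v 0 = - (w 0 * v 0))" for u w :: "real \<Rightarrow> real"
  proof -
    have "((\<lambda>t. \<bar>u 0 * ((exp (- t) - 1) / t) - w 0\<bar>) \<longlongrightarrow> \<bar>u 0 * (-1) - w 0\<bar>) (at_right 0)"
      by (intro tendsto_intros lim)
    hence *: "((\<lambda>t. \<bar>(exp (- t) * u 0 - u 0) / t - w 0\<bar>) \<longlongrightarrow> \<bar>- u 0 - w 0\<bar>) (at_right 0)"
      by (simp add: algebra_simps)
    have "((\<lambda>t. \<bar>(exp (- t) * u 0 - u 0) / t - w 0\<bar>) \<longlongrightarrow> 0) (at_right 0) \<longleftrightarrow> \<bar>- u 0 - w 0\<bar> = 0"
      using * tendsto_unique[OF _ *] by fastforce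
    also have "\<dots> \<longleftrightarrow> (\<forall>v :: real \<Rightarrow> real. u 0 * v 0 = - (w 0 * v 0))"
    proof
      assume "\<bar>- u 0 - w 0\<bar> = 0"
      hence "u 0 = - w 0" by simp
      thus "\<forall>v :: real \<Rightarrow> real. u 0 * v 0 = - (w 0 * v 0)" by simp
    qed (auto dest: spec[of _ "\<lambda>_. 1"])
    finally show ?thesis .
  qed
  have contr: "\<bar>exp (- t) * a\<bar> \<le> \<bar>a\<bar>" if "t > 0" for t a :: real
    using that by (simp add: abs_mult mult_left_le_one_le)
  have cont: "((\<lambda>t. \<bar>exp (- t) * a - a\<bar>) \<longlongrightarrow> 0) (at_right 0)" for a :: real
  proof -
    have "((\<lambda>t. \<bar>exp (- t) * a - a\<bar>) \<longlongrightarrow> \<bar>exp (- 0) * a - a\<bar>) (at_right 0)"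
      by (intro tendsto_intros)
    thus ?thesis by simp
  qed
  show ?thesis
    unfolding form_semigroup_def Let_def
    using gen contr cont
    by (simp add: distrib_left mult.left_commute exp_add[symmetric] flip: mult.assoc)
qed

section \<open>The process killed at an exponential time\<close>

text \<open>The sample point is the lifetime; \<open>\<omega> \<le> 0\<close> stands for paths that are dead from the
  start.  The law is completed so that it contains the completed filtration.\<close>

definition exp_law :: "real measure" where
  "exp_law = completion (density lborel (exponential_density 1))"

text \<open>The shift turns the lifetime into the remaining lifetime, which becomes negative after
  death; this is why the sample space is the whole line. All nonpositive sample points describe one
  and the same path, and 0 represents it in the law started at the cemetery.\<close>

definition killed_point_process :: "(real, real) process" where
  "killed_point_process =
     \<lparr>amb = exp_law,
      path = (\<lambda>t \<omega>. if t < \<omega> then Some 0 else None),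
      law = (\<lambda>x. case x of None \<Rightarrow> return exp_law 0 | Some _ \<Rightarrow> exp_law),
      shift = (\<lambda>t \<omega>. \<omega> - t)\<rparr>"

abbreviation point_top :: "real topology" where
  "point_top \<equiv> discrete_topology {0}"

lemma killed_point_process_simps [simp]:
  "amb killed_point_process = exp_law"
  "path killed_point_process t \<omega> = (if t < \<omega> then Some 0 else None)"
  "law killed_point_process None = return exp_law 0"
  "law killed_point_process (Some x) = exp_law"
  "shift killed_point_process t \<omega> = \<omega> - t"
  by (simp_all add: killed_point_process_def)

lemma space_exp_law [simp]: "space exp_law = UNIV"
  by (simp add: exp_law_def)

lemma borel_sets_exp_law: "A \<in> sets borel \<Longrightarrow> A \<in> sets exp_law"
  by (simp add: exp_law_def)

lemma borel_measurable_exp_law: "f \<in> borel_measurable borel \<Longrightarrow> f \<in> borel_measurable exp_law"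
  unfolding exp_law_def by (rule measurable_completion) simp

interpretation expd: prob_space "density lborel (exponential_density 1)"
  by (rule prob_space_exponential_density) simp

interpretation exp_law: prob_space exp_law
  unfolding exp_law_def by (rule expd.prob_space_completion)

lemma AE_exp_law_iff:
  "(AE \<omega> in exp_law. P \<omega>) \<longleftrightarrow> (AE \<omega> in density lborel (exponential_density 1). P \<omega>)"
  unfolding exp_law_def by (rule AE_completion_iff)

lemma AE_exp_lawI:
  assumes "AE \<omega> in lborel. 0 \<le> \<omega> \<longrightarrow> P \<omega>" shows "AE \<omega> in exp_law. P \<omega>"
  unfolding AE_exp_law_iff using assms
  by (subst AE_density) (auto elim!: eventually_mono simp: erlang_density_def split: if_splits)

lemma AE_exp_law_neq: "AE \<omega> in exp_law. \<omega> \<noteq> c"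
  by (intro AE_exp_lawI) (use AE_lborel_singleton[of c] in auto)

lemma AE_exp_law_pos: "AE \<omega> in exp_law. 0 < \<omega>"
proof (rule AE_exp_lawI)
  show "AE \<omega>::real in lborel. 0 \<le> \<omega> \<longrightarrow> 0 < \<omega>"
    using AE_lborel_singleton[of "0::real"] by (auto elim!: eventually_mono)
qed

lemma emeasure_exp_law_greaterThan:
  assumes "0 \<le> a" shows "emeasure exp_law {a<..} = ennreal (exp (- a))"
proof -
  \<comment> \<open>The identity map is an exponentially distributed variable, so the known tail
    formula applies to it.\<close>
  have "distributed (density lborel (exponential_density 1)) lborel (\<lambda>x. x) (exponential_density 1)"
    by (simp add: distributed_def distr_id2)
  from expd.exponential_distributedD_gt[OF this assms]
  have "measure (density lborel (exponential_density 1)) {a<..} = exp (- a)"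
    by (simp add: greaterThan_def)
  thus ?thesis
    by (simp add: exp_law_def expd.emeasure_eq_measure)
qed

lemma lifetime_killed_point [simp]: "lifetime killed_point_process \<omega> = ennreal \<omega>"
proof (rule antisym)
  show "lifetime killed_point_process \<omega> \<le> ennreal \<omega>"
    \<comment> \<open>Only times t \<ge> 0 compete, so a nonpositive sample point dies at time 0;
      this agrees with \<open>ennreal\<close> sending negative numbers to 0.\<close>
    unfolding lifetime_def by (rule Inf_lower) (auto intro!: exI[of _ "max 0 \<omega>"] simp: max_def ennreal_neg split: if_splits)
  show "ennreal \<omega> \<le> lifetime killed_point_process \<omega>"
    unfolding lifetime_def by (rule Inf_greatest) (auto split: if_splits intro: ennreal_leI)
qed

lemma path_at_killed_point:
  "path_at killed_point_process s \<omega> = (if s < ennreal \<omega> then Some 0 else None)"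
  by (cases s) (auto simp: path_at_def ennreal_less_iff)

lemma sets_borel_of_cem_point [simp]: "sets (borel_of (cem_top point_top)) = Pow {None, Some 0}"
  by (simp add: cem_top_discrete sets_borel_of_discrete)

lemma space_borel_of_cem_point [simp]: "space (borel_of (cem_top point_top)) = {None, Some 0}"
  by (simp add: space_borel_of topspace_cem_top)

section \<open>The process under an arbitrary initial law on the two states\<close>

context
  fixes \<nu> :: "real option measure"
  assumes sets_nu: "sets \<nu> = Pow {None, Some 0}"
begin

lemma space_nu: "space \<nu> = {None, Some 0}"
  using sets_eq_imp_space_eq[of \<nu> "borel_of (cem_top point_top)"] sets_nu by simp

lemma nn_integral_two_points:
  "(\<integral>\<^sup>+x. f x \<partial>\<nu>) = emeasure \<nu> {None} * f None + emeasure \<nu> {Some 0} * f (Some 0)"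
proof -
  have [measurable]: "{None} \<in> sets \<nu>" "{Some 0} \<in> sets \<nu>" by (simp_all add: sets_nu)
  have "(\<integral>\<^sup>+x. f x \<partial>\<nu>) = (\<integral>\<^sup>+x. f None * indicator {None} x + f (Some 0) * indicator {Some 0} x \<partial>\<nu>)"
    by (rule nn_integral_cong) (auto simp: space_nu)
  also have "\<dots> = f None * emeasure \<nu> {None} + f (Some 0) * emeasure \<nu> {Some 0}"
    by (subst nn_integral_add) (auto simp: nn_integral_cmult)
  finally show ?thesis by (simp add: mult.commute)
qed

lemma space_law_from [simp]: "space (law_from killed_point_process \<nu>) = UNIV"
  by (simp add: law_from_def space_measure_of_conv)

lemma sets_law_from [simp]: "sets (law_from killed_point_process \<nu>) = sets exp_law"
  using sets.sigma_sets_eq[of exp_law]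
  by (simp add: law_from_def sets_measure_of_conv)

text \<open>\<open>measure_of\<close> returns the prescribed set function only if that function is
  countably additive. Here it is a sum of two weighted measures, which settles the point and makes
  every initial law a mixture of a point mass at 0 and \<open>exp_law\<close>.\<close>

lemma emeasure_law_from:
  assumes "A \<in> sets exp_law"
  shows "emeasure (law_from killed_point_process \<nu>) A
    = emeasure \<nu> {None} * indicator A 0 + emeasure \<nu> {Some 0} * emeasure exp_law A"
proof -
  let ?mu = "\<lambda>\<Lambda>. \<integral>\<^sup>+x. emeasure (law killed_point_process x) \<Lambda> \<partial>completion \<nu>"
  have mu: "?mu \<Lambda> = emeasure \<nu> {None} * emeasure (return exp_law 0) \<Lambda> + emeasure \<nu> {Some 0} * emeasure exp_law \<Lambda>"
    for \<Lambda> by (simp add: nn_integral_completion nn_integral_two_points)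
  have "emeasure (law_from killed_point_process \<nu>) A = ?mu A"
  proof (rule emeasure_measure_of[OF law_from_def])
    show "positive (sets (law_from killed_point_process \<nu>)) ?mu"
      by (simp add: positive_def)
    show "countably_additive (sets (law_from killed_point_process \<nu>)) ?mu"
    proof (rule countably_additiveI)
      fix B :: "nat \<Rightarrow> real set"
      assume B: "range B \<subseteq> sets (law_from killed_point_process \<nu>)" "disjoint_family B"
      hence "range B \<subseteq> sets (return exp_law 0)" "range B \<subseteq> sets exp_law" by auto
      hence "(\<Sum>i. emeasure (return exp_law 0) (B i)) = emeasure (return exp_law 0) (\<Union>i. B i)"
        "(\<Sum>i. emeasure exp_law (B i)) = emeasure exp_law (\<Union>i. B i)"
        using B(2) by (auto intro!: suminf_emeasure simp del: emeasure_return)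
      thus "(\<Sum>i. ?mu (B i)) = ?mu (\<Union>i. B i)"
        unfolding mu by (simp add: suminf_add[symmetric] ennreal_suminf_cmult del: emeasure_return)
    qed
  qed (use assms in auto)
  thus ?thesis using assms by (simp add: mu)
qed

lemma AE_law_fromI:
  assumes "emeasure \<nu> {None} \<noteq> 0 \<Longrightarrow> P 0" "emeasure \<nu> {Some 0} \<noteq> 0 \<Longrightarrow> AE \<omega> in exp_law. P \<omega>"
  shows "AE \<omega> in law_from killed_point_process \<nu>. P \<omega>"
proof (cases "emeasure \<nu> {Some 0} = 0")
  case True
  show ?thesis
  proof (cases "emeasure \<nu> {None} = 0")
    case True
    with \<open>emeasure \<nu> {Some 0} = 0\<close> have "emeasure (law_from killed_point_process \<nu>) UNIV = 0"
      by (subst emeasure_law_from) (auto intro: borel_sets_exp_law)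
    thus ?thesis by (intro AE_I[of _ _ UNIV]) (auto intro: borel_sets_exp_law)
  next
    case False
    have "emeasure (law_from killed_point_process \<nu>) (- {0}) = 0"
      using True by (subst emeasure_law_from) (auto intro: borel_sets_exp_law)
    thus ?thesis using assms(1)[OF False]
      by (intro AE_I[of _ _ "- {0}"]) (auto intro: borel_sets_exp_law)
  qed
next
  case False
  have ae: "AE \<omega> in exp_law. P \<omega>" by (rule assms(2)[OF False])
  \<comment> \<open>An arbitrary null superset of the failure set might contain 0, which
    \<open>law_from\<close> can charge. Completeness of \<open>exp_law\<close> lets the failure set
    itself serve as the null set.\<close>
  have "{\<omega>. \<not> P \<omega>} \<in> null_sets exp_law"
  proof -
    from ae obtain N where "N \<in> null_sets exp_law" "{\<omega>. \<not> P \<omega>} \<subseteq> N"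
      by (auto simp: eventually_ae_filter)
    thus ?thesis unfolding exp_law_def by (rule null_sets_completion_subset[rotated])
  qed
  hence "{\<omega>. \<not> P \<omega>} \<in> sets exp_law" "emeasure exp_law {\<omega>. \<not> P \<omega>} = 0" by auto
  moreover have "emeasure \<nu> {None} * indicator {\<omega>. \<not> P \<omega>} 0 = 0"
    using assms(1) by (auto simp: indicator_def)
  ultimately show ?thesis
    by (intro AE_I[of _ _ "{\<omega>. \<not> P \<omega>}"]) (auto simp: emeasure_law_from)
qed

end

lemma is_law_point: "is_law point_top \<nu> \<longleftrightarrow> prob_space \<nu> \<and> sets \<nu> = Pow {None, Some 0}"
  by (simp add: is_law_def)

lemma prob_space_law_from:
  assumes "is_law point_top \<nu>" shows "prob_space (law_from killed_point_process \<nu>)"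
proof
  interpret prob_space \<nu> using assms by (simp add: is_law_point)
  have s: "sets \<nu> = Pow {None, Some 0}" using assms by (simp add: is_law_point)
  have "emeasure \<nu> {None} + emeasure \<nu> {Some 0} = emeasure \<nu> (space \<nu>)"
    by (subst plus_emeasure) (auto simp: s space_nu[OF s] insert_commute)
  thus "emeasure (law_from killed_point_process \<nu>) (space (law_from killed_point_process \<nu>)) = 1"
    using emeasure_space_1 exp_law.emeasure_space_1
    by (simp add: s space_law_from emeasure_law_from[OF s] borel_sets_exp_law)
qed

lemma is_law_return: "x \<in> {None, Some 0} \<Longrightarrow> is_law point_top (return (borel_of (cem_top point_top)) x)"
  by (simp add: is_law_point prob_space_return)

text \<open>Point masses as initial laws are the means by which facts about all completions are
  specialised to \<open>exp_law\<close> and, in the next lemma, to the dead path.\<close>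

lemma law_from_return_Some:
  "law_from killed_point_process (return (borel_of (cem_top point_top)) (Some 0)) = exp_law"
  by (rule measure_eqI) (simp_all add: emeasure_law_from)

lemma law_from_return_None:
  "law_from killed_point_process (return (borel_of (cem_top point_top)) None) = return exp_law 0"
  by (rule measure_eqI) (simp_all add: emeasure_law_from)

section \<open>Filtrations\<close>

abbreviation "nfilt \<equiv> nat_filt point_top killed_point_process"
abbreviation "lfilt \<equiv> law_filt point_top killed_point_process"
abbreviation "pfilt \<equiv> filt point_top killed_point_process"
abbreviation "lawf \<equiv> law_from killed_point_process"

lemma space_nat_filt [simp]: "space (nfilt t) = UNIV"
  by (simp add: nat_filt_def space_measure_of_conv)

lemma space_law_filt [simp]: "space (lfilt \<nu> t) = UNIV"
  by (simp add: law_filt_def space_measure_of_conv)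

lemma space_filt [simp]: "space (pfilt t) = UNIV"
  by (simp add: filt_def space_measure_of_conv)

lemma sets_nat_filt:
  "sets (nfilt t) = sigma_sets UNIV
     {path killed_point_process s -` A \<inter> UNIV | s A. 0 \<le> s \<and> ennreal s \<le> t \<and> A \<subseteq> {None, Some 0}}"
  by (auto simp: nat_filt_def sets_measure_of_conv)

lemma nat_filt_mono: "t \<le> u \<Longrightarrow> sets (nfilt t) \<subseteq> sets (nfilt u)"
  unfolding sets_nat_filt by (rule sigma_sets_mono') (blast intro: order_trans)

lemma path_vimage:
  "path killed_point_process s -` A \<inter> UNIV =
     (if Some 0 \<in> A then {s<..} else {}) \<union> (if None \<in> A then {..s} else {})"
  by (auto split: if_splits)

lemma nat_filt_borel: "sets (nfilt t) \<subseteq> sets borel"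
proof -
  have "path killed_point_process s -` A \<inter> UNIV \<in> sets borel" for s A
    unfolding path_vimage by simp
  hence "{path killed_point_process s -` A \<inter> UNIV | s A. 0 \<le> s \<and> ennreal s \<le> t \<and> A \<subseteq> {None, Some 0}}
      \<subseteq> sets borel" by blast
  from sets.sigma_sets_subset[OF this] show ?thesis by (simp add: sets_nat_filt)
qed

lemma greaterThan_nat_filt:
  assumes "0 \<le> s" "ennreal s \<le> t" shows "{s<..} \<in> sets (nfilt t)"
  unfolding sets_nat_filt
proof (rule sigma_sets.Basic)
  show "{s<..} \<in> {path killed_point_process s -` A \<inter> UNIV | s A. 0 \<le> s \<and> ennreal s \<le> t \<and> A \<subseteq> {None, Some 0}}"
    using assms by (intro CollectI exI[of _ s] exI[of _ "{Some 0}"]) (auto split: if_splits)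
qed

lemma atMost_nat_filt:
  assumes "0 \<le> s" "ennreal s \<le> t" shows "{..s} \<in> sets (nfilt t)"
proof -
  have "space (nfilt t) - {s<..} \<in> sets (nfilt t)"
    using greaterThan_nat_filt[OF assms] by blast
  thus ?thesis by (simp add: Compl_greaterThan flip: Compl_eq_Diff_UNIV)
qed

text \<open>A death that has happened by time t is observed together with its exact time, so the
  natural filtration contains every Borel event about it.\<close>

lemma borel_nat_filt:
  assumes C: "C \<in> sets borel" "C \<subseteq> {0<..t}" and t: "0 \<le> t"
  shows "C \<in> sets (nfilt (ennreal t))"
proof -
  \<comment> \<open>\<open>f\<close> reads off the lifetime when it lies in (0,t] and otherwise
    takes the value 0, which lies outside C.\<close>
  define f where "f \<omega> = (if 0 < \<omega> \<and> \<omega> \<le> t then \<omega> else 0)" for \<omega> :: real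
  have "f \<in> borel_measurable (nfilt (ennreal t))"
  proof (rule borel_measurableI_greater)
    fix a :: real
    consider "a < 0" | "0 \<le> a" "a < t" | "t \<le> a" by linarith
    thus "{x \<in> space (nfilt (ennreal t)). a < f x} \<in> sets (nfilt (ennreal t))"
    proof cases
      case 1
      hence "{x \<in> space (nfilt (ennreal t)). a < f x} = space (nfilt (ennreal t))"
        by (auto simp: f_def)
      thus ?thesis by (metis sets.top)
    next
      case 2
      hence "{x \<in> space (nfilt (ennreal t)). a < f x} = {a<..} - {t<..}"
        by (auto simp: f_def)
      moreover have "{a<..} \<in> sets (nfilt (ennreal t))" "{t<..} \<in> sets (nfilt (ennreal t))"
        using 2 t by (simp_all add: greaterThan_nat_filt ennreal_leI)
      ultimately show ?thesis by (metis sets.Diff)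
    next
      case 3
      have "\<not> a < f x" for x using 3 t by (simp add: f_def)
      thus ?thesis by simp
    qed
  qed
  hence "f -` C \<inter> space (nfilt (ennreal t)) \<in> sets (nfilt (ennreal t))"
    using C(1) by (rule measurable_sets)
  also have "f -` C \<inter> space (nfilt (ennreal t)) = C"
    using C(2) by (auto simp: f_def split: if_splits)
  finally show ?thesis .
qed

lemma borel_nat_filt_top:
  assumes C: "C \<in> sets borel" "C \<subseteq> {0<..}"
  shows "C \<in> sets (nfilt \<infinity>)"
proof -
  have "C \<inter> {0<..real n} \<in> sets (nfilt \<infinity>)" for n
    using borel_nat_filt[of "C \<inter> {0<..real n}" "real n"] nat_filt_mono[of "ennreal (real n)" \<infinity>] C
    by (auto simp: subset_iff)
  hence "(\<Union>n. C \<inter> {0<..real n}) \<in> sets (nfilt \<infinity>)" by blast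
  also have "(\<Union>n. C \<inter> {0<..real n}) = C"
    using C(2) by (auto simp: subset_iff real_arch_simple)
  finally show ?thesis .
qed

text \<open>All sample points beyond q are still alive at every time up to q and cannot be told
  apart: {q<..} is an atom of the natural filtration at q.\<close>

lemma nat_filt_cases:
  assumes "B \<in> sets (nfilt (ennreal q))" "0 \<le> q"
  shows "B \<inter> {q<..} = {} \<or> {q<..} \<subseteq> B"
  using assms(1) unfolding sets_nat_filt
proof (induction rule: sigma_sets.induct)
  case (Basic B)
  then obtain s A where "B = path killed_point_process s -` A \<inter> UNIV" "0 \<le> s" "s \<le> q"
    using assms(2) by auto
  thus ?case unfolding path_vimage by auto
next
  case (Union B)
  thus ?case by (auto; blast)
qed auto

text \<open>Nonpositive sample points share the path that is dead at all times s \<ge> 0, so no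
  event of the natural filtration separates them.\<close>

lemma nat_filt_nonpos:
  assumes "B \<in> sets (nfilt t)" "x \<le> 0"
  shows "x \<in> B \<longleftrightarrow> 0 \<in> B"
  using assms(1) unfolding sets_nat_filt
proof (induction rule: sigma_sets.induct)
  case (Basic B)
  then obtain s A where "B = path killed_point_process s -` A \<inter> UNIV" "0 \<le> s" by auto
  thus ?case using assms(2) by (auto split: if_splits)
qed auto

text \<open>The completion of the filtration admits only null sets from \<open>nat_filt\<close>,
  which are Borel; this supplies Borel covers for null sets of the completed law.\<close>

lemma AE_exp_law_borel_null:
  assumes "AE \<omega> in exp_law. P \<omega>"
  shows "\<exists>N. N \<in> null_sets (density lborel (exponential_density 1)) \<and> {\<omega>. \<not> P \<omega>} \<subseteq> N"
  using assms[unfolded AE_exp_law_iff] unfolding eventually_ae_filter by auto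

section \<open>The filtration completed under one initial law\<close>

context
  fixes \<nu> :: "real option measure"
  assumes sets_nu: "sets \<nu> = Pow {None, Some 0}"
begin

text \<open>The generating family is already a sigma-algebra, as countably many exceptional null
  sets can be united. Membership can therefore be unpacked into a set of the natural filtration and
  a null set.\<close>

lemma sets_law_filt:
  "sets (lfilt \<nu> t) = {A. \<exists>B\<in>sets (nfilt t). \<exists>N\<in>sets (nfilt \<infinity>).
      emeasure (lawf \<nu>) N = 0 \<and> (A - B) \<union> (B - A) \<subseteq> N}" (is "_ = ?G")
proof -
  have "sigma_algebra UNIV ?G"
    unfolding sigma_algebra_iff2
  proof (intro conjI ballI allI impI)
    show "{} \<in> ?G" by (auto intro!: bexI[of _ "{}"])
  next
    fix A assume "A \<in> ?G"
    then obtain B N where "B \<in> sets (nfilt t)" "N \<in> sets (nfilt \<infinity>)" "emeasure (lawf \<nu>) N = 0"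
      "(A - B) \<union> (B - A) \<subseteq> N" by auto
    moreover from this have "space (nfilt t) - B \<in> sets (nfilt t)" by blast
    ultimately show "UNIV - A \<in> ?G"
      by (intro CollectI bexI[of _ "space (nfilt t) - B"] bexI[of _ N]) auto
  next
    fix A :: "nat \<Rightarrow> real set" assume "range A \<subseteq> ?G"
    hence "A i \<in> ?G" for i by blast
    hence "\<forall>i. \<exists>B N. B \<in> sets (nfilt t) \<and> N \<in> sets (nfilt \<infinity>) \<and> emeasure (lawf \<nu>) N = 0 \<and>
      (A i - B) \<union> (B - A i) \<subseteq> N" unfolding mem_Collect_eq by meson
    then obtain B N where BN: "\<And>i. B i \<in> sets (nfilt t)" "\<And>i. N i \<in> sets (nfilt \<infinity>)"
      "\<And>i. emeasure (lawf \<nu>) (N i) = 0" "\<And>i. (A i - B i) \<union> (B i - A i) \<subseteq> N i" by metis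
    have "N i \<in> sets (lawf \<nu>)" for i
      using BN(2)[of i] nat_filt_borel[of \<infinity>] by (auto simp: sets_law_from[OF sets_nu] borel_sets_exp_law)
    hence "emeasure (lawf \<nu>) (\<Union>i. N i) = 0"
      using BN(3) by (intro emeasure_UN_eq_0) auto
    moreover have "(\<Union>i. B i) \<in> sets (nfilt t)" "(\<Union>i. N i) \<in> sets (nfilt \<infinity>)"
      using BN(1,2) by (auto intro!: sets.countable_UN)
    moreover have "((\<Union>i. A i) - (\<Union>i. B i)) \<union> ((\<Union>i. B i) - (\<Union>i. A i)) \<subseteq> (\<Union>i. N i)"
    proof
      fix x assume "x \<in> ((\<Union>i. A i) - (\<Union>i. B i)) \<union> ((\<Union>i. B i) - (\<Union>i. A i))"
      then obtain i where "x \<in> (A i - B i) \<union> (B i - A i)" by auto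
      thus "x \<in> (\<Union>i. N i)" using BN(4)[of i] by auto
    qed
    ultimately show "(\<Union>i. A i) \<in> ?G"
      by (intro CollectI bexI[of _ "\<Union>i. B i"] bexI[of _ "\<Union>i. N i"] conjI)
  qed auto
  thus ?thesis
    by (simp add: law_filt_def sigma_algebra.sigma_sets_eq)
qed

lemma law_filtI:
  assumes "A \<in> sets (nfilt t)" shows "A \<in> sets (lfilt \<nu> t)"
  unfolding sets_law_filt using assms by (intro CollectI bexI[of _ A] bexI[of _ "{}"]) auto

text \<open>The point 0 has to be kept out of N because an initial law charging the cemetery puts
  mass on that sample point.\<close>

lemma emeasure_law_from_null:
  assumes "N \<in> null_sets (density lborel (exponential_density 1))" "0 \<notin> N"
  shows "emeasure (lawf \<nu>) N = 0"
proof -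
  have "N \<in> null_sets exp_law" unfolding exp_law_def by (rule null_sets_completionI[OF assms(1)])
  thus ?thesis using assms(2) by (subst emeasure_law_from[OF sets_nu]) auto
qed

lemma law_filt_null:
  assumes A: "AE \<omega> in lawf \<nu>. \<omega> \<notin> A" "A \<subseteq> {0<..}"
  shows "A \<in> sets (lfilt \<nu> t)"
proof -
  have "\<exists>N\<in>sets (nfilt \<infinity>). emeasure (lawf \<nu>) N = 0 \<and> A \<subseteq> N"
  \<comment> \<open>If the living state is not charged, the whole half line {0<..} is null and
    covers A; otherwise nullity under \<open>law_from\<close> gives nullity under
    \<open>exp_law\<close>.\<close>
  proof (cases "emeasure \<nu> {Some 0} = 0")
    case True
    have "emeasure (lawf \<nu>) {0<..} = 0"
      using True by (subst emeasure_law_from[OF sets_nu]) (auto intro: borel_sets_exp_law)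
    thus ?thesis using A(2) by (intro bexI[of _ "{0<..}"] borel_nat_filt_top) auto
  next
    case False
    from A(1) obtain M where M: "M \<in> sets exp_law" "emeasure (lawf \<nu>) M = 0" "A \<subseteq> M"
      by (auto elim!: AE_E simp: sets_law_from[OF sets_nu] space_law_from[OF sets_nu])
    hence "emeasure exp_law M = 0"
      using False emeasure_law_from[OF sets_nu M(1)] by auto
    hence "AE \<omega> in exp_law. \<omega> \<notin> M" using M(1) by (intro AE_not_in) auto
    then obtain N where N: "N \<in> null_sets (density lborel (exponential_density 1))" "M \<subseteq> N"
      using AE_exp_law_borel_null[of "\<lambda>\<omega>. \<omega> \<notin> M"] by auto
    \<comment> \<open>Cutting with the positive half line keeps 0 out and puts the cover into the
      terminal natural sigma-algebra.\<close>
    have "N \<inter> {0<..} \<in> null_sets (density lborel (exponential_density 1))"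
      using N(1) by (intro null_set_Int2) auto
    moreover from this have "N \<inter> {0<..} \<in> sets borel" by auto
    ultimately show ?thesis
      using N(2) M(3) A(2) emeasure_law_from_null[of "N \<inter> {0<..}"]
      by (intro bexI[of _ "N \<inter> {0<..}"] borel_nat_filt_top) auto
  qed
  then obtain N where "N \<in> sets (nfilt \<infinity>)" "emeasure (lawf \<nu>) N = 0" "A \<subseteq> N" by blast
  thus ?thesis
    unfolding sets_law_filt by (intro CollectI bexI[of _ "{}"] bexI[of _ N]) auto
qed

lemma law_filt_mono: "t \<le> u \<Longrightarrow> sets (lfilt \<nu> t) \<subseteq> sets (lfilt \<nu> u)"
  unfolding sets_law_filt using nat_filt_mono by blast

lemma filtration_law_filt: "filtration UNIV (lfilt \<nu>)"
  by standard (simp_all add: law_filt_mono)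

text \<open>Completion changes an event by a null set only, so the dichotomy of
  \<open>nat_filt_cases\<close> survives almost surely.\<close>

lemma law_filt_cases:
  assumes "A \<in> sets (lfilt \<nu> (ennreal q))" "0 \<le> q"
  shows "(AE \<omega> in lawf \<nu>. q < \<omega> \<longrightarrow> \<omega> \<notin> A) \<or> (AE \<omega> in lawf \<nu>. q < \<omega> \<longrightarrow> \<omega> \<in> A)"
proof -
  from assms(1) obtain B N where BN: "B \<in> sets (nfilt (ennreal q))" "N \<in> sets (nfilt \<infinity>)"
    "emeasure (lawf \<nu>) N = 0" "(A - B) \<union> (B - A) \<subseteq> N" unfolding sets_law_filt by blast
  have "N \<in> sets (lawf \<nu>)"
    using BN(2) nat_filt_borel[of \<infinity>] by (auto simp: sets_law_from[OF sets_nu] borel_sets_exp_law)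
  hence *: "AE \<omega> in lawf \<nu>. \<omega> \<notin> N" using BN(3) by (intro AE_not_in) auto
  from nat_filt_cases[OF BN(1) assms(2)] show ?thesis
  proof
    assume "B \<inter> {q<..} = {}"
    thus ?thesis using BN(4) by (intro disjI1 eventually_mono[OF *]) auto
  next
    assume "{q<..} \<subseteq> B"
    thus ?thesis using BN(4) by (intro disjI2 eventually_mono[OF *]) auto
  qed
qed

text \<open>Before the lifetime nothing is observed, so the filtration only sees stopping times that are
  constant there.\<close>

lemma stopping_time_const_before_lifetime:
  assumes "stopping_time (lfilt \<nu>) \<sigma>"
  shows "\<exists>c. AE \<omega> in lawf \<nu>. \<sigma> \<omega> < ennreal \<omega> \<longrightarrow> \<sigma> \<omega> = c"
proof -
  \<comment> \<open>For each level q, the answer to "has \<sigma> stopped by q?" is almost surely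
    the same on all paths still alive at q.\<close>
  have "\<exists>b. AE \<omega> in lawf \<nu>. 0 \<le> q \<longrightarrow> q < \<omega> \<longrightarrow> (\<sigma> \<omega> \<le> ennreal q) = b" for q
  proof (cases "0 \<le> q")
    case True
    have "{\<omega>. \<sigma> \<omega> \<le> ennreal q} \<in> sets (lfilt \<nu> (ennreal q))"
      using stopping_timeD[OF assms, of "ennreal q"] by (simp add: pred_def)
    from law_filt_cases[OF this True] show ?thesis
    proof
      assume *: "AE \<omega> in lawf \<nu>. q < \<omega> \<longrightarrow> \<omega> \<notin> {\<omega>. \<sigma> \<omega> \<le> ennreal q}"
      show ?thesis by (rule exI[of _ False], rule eventually_mono[OF *]) auto
    next
      assume *: "AE \<omega> in lawf \<nu>. q < \<omega> \<longrightarrow> \<omega> \<in> {\<omega>. \<sigma> \<omega> \<le> ennreal q}"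
      show ?thesis by (rule exI[of _ True], rule eventually_mono[OF *]) auto
    qed
  qed simp
  then obtain b where b: "\<And>q. AE \<omega> in lawf \<nu>. 0 \<le> q \<longrightarrow> q < \<omega> \<longrightarrow> (\<sigma> \<omega> \<le> ennreal q) = b q"
    by metis
  \<comment> \<open>Rational levels keep the number of null sets countable, and they suffice to
    separate two different values of \<sigma>.\<close>
  define good where "good \<omega> \<longleftrightarrow> (\<forall>q\<in>\<rat>. 0 \<le> q \<longrightarrow> q < \<omega> \<longrightarrow> (\<sigma> \<omega> \<le> ennreal q) = b q)" for \<omega>
  have good: "AE \<omega> in lawf \<nu>. good \<omega>"
    unfolding good_def using b by (simp add: AE_ball_countable countable_rat)
  have le: "\<sigma> \<omega>' \<le> \<sigma> \<omega>" if "good \<omega>" "good \<omega>'" "\<sigma> \<omega> < ennreal \<omega>" "\<sigma> \<omega>' < ennreal \<omega>'" for \<omega> \<omega>'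
  proof (rule ccontr)
    \<comment> \<open>A rational q above \<sigma>(\<omega>) and below both \<sigma>(\<omega>') and
      \<omega> lies below both lifetimes, yet the two paths answer differently at level q.\<close>
    assume "\<not> ?thesis"
    hence "\<sigma> \<omega> < min (\<sigma> \<omega>') (ennreal \<omega>)" using that by auto
    moreover have "min (\<sigma> \<omega>') (ennreal \<omega>) < \<infinity>" by (simp add: min_less_iff_disj)
    ultimately obtain r1 r2 where r: "0 \<le> r1" "\<sigma> \<omega> = ennreal r1" "0 \<le> r2"
      "min (\<sigma> \<omega>') (ennreal \<omega>) = ennreal r2" "r1 < r2"
      by (cases "\<sigma> \<omega>"; cases "min (\<sigma> \<omega>') (ennreal \<omega>)") (auto simp: ennreal_less_iff)
    obtain q where q: "q \<in> \<rat>" "r1 < q" "q < r2" using Rats_dense_in_real[OF r(5)] by blast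
    have "ennreal q < ennreal r2" using q r by (simp add: ennreal_less_iff)
    hence "ennreal q < \<sigma> \<omega>'" "ennreal q < ennreal \<omega>" using r(4) by (metis min_less_iff_conj)+
    moreover from this have "ennreal q < ennreal \<omega>'" using that(4) by (auto intro: less_trans)
    ultimately have "q < \<omega>" "q < \<omega>'" "\<not> \<sigma> \<omega>' \<le> ennreal q" using q r by (auto simp: ennreal_less_iff)
    moreover have "\<sigma> \<omega> \<le> ennreal q" using q r by (simp add: ennreal_leI)
    ultimately show False using that(1,2) q r unfolding good_def by auto
  qed
  show ?thesis
  proof (cases "\<exists>\<omega>0. good \<omega>0 \<and> \<sigma> \<omega>0 < ennreal \<omega>0")
    case True
    then obtain \<omega>0 where w: "good \<omega>0" "\<sigma> \<omega>0 < ennreal \<omega>0" by blast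
    show ?thesis
      by (rule exI[of _ "\<sigma> \<omega>0"], rule eventually_mono[OF good]) (use le w in \<open>auto intro: antisym\<close>)
  next
    case False
    show ?thesis by (rule exI, rule eventually_mono[OF good]) (use False in auto)
  qed
qed

lemma measure_law_from_greaterThan:
  assumes "0 \<le> a"
  shows "measure (lawf \<nu>) {a<..} = enn2real (emeasure \<nu> {Some 0}) * exp (- a)"
  unfolding measure_def using assms
  by (subst emeasure_law_from[OF sets_nu])
    (auto intro: borel_sets_exp_law simp: emeasure_exp_law_greaterThan enn2real_mult)

end

text \<open>On \<sigma> < \<zeta> the stopping time is a constant c', so both events are almost
  surely half lines and the claim compares the tails exp(-(c' + t)) and exp(-c'). This carries the
  strong Markov property.\<close>

lemma memoryless_before_lifetime:
  assumes "is_law point_top \<nu>" "stopping_time (lfilt \<nu>) \<sigma>" "\<sigma> \<in> borel_measurable exp_law" "0 \<le> t"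
  shows "measure (lawf \<nu>) {\<omega>. \<sigma> \<omega> + ennreal t < ennreal \<omega>}
    = exp (- t) * measure (lawf \<nu>) {\<omega>. \<sigma> \<omega> < ennreal \<omega>}"
proof -
  have s: "sets \<nu> = Pow {None, Some 0}" using assms(1) by (simp add: is_law_point)
  interpret Q: prob_space "lawf \<nu>" by (rule prob_space_law_from[OF assms(1)])
  have [measurable]: "\<sigma> \<in> borel_measurable (lawf \<nu>)"
    using assms(3) by (simp add: measurable_cong_sets[OF sets_law_from[OF s] refl])
  have [measurable]: "(\<lambda>\<omega>. ennreal \<omega>) \<in> borel_measurable (lawf \<nu>)"
    by (simp add: measurable_cong_sets[OF sets_law_from[OF s] refl] borel_measurable_exp_law)
  have m: "{\<omega>. \<sigma> \<omega> + ennreal u < ennreal \<omega>} \<in> sets (lawf \<nu>)" "{\<omega>. \<sigma> \<omega> < ennreal \<omega>} \<in> sets (lawf \<nu>)" for u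
  proof -
    have "{\<omega>\<in>space (lawf \<nu>). \<sigma> \<omega> + ennreal u < ennreal \<omega>} \<in> sets (lawf \<nu>)"
      "{\<omega>\<in>space (lawf \<nu>). \<sigma> \<omega> < ennreal \<omega>} \<in> sets (lawf \<nu>)" by measurable
    thus "{\<omega>. \<sigma> \<omega> + ennreal u < ennreal \<omega>} \<in> sets (lawf \<nu>)" "{\<omega>. \<sigma> \<omega> < ennreal \<omega>} \<in> sets (lawf \<nu>)"
      by (simp_all add: space_law_from[OF s])
  qed
  have g: "{a<..} \<in> sets (lawf \<nu>)" for a by (simp add: sets_law_from[OF s] borel_sets_exp_law)
  obtain c where c: "AE \<omega> in lawf \<nu>. \<sigma> \<omega> < ennreal \<omega> \<longrightarrow> \<sigma> \<omega> = c"
    using stopping_time_const_before_lifetime[OF s assms(2)] by blast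
  show ?thesis
  proof (cases "AE \<omega> in lawf \<nu>. \<not> \<sigma> \<omega> < ennreal \<omega>")
    case True
    have le: "\<sigma> \<omega> \<le> \<sigma> \<omega> + ennreal t" for \<omega> by (simp add: add_increasing2)
    have "measure (lawf \<nu>) {\<omega>. \<sigma> \<omega> < ennreal \<omega>} = measure (lawf \<nu>) {}"
      by (rule Q.finite_measure_eq_AE) (use True m in auto)
    moreover have "measure (lawf \<nu>) {\<omega>. \<sigma> \<omega> + ennreal t < ennreal \<omega>} = measure (lawf \<nu>) {}"
      by (rule Q.finite_measure_eq_AE)
        (use m in \<open>auto intro!: eventually_mono[OF True] dest: le_less_trans[OF le]\<close>)
    ultimately show ?thesis by simp
  next
    case False
    have "c \<noteq> \<infinity>"
    proof
      assume "c = \<infinity>"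
      have "AE \<omega> in lawf \<nu>. \<not> \<sigma> \<omega> < ennreal \<omega>"
        by (rule eventually_mono[OF c]) (auto simp: \<open>c = \<infinity>\<close>)
      with False show False by simp
    qed
    then obtain c' where c': "c = ennreal c'" "0 \<le> c'" by (cases c) auto
    have "{\<omega>. \<sigma> \<omega> \<le> ennreal c'} \<in> sets (lfilt \<nu> (ennreal c'))"
      using stopping_timeD[OF assms(2), of "ennreal c'"] by (simp add: pred_def)
    \<comment> \<open>Constancy says what \<sigma> equals if it stops before death, not that it does
      stop. The dichotomy at level c' decides this: were \<sigma> > c' on almost all paths alive at
      c', it would never precede \<zeta>.\<close>
    from law_filt_cases[OF s this c'(2)]
    have le: "AE \<omega> in lawf \<nu>. c' < \<omega> \<longrightarrow> \<sigma> \<omega> \<le> ennreal c'"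
    proof
      assume a: "AE \<omega> in lawf \<nu>. c' < \<omega> \<longrightarrow> \<omega> \<notin> {\<omega>. \<sigma> \<omega> \<le> ennreal c'}"
      have "AE \<omega> in lawf \<nu>. \<not> \<sigma> \<omega> < ennreal \<omega>"
        using a c by eventually_elim (auto simp: c' ennreal_less_iff)
      with False show ?thesis by simp
    qed simp
    have "AE \<omega> in lawf \<nu>. \<sigma> \<omega> + ennreal u < ennreal \<omega> \<longleftrightarrow> c' + u < \<omega>" if "0 \<le> u" for u
      using le c
    proof eventually_elim
      case (elim \<omega>)
      have plus: "ennreal c' + ennreal u = ennreal (c' + u)" using c'(2) that by simp
      show ?case
      proof
        assume *: "\<sigma> \<omega> + ennreal u < ennreal \<omega>"
        have "\<sigma> \<omega> \<le> \<sigma> \<omega> + ennreal u" by (simp add: add_increasing2)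
        also note *
        finally have "\<sigma> \<omega> = ennreal c'" using elim(2) c'(1) by simp
        hence "ennreal (c' + u) < ennreal \<omega>" using * plus by (simp only:)
        thus "c' + u < \<omega>" using c'(2) that by (subst (asm) ennreal_less_iff) auto
      next
        assume *: "c' + u < \<omega>"
        hence "\<sigma> \<omega> \<le> ennreal c'" using elim(1) that by auto
        hence "\<sigma> \<omega> + ennreal u \<le> ennreal (c' + u)" unfolding plus[symmetric] by (rule add_right_mono)
        also have "\<dots> < ennreal \<omega>" using * c'(2) that by (subst ennreal_less_iff) auto
        finally show "\<sigma> \<omega> + ennreal u < ennreal \<omega>" .
      qed
    qed
    hence *: "measure (lawf \<nu>) {\<omega>. \<sigma> \<omega> + ennreal u < ennreal \<omega>} = measure (lawf \<nu>) {c' + u<..}"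
      if "0 \<le> u" for u
      using that by (intro Q.finite_measure_eq_AE m g) simp
    have "exp (- (c' + t)) = exp (- t) * exp (- c')" by (simp add: exp_add[symmetric])
    with *[of 0] *[of t] show ?thesis
      using c'(2) assms(4) by (simp add: measure_law_from_greaterThan[OF s] del: exp_minus)
  qed
qed

section \<open>The filtration completed under all initial laws\<close>

lemma sets_filt: "sets (pfilt t) = {A. \<forall>\<nu>. is_law point_top \<nu> \<longrightarrow> A \<in> sets (lfilt \<nu> t)}" (is "_ = ?G")
proof -
  have "sigma_algebra UNIV ?G"
    unfolding sigma_algebra_iff2
  proof (intro conjI ballI allI impI)
    fix A assume A: "A \<in> ?G"
    have "space (lfilt \<nu> t) - A \<in> sets (lfilt \<nu> t)" if "is_law point_top \<nu>" for \<nu>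
      using A that by blast
    thus "UNIV - A \<in> ?G" by simp
  next
    fix A :: "nat \<Rightarrow> real set" assume "range A \<subseteq> ?G"
    hence "range A \<subseteq> sets (lfilt \<nu> t)" if "is_law point_top \<nu>" for \<nu>
      using that by blast
    thus "(\<Union>i. A i) \<in> ?G" using sets.countable_UN by blast
  qed simp_all
  thus ?thesis by (simp add: filt_def sigma_algebra.sigma_sets_eq)
qed

lemma filt_law_filt:
  assumes "is_law point_top \<nu>" shows "sets (pfilt t) \<subseteq> sets (lfilt \<nu> t)"
  using assms by (intro subsetI) (simp add: sets_filt)

lemma filt_law_filtI: "(\<And>\<nu>. is_law point_top \<nu> \<Longrightarrow> A \<in> sets (lfilt \<nu> t)) \<Longrightarrow> A \<in> sets (pfilt t)"
  by (simp add: sets_filt)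

lemma nat_filt_filt: "sets (nfilt t) \<subseteq> sets (pfilt t)"
  by (intro subsetI filt_law_filtI law_filtI) (simp_all add: is_law_point)

lemma filt_mono: "t \<le> u \<Longrightarrow> sets (pfilt t) \<subseteq> sets (pfilt u)"
proof (intro subsetI filt_law_filtI)
  fix A \<nu> assume *: "t \<le> u" "A \<in> sets (pfilt t)" "is_law point_top \<nu>"
  hence "sets (lfilt \<nu> t) \<subseteq> sets (lfilt \<nu> u)" by (intro law_filt_mono) (simp_all add: is_law_point)
  thus "A \<in> sets (lfilt \<nu> u)" using filt_law_filt[OF *(3), of t] *(2) by (simp add: subset_iff)
qed

lemma filtration_filt: "filtration UNIV pfilt"
  by standard (simp_all add: filt_mono)

text \<open>The completion for the start at the living point is one of those intersected, and its
  sets are measurable because \<open>exp_law\<close> is complete.\<close>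

lemma filt_exp_law: "sets (pfilt t) \<subseteq> sets exp_law"
proof
  let ?d = "return (borel_of (cem_top point_top)) (Some (0::real))"
  fix A assume "A \<in> sets (pfilt t)"
  hence "A \<in> sets (lfilt ?d t)" using filt_law_filt[OF is_law_return] by blast
  then obtain B N where BN: "B \<in> sets (nfilt t)" "N \<in> sets (nfilt \<infinity>)"
    "emeasure exp_law N = 0" "(A - B) \<union> (B - A) \<subseteq> N"
    by (subst (asm) sets_law_filt) (auto simp: law_from_return_Some)
  have b: "B \<in> sets borel" "N \<in> sets borel" using BN nat_filt_borel by blast+
  hence N: "N \<in> null_sets (density lborel (exponential_density 1))"
    using BN(3) by (auto simp: exp_law_def null_sets_def)
  have "A - B \<in> sets exp_law" "B - A \<in> sets exp_law"
    unfolding exp_law_def using BN(4) N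
    by (auto intro!: null_setsD2 null_sets_completion_subset[OF _ null_sets_completionI[OF N]])
  moreover have "A = (B - (B - A)) \<union> (A - B)" by auto
  ultimately show "A \<in> sets exp_law"
    using b(1) borel_sets_exp_law by (metis sets.Diff sets.Un)
qed

text \<open>For the start at the cemetery an exceptional set must avoid 0; being unable to separate
  nonpositive points, it then avoids all of them.\<close>

lemma filt_nonpos:
  assumes "A \<in> sets (pfilt t)" "x \<le> 0" shows "x \<in> A \<longleftrightarrow> 0 \<in> A"
proof -
  let ?d = "return (borel_of (cem_top point_top)) (None :: real option)"
  have "A \<in> sets (lfilt ?d t)" using filt_law_filt[OF is_law_return] assms(1) by blast
  then obtain B N where BN: "B \<in> sets (nfilt t)" "N \<in> sets (nfilt \<infinity>)"
    "emeasure (return exp_law 0) N = 0" "(A - B) \<union> (B - A) \<subseteq> N"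
    by (subst (asm) sets_law_filt) (auto simp: law_from_return_None simp del: emeasure_return)
  have "N \<in> sets exp_law" using BN(2) nat_filt_borel[of \<infinity>] borel_sets_exp_law by auto
  hence "0 \<notin> N" using BN(3) by (auto simp: indicator_def split: if_splits)
  hence "x \<notin> N" using nat_filt_nonpos[OF BN(2) assms(2)] by simp
  thus ?thesis using \<open>0 \<notin> N\<close> nat_filt_nonpos[OF BN(1) assms(2)] BN(4) by blast
qed

lemma filt_cases:
  assumes "A \<in> sets (pfilt (ennreal q))" "0 \<le> q"
  shows "(AE \<omega> in exp_law. q < \<omega> \<longrightarrow> \<omega> \<notin> A) \<or> (AE \<omega> in exp_law. q < \<omega> \<longrightarrow> \<omega> \<in> A)"
proof -
  let ?d = "return (borel_of (cem_top point_top)) (Some (0::real))"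
  have "A \<in> sets (lfilt ?d (ennreal q))" using filt_law_filt[OF is_law_return] assms(1) by blast
  from law_filt_cases[OF _ this assms(2)] show ?thesis
    unfolding law_from_return_Some by simp
qed

text \<open>Converse to \<open>filt_exp_law\<close>, \<open>filt_nonpos\<close> and
  \<open>filt_cases\<close>: together the three properties characterise the filtration at time
  t.\<close>

lemma filtI:
  assumes A: "A \<in> sets exp_law" "\<And>x. x \<le> 0 \<Longrightarrow> x \<in> A \<longleftrightarrow> 0 \<in> A" and t: "0 \<le> t"
    and c: "(AE \<omega> in exp_law. t < \<omega> \<longrightarrow> \<omega> \<notin> A) \<or> (AE \<omega> in exp_law. t < \<omega> \<longrightarrow> \<omega> \<in> A)"
  shows "A \<in> sets (pfilt (ennreal t))"
proof -
  let ?e = "density lborel (exponential_density 1)"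
  obtain S N N1 where S: "A = S \<union> N" "N \<subseteq> N1" "N1 \<in> null_sets ?e" "S \<in> sets borel"
    using A(1) by (auto simp: exp_law_def elim: sets_completionE)
  obtain T where T: "T = {} \<or> T = {t<..}" "AE \<omega> in exp_law. t < \<omega> \<longrightarrow> (\<omega> \<in> A \<longleftrightarrow> \<omega> \<in> T)"
    using c
  proof
    assume "AE \<omega> in exp_law. t < \<omega> \<longrightarrow> \<omega> \<notin> A"
    thus thesis using that[of "{}"] by simp
  next
    assume "AE \<omega> in exp_law. t < \<omega> \<longrightarrow> \<omega> \<in> A"
    thus thesis using that[of "{t<..}"] by (auto elim!: eventually_mono)
  qed
  obtain N2 where N2: "N2 \<in> null_sets ?e" "{\<omega>. \<not> (t < \<omega> \<longrightarrow> (\<omega> \<in> A \<longleftrightarrow> \<omega> \<in> T))} \<subseteq> N2"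
    using AE_exp_law_borel_null[OF T(2)] by blast
  \<comment> \<open>The model of A in the natural filtration is glued from three zones: a Borel
    version on (0,t], all or nothing on {..0}, and all or nothing beyond t.\<close>
  define B where "B = (S \<inter> {0<..t}) \<union> (if 0 \<in> A then {..0} else {}) \<union> T"
  \<comment> \<open>Restricted to the positive half line, the error set avoids 0 and is therefore
    null under every initial law at once.\<close>
  define M where "M = (N1 \<union> N2) \<inter> {0<..}"
  have "B \<in> sets (nfilt (ennreal t))"
    unfolding B_def using S(4) T(1) t
    by (auto intro!: sets.Un borel_nat_filt greaterThan_nat_filt atMost_nat_filt)
  moreover have M0: "M \<in> null_sets ?e"
    unfolding M_def using S(3) N2(1) by (intro null_set_Int2) auto
  moreover have "M \<in> sets (nfilt \<infinity>)"
    using null_setsD2[OF M0] by (intro borel_nat_filt_top) (auto simp: M_def)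
  moreover have "(A - B) \<union> (B - A) \<subseteq> M"
  proof
    fix x assume x: "x \<in> (A - B) \<union> (B - A)"
    consider "x \<le> 0" | "0 < x" "x \<le> t" | "0 < x" "t < x" by linarith
    thus "x \<in> M"
    proof cases
      case 1
      hence "x \<notin> T" using T(1) t by auto
      hence "x \<in> B \<longleftrightarrow> 0 \<in> A" using 1 by (auto simp: B_def)
      thus ?thesis using x A(2)[OF 1] by auto
    next
      case 2
      hence "x \<in> B \<longleftrightarrow> x \<in> S" using T(1) by (auto simp: B_def)
      thus ?thesis using x 2 S by (auto simp: M_def)
    next
      case 3
      hence "x \<in> B \<longleftrightarrow> x \<in> T" using t by (auto simp: B_def)
      thus ?thesis using x 3 N2(2) by (auto simp: M_def)
    qed
  qed
  moreover have "0 \<notin> M" by (simp add: M_def)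
  ultimately have "A \<in> sets (lfilt \<nu> (ennreal t))" if "sets \<nu> = Pow {None, Some 0}" for \<nu>
    unfolding sets_law_filt[OF that] using emeasure_law_from_null[OF that, of M]
    by (intro CollectI bexI[of _ B] bexI[of _ M] conjI)
  thus ?thesis by (intro filt_law_filtI) (simp add: is_law_point)
qed

text \<open>By the characterisation in \<open>filtI\<close>, only triviality beyond t remains to be
  derived from triviality beyond every s > t.\<close>

lemma filt_right_continuous:
  assumes "t < \<infinity>"
  shows "sets (pfilt t) = (\<Inter>s\<in>{t<..}. sets (pfilt s))"
proof
  show "sets (pfilt t) \<subseteq> (\<Inter>s\<in>{t<..}. sets (pfilt s))"
    using filt_mono by (auto intro: less_imp_le)
  show "(\<Inter>s\<in>{t<..}. sets (pfilt s)) \<subseteq> sets (pfilt t)"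
  proof
    fix A assume A: "A \<in> (\<Inter>s\<in>{t<..}. sets (pfilt s))"
    obtain r where r: "t = ennreal r" "0 \<le> r" using assms by (cases t) auto
    have As: "A \<in> sets (pfilt (ennreal s))" if "r < s" for s
      using A that r by (auto simp: ennreal_less_iff)
    define out where "out s \<longleftrightarrow> (AE \<omega> in exp_law. s < \<omega> \<longrightarrow> \<omega> \<notin> A)" for s
    define inn where "inn s \<longleftrightarrow> (AE \<omega> in exp_law. s < \<omega> \<longrightarrow> \<omega> \<in> A)" for s
    have io: "out s \<or> inn s" if "r < s" for s
      unfolding out_def inn_def using filt_cases[OF As] that r(2) by simp
    \<comment> \<open>A sequence decreasing to r exhausts {r<..} by countably many half lines, so
      the almost sure statements combine.\<close>
    have cont: "AE \<omega> in exp_law. r < \<omega> \<longrightarrow> P \<omega>"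
      if "r < s0" "\<And>s. r < s \<Longrightarrow> s \<le> s0 \<Longrightarrow> AE \<omega> in exp_law. s < \<omega> \<longrightarrow> P \<omega>" for P s0
    proof -
      have "AE \<omega> in exp_law. \<forall>n. r + (s0 - r) / real (Suc n) < \<omega> \<longrightarrow> P \<omega>"
        unfolding AE_all_countable
        using that by (intro allI that(2)) (auto simp: field_simps mult_right_mono)
      thus ?thesis
      proof (rule eventually_mono, intro impI)
        fix \<omega> assume *: "\<forall>n. r + (s0 - r) / real (Suc n) < \<omega> \<longrightarrow> P \<omega>" "r < \<omega>"
        obtain n where "(s0 - r) / (\<omega> - r) < real (Suc n)"
          using reals_Archimedean2[of "(s0 - r) / (\<omega> - r)"] by (metis less_trans lessI of_nat_less_iff)
        hence "r + (s0 - r) / real (Suc n) < \<omega>" using *(2) by (simp add: field_simps)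
        thus "P \<omega>" using * by blast
      qed
    qed
    have "out r \<or> inn r"
    proof (cases "\<forall>s>r. out s")
      case True
      thus ?thesis unfolding out_def using cont[of "r + 1" "\<lambda>\<omega>. \<omega> \<notin> A"] by auto
    next
      case False
      then obtain s0 where s0: "r < s0" "\<not> out s0" by blast
      \<comment> \<open>\<open>out\<close> is inherited by larger levels. If it fails at s0, it
        fails at all smaller ones, and \<open>inn\<close> must hold there.\<close>
      have "inn s" if "r < s" "s \<le> s0" for s
      proof -
        have "\<not> out s"
        proof
          assume "out s"
          hence "out s0" unfolding out_def by (rule eventually_mono) (use that in auto)
          with s0 show False by simp
        qed
        thus ?thesis using io that by blast
      qed
      thus ?thesis unfolding inn_def using cont[OF s0(1), of "\<lambda>\<omega>. \<omega> \<in> A"] by blast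
    qed
    moreover have "A \<in> sets (pfilt (ennreal (r + 1)))" by (rule As) simp
    ultimately show "A \<in> sets (pfilt t)"
      unfolding r(1) out_def inn_def
      using filt_exp_law filt_nonpos r(2) by (intro filtI) blast+
  qed
qed

lemma stopping_time_law_filt:
  "is_law point_top \<nu> \<Longrightarrow> stopping_time pfilt \<sigma> \<Longrightarrow> stopping_time (lfilt \<nu>) \<sigma>"
  unfolding stopping_time_def pred_def using filt_law_filt by (simp add: subset_iff)

lemma stopping_time_lifetime:
  assumes "is_law point_top \<nu>" shows "stopping_time (lfilt \<nu>) (\<lambda>\<omega>. ennreal \<omega>)"
proof
  fix t :: ennreal
  have s: "sets \<nu> = Pow {None, Some 0}" using assms by (simp add: is_law_point)
  show "Measurable.pred (lfilt \<nu> t) (\<lambda>\<omega>. ennreal \<omega> \<le> t)"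
  proof (cases t)
    case (real r)
    hence "{\<omega>. ennreal \<omega> \<le> t} = {..r}" by (auto simp: ennreal_le_iff)
    thus ?thesis using real atMost_nat_filt[of r t] by (simp add: pred_def law_filtI[OF s])
  qed simp
qed

lemma stopping_time_lifetime_filt: "stopping_time pfilt (\<lambda>\<omega>. ennreal \<omega>)"
  using stopping_time_lifetime by (simp add: stopping_time_def pred_def sets_filt)

section \<open>The strong Markov property\<close>

lemma law_killed_point_vimage:
  assumes "0 \<le> t"
  shows "measure exp_law {\<omega>. (if t < \<omega> then Some 0 else None) \<in> A} =
    indicator A None + (indicator A (Some 0) - indicator A None) * exp (- t)"
    (is "measure _ ?S = _")
proof -
  have *: "measure exp_law {t<..} = exp (- t)"
    using emeasure_exp_law_greaterThan[OF assms] by (simp add: measure_def)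
  have "measure exp_law {..t} = 1 - measure exp_law {t<..}"
    using exp_law.prob_compl[of "{t<..}"] by (simp add: borel_sets_exp_law Compl_greaterThan flip: Compl_eq_Diff_UNIV)
  moreover have "?S = (if Some 0 \<in> A then {t<..} else {}) \<union> (if None \<in> A then {..t} else {})"
    by (auto split: if_splits)
  moreover have "{t<..} \<union> {..t} = UNIV" by auto
  ultimately show ?thesis using * exp_law.prob_space by auto
qed

text \<open>With two states, both sides are affine in an indicator: that of \<sigma> + t < \<zeta>
  on the left and, with factor exp(-t), that of \<sigma> < \<zeta> on the right. What remains is the
  memoryless identity on each event C of the sigma-algebra at \<sigma>.\<close>

lemma strong_markov_killed_point:
  assumes \<nu>: "is_law point_top \<nu>" and \<sigma>: "stopping_time pfilt \<sigma>" and t: "0 \<le> t"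
  shows "AE \<omega> in lawf \<nu>. real_cond_exp (lawf \<nu>) (filtration.pre_sigma UNIV pfilt \<sigma>)
              (indicator {\<omega>'. path_at killed_point_process (\<sigma> \<omega>' + ennreal t) \<omega>' \<in> A}) \<omega>
            = measure (law killed_point_process (path_at killed_point_process (\<sigma> \<omega>) \<omega>))
                {\<omega>'. path killed_point_process t \<omega>' \<in> A}"
proof -
  interpret F: filtration UNIV pfilt by (rule filtration_filt)
  interpret Q: prob_space "lawf \<nu>" by (rule prob_space_law_from[OF \<nu>])
  have s: "sets \<nu> = Pow {None, Some 0}" using \<nu> by (simp add: is_law_point)
  let ?F = "F.pre_sigma \<sigma>"
  have sub: "sets ?F \<subseteq> sets exp_law"
  proof
    fix C assume "C \<in> sets ?F"
    from F.sets_pre_sigmaD[OF \<sigma> this, of \<infinity>] show "C \<in> sets exp_law" using filt_exp_law by auto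
  qed
  interpret S: finite_measure_subalgebra "lawf \<nu>" ?F
    using sub by unfold_locales (auto simp: subalgebra_def F.space_pre_sigma space_law_from[OF s] sets_law_from[OF s])
  have ms: "\<sigma>' \<in> borel_measurable exp_law" if "stopping_time pfilt \<sigma>'" for \<sigma>' :: "real \<Rightarrow> ennreal"
    by (rule measurable_stopping_time[OF that]) (simp_all add: filt_exp_law)
  have ml: "(\<lambda>\<omega>. ennreal \<omega>) \<in> borel_measurable exp_law" by (simp add: borel_measurable_exp_law)
  have mset: "{\<omega>. \<sigma> \<omega> + ennreal u < ennreal \<omega>} \<in> sets exp_law" for u
  proof -
    note [measurable] = ms[OF \<sigma>] ml
    have "{\<omega>\<in>space exp_law. \<sigma> \<omega> + ennreal u < ennreal \<omega>} \<in> sets exp_law" by measurable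
    thus ?thesis by simp
  qed
  define \<alpha> \<beta> where "\<alpha> = (indicator A (Some 0) :: real)" and "\<beta> = (indicator A None :: real)"
  define f :: "real \<Rightarrow> real" where "f = indicator {\<omega>'. path_at killed_point_process (\<sigma> \<omega>' + ennreal t) \<omega>' \<in> A}"
  define g where "g \<omega> = measure (law killed_point_process (path_at killed_point_process (\<sigma> \<omega>) \<omega>))
                {\<omega>'. path killed_point_process t \<omega>' \<in> A}" for \<omega>
  let ?G = "\<lambda>u. {\<omega>. \<sigma> \<omega> + ennreal u < ennreal \<omega>}"
  have f_eq: "f \<omega> = \<beta> + (\<alpha> - \<beta>) * indicator (?G t) \<omega>" for \<omega>
    by (auto simp: f_def \<alpha>_def \<beta>_def indicator_def path_at_killed_point)
  have g_eq: "g \<omega> = \<beta> + (\<alpha> - \<beta>) * exp (- t) * indicator (?G 0) \<omega>" for \<omega>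
  proof -
    have "{\<omega>'. (if t < \<omega>' then Some 0 else None) \<in> A} \<in> sets exp_law"
    proof -
      have "{\<omega>'. (if t < \<omega>' then Some 0 else None) \<in> A} =
        (if Some 0 \<in> A then {t<..} else {}) \<union> (if None \<in> A then {..t} else {})"
        by (auto split: if_splits)
      thus ?thesis by (simp add: borel_sets_exp_law)
    qed
    hence "measure (return exp_law 0) {\<omega>'. (if t < \<omega>' then Some 0 else None) \<in> A} = \<beta>"
      using t by (simp add: measure_return \<beta>_def indicator_def)
    thus ?thesis using law_killed_point_vimage[OF t, of A]
      by (auto simp: g_def path_at_killed_point \<alpha>_def \<beta>_def)
  qed
  have "AE \<omega> in lawf \<nu>. real_cond_exp (lawf \<nu>) ?F f \<omega> = g \<omega>"
  proof (rule S.real_cond_exp_charact)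
    fix C assume C: "C \<in> sets ?F"
    \<comment> \<open>Postponing \<sigma> to infinity off C gives another stopping time, so
      intersecting with C is absorbed into the memoryless lemma.\<close>
    define \<sigma>C where "\<sigma>C \<omega> = (if \<omega> \<in> C then \<sigma> \<omega> else \<infinity>)" for \<omega>
    have \<sigma>C: "stopping_time pfilt \<sigma>C"
    proof
      fix u
      have "{\<omega>. \<sigma>C \<omega> \<le> u} \<in> sets (pfilt u)"
      proof (cases "u = \<infinity>")
        case False
        hence "{\<omega>. \<sigma>C \<omega> \<le> u} = {\<omega>\<in>C. \<sigma> \<omega> \<le> u}" by (auto simp: \<sigma>C_def top_unique)
        thus ?thesis using F.sets_pre_sigmaD[OF \<sigma> C] by simp
      next
        case True
        hence "{\<omega>. \<sigma>C \<omega> \<le> u} = space (pfilt u)" by auto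
        thus ?thesis by (metis sets.top)
      qed
      thus "Measurable.pred (pfilt u) (\<lambda>\<omega>. \<sigma>C \<omega> \<le> u)" by (simp add: pred_def)
    qed
    have "{\<omega>. \<sigma>C \<omega> + ennreal u < ennreal \<omega>} = C \<inter> ?G u" for u
      by (auto simp: \<sigma>C_def)
    with memoryless_before_lifetime[OF \<nu> stopping_time_law_filt[OF \<nu> \<sigma>C] ms[OF \<sigma>C] t]
    have key: "measure (lawf \<nu>) (C \<inter> ?G t) = exp (- t) * measure (lawf \<nu>) (C \<inter> ?G 0)"
      by (metis (no_types, lifting) Collect_cong add.right_neutral ennreal_0)
    have Cm: "C \<in> sets (lawf \<nu>)" "C \<inter> ?G u \<in> sets (lawf \<nu>)" for u
      using C sub mset by (auto simp: sets_law_from[OF s])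
    have int: "(\<integral>\<omega>\<in>C. (\<beta> + c * indicator (?G u) \<omega>) \<partial>lawf \<nu>) = \<beta> * measure (lawf \<nu>) C + c * measure (lawf \<nu>) (C \<inter> ?G u)"
      for c u :: real
    proof -
      have "(\<integral>\<omega>\<in>C. (\<beta> + c * indicator (?G u) \<omega>) \<partial>lawf \<nu>)
        = (\<integral>\<omega>. \<beta> * indicator C \<omega> + c * indicator (C \<inter> ?G u) \<omega> \<partial>lawf \<nu>)"
        unfolding set_lebesgue_integral_def
        by (intro Bochner_Integration.integral_cong) (auto simp: indicator_def)
      also have "\<dots> = \<beta> * measure (lawf \<nu>) C + c * measure (lawf \<nu>) (C \<inter> ?G u)"
        using Cm by (subst Bochner_Integration.integral_add)
          (auto simp: Q.emeasure_eq_measure intro!: integrable_mult_right integrable_real_indicator)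
      finally show ?thesis .
    qed
    show "(\<integral>\<omega>\<in>C. f \<omega> \<partial>lawf \<nu>) = (\<integral>\<omega>\<in>C. g \<omega> \<partial>lawf \<nu>)"
      unfolding f_eq g_eq int key by simp
  next
    have i: "integrable (lawf \<nu>) (\<lambda>\<omega>. \<beta> + c * indicator (?G u) \<omega>)" for c u :: real
      using mset by (intro Bochner_Integration.integrable_add integrable_mult_right integrable_real_indicator)
        (auto simp: sets_law_from[OF s] Q.emeasure_eq_measure)
    show "integrable (lawf \<nu>) f" "integrable (lawf \<nu>) g"
      unfolding f_eq[abs_def] g_eq[abs_def] by (rule i)+
    \<comment> \<open>The comparison \<sigma> < \<zeta> of two stopping times is decided at time
      \<sigma>.\<close>
    have [measurable]: "?G 0 \<in> sets ?F"
      using F.stopping_time_less[OF \<sigma> stopping_time_lifetime_filt] by (simp add: pred_def F.space_pre_sigma)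
    show "g \<in> borel_measurable ?F" unfolding g_eq[abs_def] by measurable
  qed
  thus ?thesis unfolding f_def g_def .
qed

section \<open>The process is special standard and associated with the form\<close>

lemma measurable_of_Pow:
  assumes "sets M = Pow (space M)" "\<And>x. x \<in> space M \<Longrightarrow> f x \<in> space N"
  shows "f \<in> measurable M N"
  using assms by (auto simp: measurable_def)

text \<open>In a discrete space convergence means being eventually equal. At s = \<omega> the left
  limit is still alive while the path is dead: this is the jump that the Levy system
  records.\<close>

lemma limitin_killed_point_at_left:
  assumes "0 < s"
  shows "limitin (cem_top point_top) (\<lambda>r. path killed_point_process r \<omega>) l (at_left s) \<longleftrightarrow>
    l = (if s \<le> \<omega> then Some 0 else None)" (is "?L l \<longleftrightarrow> l = ?l")
proof -
  have ev: "eventually (\<lambda>r. path killed_point_process r \<omega> = ?l) (at_left s)"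
  proof (cases "s \<le> \<omega>")
    case True
    have "eventually (\<lambda>r. r \<in> {s - 1<..<s}) (at_left s)" by (intro eventually_at_leftI[of "s - 1"]) auto
    thus ?thesis using True by (auto elim!: eventually_mono)
  next
    case False
    hence "eventually (\<lambda>r. r \<in> {\<omega><..<s}) (at_left s)" by (intro eventually_at_leftI[of \<omega>]) auto
    thus ?thesis using False by (auto elim!: eventually_mono)
  qed
  have *: "?l \<in> {None, Some 0}" by auto
  show ?thesis
  proof
    assume l: "l = ?l"
    show "?L l" unfolding l
      using ev * by (intro limitin_eventually) (simp_all add: cem_top_discrete insert_commute)
  next
    assume L: "?L l"
    have "l \<in> topspace (cem_top point_top)" using L by (rule limitin_topspace)
    hence "openin (cem_top point_top) {l}" by (simp add: cem_top_discrete)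
    hence ev_l: "eventually (\<lambda>r. path killed_point_process r \<omega> \<in> {l}) (at_left s)"
      by (intro L[unfolded limitin_def, THEN conjunct2, rule_format] conjI singletonI)
    obtain r where r: "path killed_point_process r \<omega> \<in> {l}" "path killed_point_process r \<omega> = ?l"
      using eventually_happens'[OF trivial_limit_at_left_real eventually_conj[OF ev_l ev]]
      by (elim exE conjE)
    have "l = path killed_point_process r \<omega>" using r(1) by (rule singletonD[symmetric])
    thus "l = ?l" using r(2) by (rule trans)
  qed
qed

lemma path_killed_point_measurable:
  "path killed_point_process t \<in> measurable exp_law (borel_of (cem_top point_top))"
proof (rule measurableI)
  fix A :: "real option set"
  show "path killed_point_process t -` A \<inter> space exp_law \<in> sets exp_law"
    unfolding space_exp_law path_vimage by (simp add: borel_sets_exp_law)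
qed auto

lemma right_process_killed_point: "right_process point_top killed_point_process"
  unfolding right_process_def Let_def
proof (intro conjI allI impI ballI)
  fix x assume "x \<in> topspace (cem_top point_top)"
  hence x: "x = None \<or> x = Some 0" by (auto simp: topspace_cem_top)
  thus "prob_space (law killed_point_process x)"
    using exp_law.prob_space_axioms prob_space_return[of 0 exp_law] by auto
  show "sets (law killed_point_process x) = sets (amb killed_point_process)"
    using x by auto
  show "AE \<omega> in law killed_point_process x. path killed_point_process 0 \<omega> = x"
    using x
  proof
    assume "x = Some 0"
    show ?thesis
      unfolding \<open>x = Some 0\<close> killed_point_process_simps using AE_exp_law_pos by simp
  next
    assume "x = None"
    have "AE \<omega> in return exp_law 0. (if 0 < \<omega> then Some 0 else None) = None"
      by (rule AE_I[of _ _ "{0<..}"]) (auto simp: borel_sets_exp_law)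
    thus ?thesis unfolding \<open>x = None\<close> killed_point_process_simps .
  qed
next
  fix \<Lambda>
  show "universally_measurable point_top (\<lambda>x. emeasure (law killed_point_process x) \<Lambda>)"
    unfolding universally_measurable_def
  proof (intro allI impI measurable_completion measurable_of_Pow)
    fix \<nu> assume "is_law point_top \<nu>"
    thus "sets \<nu> = Pow (space \<nu>)" using space_nu by (auto simp: is_law_point)
  qed simp
next
  fix t :: real
  show "path killed_point_process t \<in> measurable (amb killed_point_process) (borel_of (cem_top point_top))"
    using path_killed_point_measurable by simp
next
  show "sets (pfilt \<infinity>) \<subseteq> sets (amb killed_point_process)"
    using filt_exp_law by simp
next
  fix \<omega> t :: real
  assume t: "0 \<le> t"
  thus "(path killed_point_process t \<omega> = None) = (lifetime killed_point_process \<omega> \<le> ennreal t)"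
    by (simp add: not_less)
  show "shift killed_point_process t \<omega> \<in> samples killed_point_process" by simp
  fix s :: real
  show "path killed_point_process s (shift killed_point_process t \<omega>) = path killed_point_process (s + t) \<omega>"
    by (simp add: less_diff_eq)
next
  fix \<omega> t :: real
  assume t: "0 \<le> t"
  show "limitin (cem_top point_top) (\<lambda>s. path killed_point_process s \<omega>) (path killed_point_process t \<omega>) (at_right t)"
  proof (rule limitin_eventually)
    show "eventually (\<lambda>s. path killed_point_process s \<omega> = path killed_point_process t \<omega>) (at_right t)"
    proof (cases "t < \<omega>")
      case True
      hence "eventually (\<lambda>r. r \<in> {t<..<\<omega>}) (at_right t)" by (intro eventually_at_rightI[of t \<omega>]) auto
      thus ?thesis using True by (auto elim!: eventually_mono)
    next
      case False
      thus ?thesis using eventually_at_right_less[of t] by (auto elim!: eventually_mono)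
    qed
  qed (simp add: topspace_cem_top)
next
  fix t :: ennreal assume "t < \<infinity>"
  thus "sets (pfilt t) = (\<Inter>s\<in>{t<..}. sets (pfilt s))" by (rule filt_right_continuous)
next
  fix \<nu> :: "real option measure" and \<sigma> and A :: "real option set" and t :: real
  assume "is_law point_top \<nu>" "stopping_time pfilt \<sigma>" "0 \<le> t"
  from strong_markov_killed_point[OF this, of A]
  show "AE \<omega> in lawf \<nu>.
      real_cond_exp (lawf \<nu>) (filtration.pre_sigma (samples killed_point_process) pfilt \<sigma>)
        (indicator {\<omega>' \<in> samples killed_point_process. path_at killed_point_process (\<sigma> \<omega>' + ennreal t) \<omega>' \<in> A}) \<omega>
      = measure (law killed_point_process (path_at killed_point_process (\<sigma> \<omega>) \<omega>))
          {\<omega>' \<in> samples killed_point_process. path killed_point_process t \<omega>' \<in> A}"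
    by simp
qed

text \<open>The lifetime is totally inaccessible: announcing times are deterministic before it, so
  their limit can only hit it on a single atom of a diffuse law.\<close>

lemma lifetime_totally_inaccessible:
  assumes \<nu>: "is_law point_top \<nu>" and st: "\<And>n. stopping_time (lfilt \<nu>) (\<tau>s n)"
    and lim: "\<And>\<omega>. incseq (\<lambda>n. \<tau>s n \<omega>) \<and> (\<lambda>n. \<tau>s n \<omega>) \<longlonglongrightarrow> \<tau> \<omega>"
  shows "AE \<omega> in lawf \<nu>. \<not> ((\<forall>n. \<tau>s n \<omega> < ennreal \<omega>) \<and> \<not> \<tau> \<omega> < ennreal \<omega>)"
proof -
  have s: "sets \<nu> = Pow {None, Some 0}" using \<nu> by (simp add: is_law_point)
  have "\<forall>n. \<exists>c. AE \<omega> in lawf \<nu>. \<tau>s n \<omega> < ennreal \<omega> \<longrightarrow> \<tau>s n \<omega> = c"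
    using stopping_time_const_before_lifetime[OF s st] by blast
  then obtain c where "\<And>n. AE \<omega> in lawf \<nu>. \<tau>s n \<omega> < ennreal \<omega> \<longrightarrow> \<tau>s n \<omega> = c n" by metis
  hence c: "AE \<omega> in lawf \<nu>. \<forall>n. \<tau>s n \<omega> < ennreal \<omega> \<longrightarrow> \<tau>s n \<omega> = c n"
    by (simp add: AE_all_countable)
  have hit: "c \<longlonglongrightarrow> ennreal \<omega>" "0 < \<omega>"
    if "\<forall>n. \<tau>s n \<omega> < ennreal \<omega> \<longrightarrow> \<tau>s n \<omega> = c n" "\<forall>n. \<tau>s n \<omega> < ennreal \<omega>" "\<not> \<tau> \<omega> < ennreal \<omega>" for \<omega>
  proof -
    have "(\<lambda>n. \<tau>s n \<omega>) = c" using that(1,2) by auto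
    moreover have "\<tau> \<omega> \<le> ennreal \<omega>"
      using lim that(2) by (intro LIMSEQ_le_const2[of "\<lambda>n. \<tau>s n \<omega>" "\<tau> \<omega>"]) (auto intro: less_imp_le)
    ultimately show "c \<longlonglongrightarrow> ennreal \<omega>" using lim[of \<omega>] that(3) by simp
    have "0 < ennreal \<omega>" using that(2) by (metis not_gr_zero not_less_zero)
    thus "0 < \<omega>" by simp
  qed
  show ?thesis
  proof (cases "\<exists>\<omega>0. c \<longlonglongrightarrow> ennreal \<omega>0 \<and> 0 < \<omega>0")
    case True
    then obtain \<omega>0 where w: "c \<longlonglongrightarrow> ennreal \<omega>0" "0 < \<omega>0" by blast
    \<comment> \<open>Positivity of the limit point matters: 0 may be an atom of the law, and no
      other sample point can be one.\<close>
    have "AE \<omega> in lawf \<nu>. \<omega> \<noteq> \<omega>0"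
      using w(2) AE_exp_law_neq by (intro AE_law_fromI[OF s]) auto
    with c show ?thesis
    proof eventually_elim
      case (elim \<omega>)
      show ?case
      proof
        assume "(\<forall>n. \<tau>s n \<omega> < ennreal \<omega>) \<and> \<not> \<tau> \<omega> < ennreal \<omega>"
        with hit[OF elim(1)] have "c \<longlonglongrightarrow> ennreal \<omega>" "0 < \<omega>" by auto
        hence "ennreal \<omega> = ennreal \<omega>0" using w(1) LIMSEQ_unique by blast
        thus False using elim(2) \<open>0 < \<omega>\<close> w(2) by simp
      qed
    qed
  next
    case False
    from c show ?thesis
    proof eventually_elim
      case (elim \<omega>)
      thus ?case using hit[OF elim] False by blast
    qed
  qed
qed

text \<open>Before \<zeta> the path is constant, so quasi-left-continuity is immediate. The delicate
  clause is the last one: whether \<tau> precedes \<zeta> must be decided by the information at the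
  announcing times.\<close>

lemma special_standard_killed_point: "special_standard point_top killed_point_process"
  unfolding special_standard_def
proof (intro conjI allI impI)
  show "right_process point_top killed_point_process" by (rule right_process_killed_point)
next
  fix \<nu> assume \<nu>: "is_law point_top \<nu>"
  have "\<exists>l\<in>topspace point_top. limitin (cem_top point_top) (\<lambda>s. path killed_point_process s \<omega>) (Some l) (at_left t)"
    if "0 < t" "ennreal t < ennreal \<omega>" for t \<omega>
    using that by (subst limitin_killed_point_at_left) (auto simp: ennreal_less_iff)
  thus "AE \<omega> in lawf \<nu>. \<forall>t>0. ennreal t < lifetime killed_point_process \<omega> \<longrightarrow>
      (\<exists>l\<in>topspace point_top. limitin (cem_top point_top) (\<lambda>s. path killed_point_process s \<omega>) (Some l) (at_left t))"
    by simp
next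
  fix \<nu> \<tau> \<tau>s
  assume \<nu>: "is_law point_top \<nu>" and \<tau>: "stopping_time (lfilt \<nu>) \<tau>"
    and \<tau>s: "\<forall>n. stopping_time (lfilt \<nu>) (\<tau>s n)"
    and "\<forall>\<omega>\<in>samples killed_point_process. incseq (\<lambda>n. \<tau>s n \<omega>) \<and> (\<lambda>n. \<tau>s n \<omega>) \<longlonglongrightarrow> \<tau> \<omega>"
  hence lim: "incseq (\<lambda>n. \<tau>s n \<omega>) \<and> (\<lambda>n. \<tau>s n \<omega>) \<longlonglongrightarrow> \<tau> \<omega>" for \<omega> by simp
  have le: "\<tau>s n \<omega> \<le> \<tau> \<omega>" for n \<omega> using lim[of \<omega>] incseq_le by blast
  have s: "sets \<nu> = Pow {None, Some 0}" using \<nu> by (simp add: is_law_point)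
  have "limitin (cem_top point_top) (\<lambda>n. path_at killed_point_process (\<tau>s n \<omega>) \<omega>)
      (path_at killed_point_process (\<tau> \<omega>) \<omega>) sequentially" if "\<tau> \<omega> < ennreal \<omega>" for \<omega>
    using that le_less_trans[OF le that]
    by (simp add: path_at_killed_point topspace_cem_top)
  thus "AE \<omega> in lawf \<nu>. \<tau> \<omega> < lifetime killed_point_process \<omega> \<longrightarrow>
      limitin (cem_top point_top) (\<lambda>n. path_at killed_point_process (\<tau>s n \<omega>) \<omega>)
        (path_at killed_point_process (\<tau> \<omega>) \<omega>) sequentially"
    by simp
  interpret F: filtration UNIV "lfilt \<nu>" by (rule filtration_law_filt[OF s])
  let ?U = "\<Union>n. sets (F.pre_sigma (\<tau>s n))"
  let ?G = "sigma UNIV ?U"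
  have setsG: "sets ?G = sigma_sets UNIV ?U" by (simp add: sets_measure_of_conv)
  have sp: "space ?G = UNIV" by (simp add: space_measure_of_conv)
  have top: "UNIV \<in> sets ?G" using sets.top[of ?G] unfolding sp .
  have sub: "A \<in> sets ?G" if "A \<in> sets (F.pre_sigma (\<tau>s n))" for A n
    unfolding setsG by (rule sigma_sets.Basic) (use that in blast)
  \<comment> \<open>The event \<tau> < \<zeta> is the event that every \<tau>s n precedes \<zeta>,
    minus D. Inaccessibility makes D null, and completion places it in the sigma-algebra of \<tau>s
    0.\<close>
  define D where "D = {\<omega>. (\<forall>n. \<tau>s n \<omega> < ennreal \<omega>) \<and> \<not> \<tau> \<omega> < ennreal \<omega>}"
  have D0: "AE \<omega> in lawf \<nu>. \<omega> \<notin> D"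
    using lifetime_totally_inaccessible[OF \<nu> _ lim] \<tau>s by (simp add: D_def)
  have Dpos: "D \<subseteq> {0<..}"
  proof
    fix \<omega> assume "\<omega> \<in> D"
    hence "\<tau>s 0 \<omega> < ennreal \<omega>" by (simp add: D_def)
    hence "0 < ennreal \<omega>" by (metis not_gr_zero not_less_zero)
    thus "\<omega> \<in> {0<..}" by simp
  qed
  have "D \<in> sets (F.pre_sigma (\<tau>s 0))"
  proof (rule F.sets_pre_sigmaI)
    show "stopping_time (lfilt \<nu>) (\<tau>s 0)" using \<tau>s by blast
    show "{\<omega> \<in> D. \<tau>s 0 \<omega> \<le> t} \<in> sets (lfilt \<nu> t)" for t
      using Dpos by (intro law_filt_null[OF s] eventually_mono[OF D0]) auto
  qed
  hence DG: "D \<in> sets ?G" by (rule sub)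
  have "{\<omega>. \<tau>s n \<omega> < ennreal \<omega>} \<in> sets ?G" for n
    using F.stopping_time_less[OF \<tau>s[rule_format] stopping_time_lifetime[OF \<nu>], of n]
    by (intro sub[of _ n]) (simp add: pred_def F.space_pre_sigma)
  hence "(\<Inter>n. {\<omega>. \<tau>s n \<omega> < ennreal \<omega>}) - D \<in> sets ?G"
    using DG by (intro sets.Diff sets.countable_INT'' top countableI_type)
  also have "(\<Inter>n. {\<omega>. \<tau>s n \<omega> < ennreal \<omega>}) - D = {\<omega>. \<tau> \<omega> < ennreal \<omega>}"
    using le by (auto simp: D_def intro: le_less_trans)
  finally have main: "{\<omega>. \<tau> \<omega> < ennreal \<omega>} \<in> sets ?G" .
  have "(\<lambda>\<omega>. path_at killed_point_process (\<tau> \<omega>) \<omega>) \<in> measurable ?G (borel_of (cem_top point_top))"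
  proof (rule measurableI)
    fix A :: "real option set"
    have "(\<lambda>\<omega>. path_at killed_point_process (\<tau> \<omega>) \<omega>) -` A \<inter> space ?G =
      (if Some 0 \<in> A then {\<omega>. \<tau> \<omega> < ennreal \<omega>} else {}) \<union> (if None \<in> A then space ?G - {\<omega>. \<tau> \<omega> < ennreal \<omega>} else {})"
      unfolding sp by (auto simp: path_at_killed_point split: if_splits)
    also have "\<dots> \<in> sets ?G" using main sets.compl_sets[OF main]
      by (intro sets.Un) (simp_all del: sets_measure_of space_measure_of)
    finally show "(\<lambda>\<omega>. path_at killed_point_process (\<tau> \<omega>) \<omega>) -` A \<inter> space ?G \<in> sets ?G" .
  qed (simp add: path_at_killed_point)
  thus "(\<lambda>\<omega>. path_at killed_point_process (\<tau> \<omega>) \<omega>) \<in> measurable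
      (sigma (samples killed_point_process)
        (\<Union>n. sets (filtration.pre_sigma (samples killed_point_process) (lfilt \<nu>) (\<tau>s n))))
      (borel_of (cem_top point_top))"
    by simp
qed

lemma m_tight_killed_point: "m_tight killed_point_form killed_point_process"
proof -
  \<comment> \<open>The state space is its own compact exhaustion, so the set to be hit is
    empty.\<close>
  have "hitting_time killed_point_process {} \<omega> = \<infinity>" for \<omega> by (simp add: hitting_time_def)
  thus ?thesis
    unfolding m_tight_def
    by (intro exI[of _ "\<lambda>_. {0}"] conjI allI) (simp_all add: compactin_discrete_topology del: AE_count_space_point AE_killed_point_form killed_point_process_simps)
qed

lemma integral_exp_law_greaterThan:
  assumes "0 \<le> t" shows "(\<integral>\<omega>. (if t < \<omega> then a else 0) \<partial>exp_law) = a * exp (- t)"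
proof -
  have "(\<integral>\<omega>. (if t < \<omega> then a else 0) \<partial>exp_law) = (\<integral>\<omega>. a * indicator {t<..} \<omega> \<partial>exp_law)"
    by (intro Bochner_Integration.integral_cong) (auto simp: indicator_def)
  also have "\<dots> = a * measure exp_law {t<..}" by simp
  finally show ?thesis
    using emeasure_exp_law_greaterThan[OF assms] by (simp add: measure_def)
qed

lemma properly_associated_killed_point: "properly_associated killed_point_form killed_point_process"
  unfolding properly_associated_def
proof (intro exI conjI allI impI)
  show "form_semigroup killed_point_form (\<lambda>t f x. exp (- t) * f x)"
    by (rule form_semigroup_killed_point)
  fix f :: "real \<Rightarrow> real" and t :: real
  assume t: "0 < t"
  have "(\<integral>\<omega>. ext0 f (path killed_point_process t \<omega>) \<partial>exp_law) = (\<integral>\<omega>. (if t < \<omega> then f 0 else 0) \<partial>exp_law)"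
    by (intro Bochner_Integration.integral_cong) auto
  thus "qc_version killed_point_form (\<lambda>x. exp (- t) * f x)
      (\<lambda>x. \<integral>\<omega>. ext0 f (path killed_point_process t \<omega>) \<partial>law killed_point_process (Some x))"
    using t by (simp only: qc_version_killed_point killed_point_process_simps) (simp add: integral_exp_law_greaterThan)
qed

section \<open>Additive functionals of the lifetime\<close>

text \<open>The additive functional \<open>c (t \<and> \<zeta>)\<close>; the process started at the cemetery (\<open>\<omega> \<le> 0\<close>) has
  \<open>\<zeta> = 0\<close>.\<close>

definition clock :: "real \<Rightarrow> real \<Rightarrow> real \<Rightarrow> ereal" where
  "clock c t \<omega> = ereal (c * max 0 (min t \<omega>))"

lemma stopped_time:
  "0 \<le> t \<Longrightarrow> enn2real (min (ennreal t) (ennreal \<omega>)) = max 0 (min t \<omega>)"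
  by (cases "0 \<le> \<omega>") (simp_all add: min_ennreal ennreal_neg)

lemma exit_time_killed_point: "exit_time killed_point_process {0} \<omega> = ennreal \<omega>"
proof (rule antisym)
  show "ennreal \<omega> \<le> exit_time killed_point_process {0} \<omega>"
    unfolding exit_time_def hitting_time_def
    by (rule Inf_greatest) (auto split: if_splits intro: ennreal_leI)
  show "exit_time killed_point_process {0} \<omega> \<le> ennreal \<omega>"
  \<comment> \<open>Hitting times range over t > 0 strictly, so for a path dead from the start the
    infimum 0 is approached but not attained.\<close>
  proof (rule ennreal_le_epsilon)
    fix e :: real assume "0 < e"
    hence "exit_time killed_point_process {0} \<omega> \<le> ennreal (max 0 \<omega> + e)"
      unfolding exit_time_def hitting_time_def
      by (intro Inf_lower CollectI exI[of _ "max 0 \<omega> + e"]) auto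
    also have "\<dots> = ennreal \<omega> + ennreal e"
      using \<open>0 < e\<close> by (cases "0 \<le> \<omega>") (simp_all add: ennreal_neg)
    finally show "exit_time killed_point_process {0} \<omega> \<le> ennreal \<omega> + ennreal e" .
  qed
qed

lemma min_lifetime_filt_measurable:
  assumes "0 \<le> t" shows "(\<lambda>\<omega>. max 0 (min t \<omega>)) \<in> borel_measurable (pfilt (ennreal t))"
proof (rule borel_measurableI_greater)
  fix a :: real
  consider "a < 0" | "0 \<le> a" "a < t" | "0 \<le> a" "t \<le> a" by linarith
  thus "{\<omega> \<in> space (pfilt (ennreal t)). a < max 0 (min t \<omega>)} \<in> sets (pfilt (ennreal t))"
  proof cases
    case 1
    have "{\<omega> \<in> space (pfilt (ennreal t)). a < max 0 (min t \<omega>)} = space (pfilt (ennreal t))"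
      using 1 by auto
    thus ?thesis using sets.top[of "pfilt (ennreal t)"] by (simp only:)
  next
    case 2
    have "{\<omega> \<in> space (pfilt (ennreal t)). a < max 0 (min t \<omega>)} = {a<..}"
      using 2 by auto
    moreover have "{a<..} \<in> sets (nfilt (ennreal t))"
      using 2 by (intro greaterThan_nat_filt) (simp_all add: ennreal_leI)
    ultimately show ?thesis using nat_filt_filt by auto
  next
    case 3
    have "{\<omega> \<in> space (pfilt (ennreal t)). a < max 0 (min t \<omega>)} = {}"
      using 3 assms by auto
    thus ?thesis by (simp only: sets.empty_sets)
  qed
qed

lemma clock_measurable:
  "0 \<le> t \<Longrightarrow> clock c t \<in> borel_measurable (pfilt (ennreal t))"
  unfolding clock_def[abs_def] using min_lifetime_filt_measurable by measurable

lemma continuous_clock: "continuous_on UNIV (\<lambda>t. clock c t \<omega>)"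
  unfolding clock_def by (intro continuous_intros continuous_on_ereal)

lemma clock_tendsto: "((\<lambda>t. clock c t \<omega>) \<longlongrightarrow> clock c t0 \<omega>) (at t0 within A)"
  using continuous_clock[of c \<omega>] tendsto_within_subset[of _ _ t0 UNIV A]
  by (auto simp: continuous_on_def)

lemma clock_0 [simp]: "clock c 0 \<omega> = 0"
  by (simp add: clock_def)

lemma clock_after_lifetime:
  assumes "0 \<le> t" "ennreal \<omega> \<le> ennreal t" shows "clock c t \<omega> = clock c (enn2real (ennreal \<omega>)) \<omega>"
proof -
  have "\<omega> \<le> t" using assms by simp
  thus ?thesis by (cases "0 \<le> \<omega>") (auto simp: clock_def ennreal_neg)
qed

text \<open>Additivity persists past the lifetime, where the shifted sample point is nonpositive and
  its clock stays at 0; \<open>pcaf\<close> demands it at all times.\<close>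

lemma clock_add:
  assumes "0 \<le> t" "0 \<le> s" shows "clock c (t + s) \<omega> = clock c t \<omega> + clock c s (\<omega> - t)"
proof -
  have "max 0 (min (t + s) \<omega>) = max 0 (min t \<omega>) + max 0 (min s (\<omega> - t))"
    using assms by (auto simp: max_def min_def)
  thus ?thesis by (simp add: clock_def distrib_left)
qed

lemma local_af_clock: "local_af killed_point_form killed_point_process (clock c)"
  unfolding local_af_def
proof (intro conjI bexI[of _ UNIV] exI[of _ "{}"] allI impI ballI)
  fix t \<omega> :: real
  show "0 \<le> t \<Longrightarrow> clock c t \<in> borel_measurable (filt (ftop killed_point_form) killed_point_process (ennreal t))"
    using clock_measurable by simp
  show "((\<lambda>s. clock c s \<omega>) \<longlongrightarrow> clock c t \<omega>) (at_right t)" by (rule clock_tendsto)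
  show "\<exists>l. ((\<lambda>s. clock c s \<omega>) \<longlongrightarrow> ereal l) (at_left t)"
    using clock_tendsto[of c \<omega> t "{..<t}"] unfolding clock_def by blast
  show "\<bar>clock c t \<omega>\<bar> < \<infinity>" by (simp add: clock_def)
  show "clock c 0 \<omega> = 0" by simp
  show "0 \<le> t \<Longrightarrow> lifetime killed_point_process \<omega> \<le> ennreal t \<Longrightarrow>
      clock c t \<omega> = clock c (enn2real (lifetime killed_point_process \<omega>)) \<omega>"
    by (simp only: lifetime_killed_point clock_after_lifetime)
  fix s :: real
  show "0 \<le> t \<Longrightarrow> 0 \<le> s \<Longrightarrow> clock c (t + s) \<omega> = clock c t \<omega> + clock c s (shift killed_point_process t \<omega>)"
    by (simp add: clock_add)
next
  fix x
  assume "x \<in> pts killed_point_form - {}"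
  show "emeasure (law killed_point_process (Some x)) UNIV = 1"
    using exp_law.emeasure_space_1 by simp
qed (simp_all add: borel_sets_exp_law)

section \<open>The clock belongs to \<open>class_Lc\<close>\<close>

lemma stopped_clock:
  "0 \<le> t \<Longrightarrow> stopped (clock c) (exit_time killed_point_process {0}) t \<omega> = clock c t \<omega>"
proof -
  assume "0 \<le> t"
  moreover have "max 0 (min (max 0 (min t \<omega>)) \<omega>) = max 0 (min t \<omega>)" by (auto simp: max_def min_def)
  ultimately show ?thesis
    unfolding stopped_def exit_time_killed_point by (simp add: stopped_time clock_def)
qed

text \<open>Paths are Lipschitz with constant |c|, so a squared increment over a step 1/r is at most
  c^2/r^2. At most rT of them sum to c^2 T/r, uniformly in \<omega>.\<close>

lemma zero_quadratic_variation_clock: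
  "zero_quadratic_variation killed_point_form killed_point_process
     (stopped (clock c) (exit_time killed_point_process {0}))" (is "zero_quadratic_variation _ _ ?Y")
  unfolding zero_quadratic_variation_def
proof (intro allI impI)
  fix g :: "real \<Rightarrow> ennreal" and T \<epsilon> :: real
  assume T: "0 < T" and \<epsilon>: "0 < \<epsilon>"
  have bound: "(\<Sum>k=1..nat \<lfloor>r * T\<rfloor>. (?Y (real (k + 1) / r) \<omega> - ?Y (real k / r) \<omega>)\<^sup>2) \<le> ereal (c\<^sup>2 * T / r)"
    if r: "0 < r" for r \<omega>
  proof -
    have step: "(?Y (real (k + 1) / r) \<omega> - ?Y (real k / r) \<omega>)\<^sup>2 \<le> ereal (c\<^sup>2 * (1 / r)\<^sup>2)" for k
    proof -
      let ?d = "max 0 (min (real (k + 1) / r) \<omega>) - max 0 (min (real k / r) \<omega>)"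
      have "\<bar>max 0 (min (a + b) \<omega>) - max 0 (min a \<omega>)\<bar> \<le> b" if "0 \<le> a" "0 \<le> b" for a b :: real
        using that by (auto simp: max_def min_def)
      from this[of "real k / r" "1 / r"] have "\<bar>?d\<bar> \<le> 1 / r"
        using r by (simp add: add_divide_distrib add.commute)
      hence "?d\<^sup>2 \<le> (1 / r)\<^sup>2" using r by (simp add: abs_le_square_iff[symmetric])
      hence "c\<^sup>2 * ?d\<^sup>2 \<le> c\<^sup>2 * (1 / r)\<^sup>2" by (intro mult_left_mono) auto
      moreover have "(?Y (real (k + 1) / r) \<omega> - ?Y (real k / r) \<omega>)\<^sup>2 = ereal (c\<^sup>2 * ?d\<^sup>2)"
      proof -
        have "?Y (real (k + 1) / r) \<omega> - ?Y (real k / r) \<omega> = ereal (c * ?d)"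
          using r by (simp add: stopped_clock) (simp add: clock_def right_diff_distrib)
        thus ?thesis by (simp add: power_mult_distrib)
      qed
      ultimately show ?thesis by simp
    qed
    have "(\<Sum>k=1..nat \<lfloor>r * T\<rfloor>. (?Y (real (k + 1) / r) \<omega> - ?Y (real k / r) \<omega>)\<^sup>2)
        \<le> (\<Sum>k=1..nat \<lfloor>r * T\<rfloor>. ereal (c\<^sup>2 * (1 / r)\<^sup>2))"
      by (intro sum_mono step)
    also have "\<dots> = ereal (real (nat \<lfloor>r * T\<rfloor>) * (c\<^sup>2 * (1 / r)\<^sup>2))"
      by (simp add: sum_ereal)
    also have "\<dots> \<le> ereal ((r * T) * (c\<^sup>2 * (1 / r)\<^sup>2))"
      using r T by (intro ereal_less_eq(3)[THEN iffD2] mult_right_mono) (auto simp: of_nat_floor)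
    also have "(r * T) * (c\<^sup>2 * (1 / r)\<^sup>2) = c\<^sup>2 * T / r"
      using r by (simp add: power2_eq_square field_simps)
    finally show ?thesis .
  qed
  have "eventually (\<lambda>r. outer_measure_of (law_dens killed_point_form killed_point_process g)
     {\<omega> \<in> samples killed_point_process. ereal \<epsilon> <
        (\<Sum>k=1..nat \<lfloor>r * T\<rfloor>. (?Y (real (k + 1) / r) \<omega> - ?Y (real k / r) \<omega>)\<^sup>2)} = 0) at_top"
    \<comment> \<open>Beyond this threshold the uniform bound is at most \<epsilon>, so the event is
      not merely unlikely but empty.\<close>
    using eventually_gt_at_top[of "max 0 (c\<^sup>2 * T / \<epsilon>)"]
  proof (rule eventually_mono)
    fix r :: real assume r: "max 0 (c\<^sup>2 * T / \<epsilon>) < r"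
    have "c\<^sup>2 * T / r \<le> \<epsilon>" using r \<epsilon> by (simp add: field_simps)
    hence "(\<Sum>k=1..nat \<lfloor>r * T\<rfloor>. (?Y (real (k + 1) / r) \<omega> - ?Y (real k / r) \<omega>)\<^sup>2) \<le> ereal \<epsilon>" for \<omega>
      using r by (intro order_trans[OF bound]) auto
    hence "{\<omega> \<in> samples killed_point_process. ereal \<epsilon> <
        (\<Sum>k=1..nat \<lfloor>r * T\<rfloor>. (?Y (real (k + 1) / r) \<omega> - ?Y (real k / r) \<omega>)\<^sup>2)} = {}"
      by (simp add: not_less del: killed_point_process_simps)
    thus "outer_measure_of (law_dens killed_point_form killed_point_process g)
     {\<omega> \<in> samples killed_point_process. ereal \<epsilon> <
        (\<Sum>k=1..nat \<lfloor>r * T\<rfloor>. (?Y (real (k + 1) / r) \<omega> - ?Y (real k / r) \<omega>)\<^sup>2)} = 0"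
      by (simp only: outer_measure_of_eq[OF sets.empty_sets] emeasure_empty)
  qed
  thus "((\<lambda>r. outer_measure_of (law_dens killed_point_form killed_point_process g)
     {\<omega> \<in> samples killed_point_process. ereal \<epsilon> <
        (\<Sum>k=1..nat \<lfloor>r * T\<rfloor>. (?Y (real (k + 1) / r) \<omega> - ?Y (real k / r) \<omega>)\<^sup>2)}) \<longlongrightarrow> 0) at_top"
    by (rule tendsto_eventually)
qed

lemma clock_in_Lc: "clock c \<in> class_Lc killed_point_form killed_point_process"
  unfolding class_Lc_def
proof (intro CollectI conjI local_af_clock bexI[OF _ Theta_killed_point] allI)
  have "continuous_on {0..} (\<lambda>t. stopped (clock c) (exit_time killed_point_process {0}) t \<omega>)" for \<omega>
    by (rule continuous_on_eq[OF continuous_on_subset[OF continuous_clock[of c \<omega>]]])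
      (simp_all add: stopped_clock)
  thus "qe killed_point_form (\<lambda>x. AE \<omega> in law killed_point_process (Some x).
      continuous_on {0..} (\<lambda>t. stopped (clock c) (exit_time killed_point_process {0}) t \<omega>))"
    by simp
qed (rule zero_quadratic_variation_clock)

text \<open>The compensated lifetime \<open>(t \<and> \<zeta>) - 1{\<zeta> \<le> t}\<close>, which agrees with \<^term>\<open>clock 1\<close>
  strictly before the lifetime.\<close>

definition comp_lifetime :: "real \<Rightarrow> real \<Rightarrow> real" where
  "comp_lifetime t \<omega> = max 0 (min t \<omega>) - (if \<omega> \<le> t then 1 else 0)"

section \<open>The compensated lifetime is a locally square integrable martingale\<close>

lemma comp_lifetime_filt_measurable:
  assumes "0 \<le> t" shows "comp_lifetime t \<in> borel_measurable (pfilt (ennreal t))"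
proof -
  have "{..t} \<in> sets (pfilt (ennreal t))"
    using atMost_nat_filt[OF assms order_refl] nat_filt_filt by auto
  hence "(\<lambda>\<omega>. max 0 (min t \<omega>) - indicator {..t} \<omega> :: real) \<in> borel_measurable (pfilt (ennreal t))"
    using min_lifetime_filt_measurable[OF assms] by measurable
  thus ?thesis by (simp add: comp_lifetime_def[abs_def] indicator_def of_bool_def)
qed

lemma comp_lifetime_measurable:
  assumes "0 \<le> t" shows "comp_lifetime t \<in> borel_measurable exp_law"
  using measurable_mono[OF order_refl refl filt_exp_law] comp_lifetime_filt_measurable[OF assms]
  by auto

lemma comp_lifetime_bound: "0 \<le> t \<Longrightarrow> \<bar>comp_lifetime t \<omega>\<bar> \<le> t + 1"
  by (auto simp: comp_lifetime_def max_def min_def)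

lemma integrable_comp_lifetime: "0 \<le> t \<Longrightarrow> integrable exp_law (comp_lifetime t)"
  using comp_lifetime_bound comp_lifetime_measurable
  by (intro exp_law.integrable_const_bound[of _ "t + 1"]) auto

text \<open>The martingale property on {s<..}, the one event of time s on which the increment can be
  nonzero: the growth t - s of the survivors balances the gain \<omega> - s minus the unit loss of
  those dying in (s,t].\<close>

lemma integral_comp_lifetime_diff:
  assumes st: "0 \<le> s" "s \<le> t"
  shows "(\<integral>\<omega>. indicator {s<..} \<omega> * (comp_lifetime t \<omega> - comp_lifetime s \<omega>) \<partial>exp_law) = 0"
proof -
  let ?e = "exponential_density 1"
  define f where "f \<omega> = indicator {s<..} \<omega> * (min t \<omega> - s - (if \<omega> \<le> t then 1 else 0))" for \<omega> :: real
  have [measurable]: "f \<in> borel_measurable borel" unfolding f_def by measurable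
  have "(\<integral>\<omega>. indicator {s<..} \<omega> * (comp_lifetime t \<omega> - comp_lifetime s \<omega>) \<partial>exp_law) = (\<integral>\<omega>. f \<omega> \<partial>exp_law)"
    using st by (intro Bochner_Integration.integral_cong)
      (auto simp: comp_lifetime_def f_def indicator_def max_def min_def)
  also have "\<dots> = (\<integral>\<omega>. (t - s) * indicator {t<..} \<omega> + indicator {s<..t} \<omega> * (\<omega> - s - 1) \<partial>exp_law)"
    using st by (intro Bochner_Integration.integral_cong) (auto simp: f_def indicator_def)
  also have "\<dots> = (\<integral>\<omega>. (t - s) * indicator {t<..} \<omega> \<partial>exp_law) + (\<integral>\<omega>. indicator {s<..t} \<omega> * (\<omega> - s - 1) \<partial>exp_law)"
  proof (rule Bochner_Integration.integral_add)
    show "integrable exp_law (\<lambda>\<omega>. (t - s) * indicator {t<..} \<omega> :: real)"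
      by (intro integrable_mult_right integrable_real_indicator)
        (simp_all add: borel_sets_exp_law exp_law.emeasure_eq_measure)
    show "integrable exp_law (\<lambda>\<omega>. indicator {s<..t} \<omega> * (\<omega> - s - 1) :: real)"
    proof (rule exp_law.integrable_const_bound[of _ "t - s + 1"])
      show "(\<lambda>\<omega>. indicator {s<..t} \<omega> * (\<omega> - s - 1) :: real) \<in> borel_measurable exp_law"
        by (rule borel_measurable_exp_law) measurable
    qed (use st in \<open>auto simp: indicator_def\<close>)
  qed
  also have "(\<integral>\<omega>. (t - s) * indicator {t<..} \<omega> \<partial>exp_law) = (t - s) * exp (- t)"
    using emeasure_exp_law_greaterThan[of t] st by (simp add: measure_def)
  also have "(\<integral>\<omega>. indicator {s<..t} \<omega> * (\<omega> - s - 1) \<partial>exp_law)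
     = (\<integral>\<omega>. indicator {s<..t} \<omega> * (\<omega> - s - 1) \<partial>density lborel ?e)"
    unfolding exp_law_def by (rule integral_completion) simp
  also have "\<dots> = (\<integral>\<omega>. ?e \<omega> * (indicator {s<..t} \<omega> * (\<omega> - s - 1)) \<partial>lborel)"
    by (subst integral_density) (auto simp: exponential_density_nonneg)
  also have "\<dots> = (\<integral>\<omega>. (exp (- \<omega>) * (\<omega> - s - 1)) * indicator {s..t} \<omega> \<partial>lborel)"
  proof (rule integral_cong_AE)
    show "AE \<omega> in lborel. ?e \<omega> * (indicator {s<..t} \<omega> * (\<omega> - s - 1)) =
        (exp (- \<omega>) * (\<omega> - s - 1)) * indicator {s..t} \<omega>"
      using AE_lborel_singleton[of s]
      by eventually_elim (use st in \<open>auto simp: indicator_def erlang_density_def\<close>)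
  qed measurable
  \<comment> \<open>The antiderivative -(x - s) exp(-x) vanishes at s, and its value at t cancels
    the contribution of the survivors.\<close>
  also have "\<dots> = - ((t - s) * exp (- t)) - - ((s - s) * exp (- s))"
  proof (rule integral_FTC_Icc_real[OF st(2)])
    fix x
    show "((\<lambda>x. - ((x - s) * exp (- x))) has_real_derivative exp (- x) * (x - s - 1)) (at x)"
      by (auto intro!: derivative_eq_intros simp: algebra_simps)
    show "isCont (\<lambda>x. exp (- x) * (x - s - 1)) x" by (intro continuous_intros)
  qed
  finally show ?thesis by simp
qed

text \<open>The increment vanishes on {..s}, and beyond s the event A is almost surely all or
  nothing. Its integral over A is thus 0 or the one just computed.\<close>

lemma set_integral_comp_lifetime:
  assumes A: "A \<in> sets (pfilt (ennreal s))" and st: "0 \<le> s" "s \<le> t"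
  shows "(\<integral>\<omega>\<in>A. comp_lifetime t \<omega> \<partial>exp_law) = (\<integral>\<omega>\<in>A. comp_lifetime s \<omega> \<partial>exp_law)"
proof -
  have A': "A \<in> sets exp_law" using A filt_exp_law by auto
  have t: "0 \<le> t" using st by simp
  let ?d = "\<lambda>\<omega>. comp_lifetime t \<omega> - comp_lifetime s \<omega>"
  have i: "set_integrable exp_law A (comp_lifetime u)" if "0 \<le> u" for u
    unfolding set_integrable_def using integrable_mult_indicator[OF A' integrable_comp_lifetime[OF that]] .
  have m: "?d \<in> borel_measurable exp_law"
    using comp_lifetime_measurable[OF t] comp_lifetime_measurable[OF st(1)] by measurable
  have d0: "?d \<omega> = 0" if "\<omega> \<le> s" for \<omega>
    using that st by (auto simp: comp_lifetime_def max_def min_def)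
  have mA: "(\<lambda>\<omega>. indicator A \<omega> * ?d \<omega>) \<in> borel_measurable exp_law"
    using m A' by measurable
  have mS: "(\<lambda>\<omega>. indicator {s<..} \<omega> * ?d \<omega>) \<in> borel_measurable exp_law"
  proof -
    have [measurable]: "{s<..} \<in> sets exp_law" by (simp add: borel_sets_exp_law)
    show ?thesis using m by measurable
  qed
  have "(\<integral>\<omega>\<in>A. comp_lifetime t \<omega> \<partial>exp_law) - (\<integral>\<omega>\<in>A. comp_lifetime s \<omega> \<partial>exp_law) = (\<integral>\<omega>\<in>A. ?d \<omega> \<partial>exp_law)"
    by (rule set_integral_diff(2)[symmetric]) (use i t st in auto)
  also have "\<dots> = (\<integral>\<omega>. indicator A \<omega> * ?d \<omega> \<partial>exp_law)"
    by (simp add: set_lebesgue_integral_def)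
  also have "\<dots> = 0"
    using filt_cases[OF A st(1)]
  proof
    assume *: "AE \<omega> in exp_law. s < \<omega> \<longrightarrow> \<omega> \<notin> A"
    have "(\<integral>\<omega>. indicator A \<omega> * ?d \<omega> \<partial>exp_law) = (\<integral>\<omega>. 0 \<partial>exp_law)"
    proof (rule integral_cong_AE[OF mA])
      show "AE \<omega> in exp_law. indicator A \<omega> * ?d \<omega> = 0"
        using * by (rule eventually_mono) (metis d0 indicator_simps(2) mult_zero_left mult_zero_right not_less)
    qed simp
    thus ?thesis by simp
  next
    assume *: "AE \<omega> in exp_law. s < \<omega> \<longrightarrow> \<omega> \<in> A"
    have "(\<integral>\<omega>. indicator A \<omega> * ?d \<omega> \<partial>exp_law) = (\<integral>\<omega>. indicator {s<..} \<omega> * ?d \<omega> \<partial>exp_law)"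
    proof (rule integral_cong_AE[OF mA mS])
      show "AE \<omega> in exp_law. indicator A \<omega> * ?d \<omega> = indicator {s<..} \<omega> * ?d \<omega>"
        using *
      proof (rule eventually_mono)
        fix \<omega> assume "s < \<omega> \<longrightarrow> \<omega> \<in> A"
        thus "indicator A \<omega> * ?d \<omega> = indicator {s<..} \<omega> * ?d \<omega>"
          using d0[of \<omega>] by (cases "s < \<omega>") simp_all
      qed
    qed
    thus ?thesis using integral_comp_lifetime_diff[OF st] by simp
  qed
  finally show ?thesis by simp
qed

text \<open>The free jump size b and offset d let one statement serve the process itself and its
  stopped, recentred versions.\<close>

lemma cadlag_comp_lifetime:
  assumes g: "continuous_on UNIV g"
  shows "cadlag (\<lambda>t. c * (g t - b * (if \<omega> \<le> t then 1 else 0)) - d)"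
proof -
  have gl: "(g \<longlongrightarrow> g t) (at t within A)" for t A
    using g tendsto_within_subset[of g _ t UNIV A] by (auto simp: continuous_on_def)
  have r: "((\<lambda>t. if \<omega> \<le> t then 1 else 0 :: real) \<longlongrightarrow> (if \<omega> \<le> t then 1 else 0)) (at_right t)" for t
  proof (rule tendsto_eventually, cases "\<omega> \<le> t")
    case True
    thus "eventually (\<lambda>s. (if \<omega> \<le> s then 1 else 0 :: real) = (if \<omega> \<le> t then 1 else 0)) (at_right t)"
      using eventually_at_right_less[of t] by (auto elim!: eventually_mono)
  next
    case False
    hence "eventually (\<lambda>s. s \<in> {t<..<\<omega>}) (at_right t)" by (intro eventually_at_rightI[of t \<omega>]) auto
    thus "eventually (\<lambda>s. (if \<omega> \<le> s then 1 else 0 :: real) = (if \<omega> \<le> t then 1 else 0)) (at_right t)"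
      using False by (auto elim!: eventually_mono)
  qed
  have l: "((\<lambda>t. if \<omega> \<le> t then 1 else 0 :: real) \<longlongrightarrow> (if \<omega> < t then 1 else 0)) (at_left t)" for t
  proof (rule tendsto_eventually, cases "\<omega> < t")
    case True
    hence "eventually (\<lambda>s. s \<in> {\<omega><..<t}) (at_left t)" by (intro eventually_at_leftI[of \<omega>]) auto
    thus "eventually (\<lambda>s. (if \<omega> \<le> s then 1 else 0 :: real) = (if \<omega> < t then 1 else 0)) (at_left t)"
      using True by (auto elim!: eventually_mono)
  next
    case False
    have "eventually (\<lambda>s. s \<in> {t - 1<..<t}) (at_left t)" by (intro eventually_at_leftI[of "t - 1"]) auto
    thus "eventually (\<lambda>s. (if \<omega> \<le> s then 1 else 0 :: real) = (if \<omega> < t then 1 else 0)) (at_left t)"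
      using False by (auto elim!: eventually_mono)
  qed
  show ?thesis
    unfolding cadlag_def
  proof (intro conjI allI impI)
    fix t
    show "((\<lambda>t. c * (g t - b * (if \<omega> \<le> t then 1 else 0)) - d) \<longlongrightarrow>
        c * (g t - b * (if \<omega> \<le> t then 1 else 0)) - d) (at_right t)"
      by (intro tendsto_diff tendsto_mult tendsto_const gl r)
    show "\<exists>l. ((\<lambda>t. c * (g t - b * (if \<omega> \<le> t then 1 else 0)) - d) \<longlongrightarrow> l) (at_left t)"
      by (intro exI[of _ "c * (g t - b * (if \<omega> < t then 1 else 0)) - d"] tendsto_diff tendsto_mult tendsto_const gl l)
  qed
qed

lemma cadlag_cong:
  assumes c: "cadlag z" and yz: "\<And>t. 0 \<le> t \<Longrightarrow> y t = z t"
  shows "cadlag y"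
  unfolding cadlag_def
proof (intro conjI allI impI)
  fix t :: real assume t: "0 \<le> t"
  have "eventually (\<lambda>s. z s = y s) (at_right t)"
    using eventually_at_right_less[of t] by (rule eventually_mono) (use t yz in auto)
  moreover have "(z \<longlongrightarrow> y t) (at_right t)" using c t yz[OF t] by (simp add: cadlag_def)
  ultimately show "(y \<longlongrightarrow> y t) (at_right t)" by (rule Lim_transform_eventually[rotated])
next
  fix t :: real assume t: "0 < t"
  then obtain l where "(z \<longlongrightarrow> l) (at_left t)" using c by (auto simp: cadlag_def)
  moreover have "eventually (\<lambda>s. s \<in> {0<..<t}) (at_left t)" by (rule eventually_at_leftI[OF _ t])
  hence "eventually (\<lambda>s. z s = y s) (at_left t)" by (rule eventually_mono) (use yz in auto)
  ultimately show "\<exists>l. (y \<longlongrightarrow> l) (at_left t)" by (blast intro: Lim_transform_eventually)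
qed

lemma stopped_const_time: "0 \<le> t \<Longrightarrow> stopped Y (\<lambda>_. ennreal (real k)) t \<omega> = Y (min t (real k)) \<omega>"
  by (simp add: stopped_def min_ennreal)

lemma martingale_stopped_comp_lifetime:
  "square_integrable_martingale exp_law pfilt
    (\<lambda>t \<omega>. stopped (\<lambda>t \<omega>. c * comp_lifetime t \<omega>) (\<lambda>_. ennreal (real k)) t \<omega> - c * comp_lifetime 0 \<omega>)"
    (is "square_integrable_martingale _ _ ?Y")
proof -
  have Y: "?Y t \<omega> = c * comp_lifetime (min t (real k)) \<omega> - c * comp_lifetime 0 \<omega>" if "0 \<le> t" for t \<omega>
    using that by (simp add: stopped_const_time)
  have meas: "?Y t \<in> borel_measurable (pfilt (ennreal t))" if t: "0 \<le> t" for t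
  proof -
    have "comp_lifetime u \<in> borel_measurable (pfilt (ennreal t))" if "0 \<le> u" "u \<le> t" for u
      using measurable_mono[OF order_refl refl filt_mono[of "ennreal u" "ennreal t"]]
        comp_lifetime_filt_measurable[OF that(1)] that(2) by (auto simp: ennreal_leI)
    hence "comp_lifetime 0 \<in> borel_measurable (pfilt (ennreal t))"
      "comp_lifetime (min t (real k)) \<in> borel_measurable (pfilt (ennreal t))" using t by simp_all
    thus ?thesis unfolding Y[OF t, abs_def] by measurable
  qed
  \<comment> \<open>k + 2 is the bound k + 1 at time min t k plus the bound 1 at time 0.\<close>
  have bound: "\<bar>?Y t \<omega>\<bar> \<le> \<bar>c\<bar> * (real k + 2)" if "0 \<le> t" for t \<omega>
  proof -
    have "\<bar>comp_lifetime (min t (real k)) \<omega> - comp_lifetime 0 \<omega>\<bar> \<le> real k + 2"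
      using comp_lifetime_bound[of "min t (real k)" \<omega>] comp_lifetime_bound[of 0 \<omega>] that by simp
    hence "\<bar>c\<bar> * \<bar>comp_lifetime (min t (real k)) \<omega> - comp_lifetime 0 \<omega>\<bar> \<le> \<bar>c\<bar> * (real k + 2)"
      by (rule mult_left_mono) simp
    thus ?thesis by (simp only: Y[OF that] abs_mult[symmetric] right_diff_distrib)
  qed
  have meas': "?Y t \<in> borel_measurable exp_law" if t: "0 \<le> t" for t
    using measurable_mono[OF order_refl refl filt_exp_law] meas[OF t] by auto
  have int: "integrable exp_law (?Y t)" if "0 \<le> t" for t
    using bound[OF that] meas'[OF that] by (intro exp_law.integrable_const_bound[of _ "\<bar>c\<bar> * (real k + 2)"]) auto
  have "martingale exp_law pfilt ?Y"
    unfolding martingale_def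
  proof (intro conjI allI impI)
    fix t :: real assume t: "0 \<le> t"
    show "?Y t \<in> borel_measurable (pfilt (ennreal t))" by (rule meas[OF t])
    show "integrable exp_law (?Y t)" by (rule int[OF t])
  next
    have "cadlag (\<lambda>t. ?Y t \<omega>)" for \<omega>
    proof -
      \<comment> \<open>The jump at \<omega> survives stopping at k only if \<omega> \<le> k, so its
        indicator factors into one in \<omega> and one in t.\<close>
      have eq: "?Y t \<omega> = c * (max 0 (min (min t (real k)) \<omega>) - (if \<omega> \<le> real k then 1 else 0) * (if \<omega> \<le> t then 1 else 0)) - c * comp_lifetime 0 \<omega>"
        if "0 \<le> t" for t
        unfolding Y[OF that] by (simp add: comp_lifetime_def)
      have "cadlag (\<lambda>t. c * (max 0 (min (min t (real k)) \<omega>) - (if \<omega> \<le> real k then 1 else 0) * (if \<omega> \<le> t then 1 else 0)) - c * comp_lifetime 0 \<omega>)"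
        by (intro cadlag_comp_lifetime continuous_intros)
      thus ?thesis by (rule cadlag_cong) (rule eq)
    qed
    thus "AE \<omega> in exp_law. cadlag (\<lambda>t. ?Y t \<omega>)" by simp
  next
    fix s t :: real assume st: "0 \<le> s" "s \<le> t"
    interpret F: finite_measure_subalgebra exp_law "pfilt (ennreal s)"
      by unfold_locales (simp add: subalgebra_def filt_exp_law)
    show "AE \<omega> in exp_law. real_cond_exp exp_law (pfilt (ennreal s)) (?Y t) \<omega> = ?Y s \<omega>"
    proof (rule F.real_cond_exp_charact)
      fix A assume A: "A \<in> sets (pfilt (ennreal s))"
      have A': "A \<in> sets exp_law" using A filt_exp_law by auto
      have i: "set_integrable exp_law A (\<lambda>\<omega>. c * comp_lifetime u \<omega>)" if "0 \<le> u" for u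
        unfolding set_integrable_def
        by (intro integrable_mult_indicator[OF A'] integrable_mult_right integrable_comp_lifetime that)
      have e: "(\<integral>\<omega>\<in>A. ?Y u \<omega> \<partial>exp_law) = c * (\<integral>\<omega>\<in>A. comp_lifetime (min u (real k)) \<omega> \<partial>exp_law) - (\<integral>\<omega>\<in>A. c * comp_lifetime 0 \<omega> \<partial>exp_law)"
        if "0 \<le> u" for u
        unfolding Y[OF that] using that by (subst set_integral_diff(2)) (auto intro!: i)
      have "(\<integral>\<omega>\<in>A. comp_lifetime (min t (real k)) \<omega> \<partial>exp_law) = (\<integral>\<omega>\<in>A. comp_lifetime (min s (real k)) \<omega> \<partial>exp_law)"
      proof (cases "s \<le> real k")
        case True
        thus ?thesis using set_integral_comp_lifetime[OF A st(1), of "min t (real k)"] st by simp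
      next
        case False
        thus ?thesis using st by (simp add: min_def)
      qed
      thus "(\<integral>\<omega>\<in>A. ?Y t \<omega> \<partial>exp_law) = (\<integral>\<omega>\<in>A. ?Y s \<omega> \<partial>exp_law)"
        using st e[of t] e[of s] by simp
    qed (use st in \<open>auto intro: int meas\<close>)
  qed
  moreover have "integrable exp_law (\<lambda>\<omega>. (?Y t \<omega>)\<^sup>2) \<and> (\<integral>\<omega>. (?Y t \<omega>)\<^sup>2 \<partial>exp_law) \<le> (\<bar>c\<bar> * (real k + 2))\<^sup>2"
    if t: "0 \<le> t" for t
  proof -
    have b: "(?Y t \<omega>)\<^sup>2 \<le> (\<bar>c\<bar> * (real k + 2))\<^sup>2" for \<omega>
      using power_mono[OF bound[OF t] abs_ge_zero, of \<omega> 2] by simp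
    have i: "integrable exp_law (\<lambda>\<omega>. (?Y t \<omega>)\<^sup>2)"
      using b meas'[OF t] by (intro exp_law.integrable_const_bound[of _ "(\<bar>c\<bar> * (real k + 2))\<^sup>2"]) auto
    have "(\<integral>\<omega>. (?Y t \<omega>)\<^sup>2 \<partial>exp_law) \<le> (\<integral>\<omega>. (\<bar>c\<bar> * (real k + 2))\<^sup>2 \<partial>exp_law)"
      using i b by (intro integral_mono) auto
    thus ?thesis using i exp_law.prob_space by simp
  qed
  ultimately show ?thesis unfolding square_integrable_martingale_def by blast
qed

lemma locally_martingale_comp_lifetime:
  "locally_square_integrable_martingale exp_law pfilt (\<lambda>t \<omega>. c * comp_lifetime t \<omega>)"
  unfolding locally_square_integrable_martingale_def
proof (intro conjI exI[of _ "\<lambda>k _. ennreal (real k)"] allI impI)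
  fix t :: real assume "0 \<le> t"
  thus "(\<lambda>\<omega>. c * comp_lifetime t \<omega>) \<in> borel_measurable (pfilt (ennreal t))"
    using comp_lifetime_filt_measurable by measurable
next
  have "cadlag (\<lambda>t. c * comp_lifetime t \<omega>)" for \<omega>
    using cadlag_comp_lifetime[of "\<lambda>t. max 0 (min t \<omega>)" c 1 \<omega> 0]
    by (simp add: comp_lifetime_def continuous_intros)
  thus "AE \<omega> in exp_law. cadlag (\<lambda>t. c * comp_lifetime t \<omega>)" by simp
next
  fix k
  show "stopping_time pfilt (\<lambda>_. ennreal (real k))" by (rule stopping_time_const)
  show "square_integrable_martingale exp_law pfilt
    (\<lambda>t \<omega>. stopped (\<lambda>t \<omega>. c * comp_lifetime t \<omega>) (\<lambda>_. ennreal (real k)) t \<omega> - c * comp_lifetime 0 \<omega>)"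
    by (rule martingale_stopped_comp_lifetime)
next
  show "AE \<omega> in exp_law. incseq (\<lambda>k. ennreal (real k)) \<and> (SUP k. ennreal (real k)) = \<infinity>"
    using ennreal_SUP_of_nat_eq_top by (simp add: incseq_def ennreal_of_nat_eq_real_of_nat)
qed

text \<open>The loophole itself: take \<zeta> as every localising time. Strictly before \<zeta> the
  clock and the martingale coincide, and at \<zeta> \<open>restrict_life\<close> sets both to
  0.\<close>

lemma clock_in_Mloc: "clock c \<in> class_Mloc killed_point_form killed_point_process"
proof -
  have eq: "stopped (restrict_life (lifetime killed_point_process) (clock c)) (\<lambda>\<omega>. ennreal \<omega>) t \<omega> =
      stopped (restrict_life (lifetime killed_point_process) (\<lambda>s \<omega>. ereal (c * comp_lifetime s \<omega>))) (\<lambda>\<omega>. ennreal \<omega>) t \<omega>"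
    for t \<omega>
  proof -
    let ?T = "enn2real (min (ennreal t) (ennreal \<omega>))"
    have "clock c ?T \<omega> = ereal (c * comp_lifetime ?T \<omega>)" if "ennreal ?T < ennreal \<omega>"
    proof -
      have "?T < \<omega>" using that by (simp add: ennreal_less_iff)
      thus ?thesis by (simp add: clock_def comp_lifetime_def)
    qed
    thus ?thesis by (simp add: stopped_def restrict_life_def)
  qed
  have "lsi_martingale_on_life exp_law pfilt (lifetime killed_point_process) (clock c)"
    unfolding lsi_martingale_on_life_def
  proof (intro exI[of _ "\<lambda>_ \<omega>. ennreal \<omega>"] exI[of _ "\<lambda>_ t \<omega>. c * comp_lifetime t \<omega>"] conjI allI)
    show "stopping_time pfilt (\<lambda>\<omega>. ennreal \<omega>)" by (rule stopping_time_lifetime_filt)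
    show "locally_square_integrable_martingale exp_law pfilt (\<lambda>t \<omega>. c * comp_lifetime t \<omega>)"
      by (rule locally_martingale_comp_lifetime)
    show "AE \<omega> in exp_law. \<forall>n. \<forall>t>0.
        stopped (restrict_life (lifetime killed_point_process) (clock c)) (\<lambda>\<omega>. ennreal \<omega>) t \<omega> =
        stopped (restrict_life (lifetime killed_point_process) (\<lambda>s \<omega>. ereal (c * comp_lifetime s \<omega>))) (\<lambda>\<omega>. ennreal \<omega>) t \<omega>"
      using eq by simp
    show "AE \<omega> in exp_law. incseq (\<lambda>n. ennreal \<omega>) \<and> (\<lambda>n. ennreal \<omega>) \<longlonglongrightarrow> lifetime killed_point_process \<omega> \<and>
        (\<forall>t\<ge>0. ennreal t < lifetime killed_point_process \<omega> \<longrightarrow> (\<exists>n. ennreal t \<le> ennreal \<omega>))"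
      by (simp add: incseq_def less_imp_le)
  qed
  thus ?thesis
    unfolding class_Mloc_def using local_af_clock by simp
qed

lemma clock_not_equivalent:
  assumes "c \<noteq> d" shows "\<not> af_equivalent killed_point_form killed_point_process (clock c) (clock d)"
proof -
  \<comment> \<open>On paths that outlive time 1 the two functionals equal c and d, so they differ
    on an event of mass exp(-1).\<close>
  have "{\<omega> \<in> samples killed_point_process. clock c 1 \<omega> = clock d 1 \<omega> \<and> ennreal 1 < lifetime killed_point_process \<omega>} = {}"
    using assms by (auto simp: clock_def)
  moreover have "{\<omega> \<in> samples killed_point_process. ennreal 1 < lifetime killed_point_process \<omega>} = {1<..}"
    by (auto simp: ennreal_less_iff simp del: ennreal_1)
  ultimately have "emeasure exp_law {\<omega> \<in> samples killed_point_process. clock c 1 \<omega> = clock d 1 \<omega> \<and> ennreal 1 < lifetime killed_point_process \<omega>}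
      \<noteq> emeasure exp_law {\<omega> \<in> samples killed_point_process. ennreal 1 < lifetime killed_point_process \<omega>}"
    by (simp only: emeasure_exp_law_greaterThan emeasure_empty) simp
  thus ?thesis unfolding af_equivalent_def qe_killed_point killed_point_process_simps
    using zero_le_one by blast
qed

section \<open>Levy system, Revuz measure and jump measure\<close>

text \<open>The martingale identity from time 0 gives E[min t \<zeta>] = P(0 < \<zeta> \<le> t).
  This is the sense in which \<open>clock 1\<close> compensates the killing.\<close>

lemma nn_integral_clock:
  assumes "0 \<le> t"
  shows "(\<integral>\<^sup>+\<omega>. ennreal (max 0 (min t \<omega>)) \<partial>exp_law) = ennreal (1 - exp (- t))"
proof -
  have m: "(\<lambda>\<omega>. max 0 (min t \<omega>)) \<in> borel_measurable exp_law"
    by (rule borel_measurable_exp_law) measurable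
  have i: "integrable exp_law (\<lambda>\<omega>. max 0 (min t \<omega>))"
    using assms m by (intro exp_law.integrable_const_bound[of _ t]) auto
  have i0: "integrable exp_law (\<lambda>\<omega>. indicator {0<..t} \<omega> :: real)"
    by (intro integrable_real_indicator) (simp_all add: borel_sets_exp_law exp_law.emeasure_eq_measure)
  have "(\<integral>\<omega>. max 0 (min t \<omega>) \<partial>exp_law) - (\<integral>\<omega>. indicator {0<..t} \<omega> \<partial>exp_law)
    = (\<integral>\<omega>. max 0 (min t \<omega>) - indicator {0<..t} \<omega> \<partial>exp_law)"
    by (rule Bochner_Integration.integral_diff[OF i i0, symmetric])
  also have "\<dots> = (\<integral>\<omega>. indicator {0<..} \<omega> * (comp_lifetime t \<omega> - comp_lifetime 0 \<omega>) \<partial>exp_law)"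
    using assms by (intro Bochner_Integration.integral_cong)
      (auto simp: comp_lifetime_def indicator_def max_def min_def)
  also have "\<dots> = 0" using integral_comp_lifetime_diff[of 0 t] assms by simp
  finally have "(\<integral>\<omega>. max 0 (min t \<omega>) \<partial>exp_law) = (\<integral>\<omega>. indicator {0<..t} \<omega> \<partial>exp_law)" by simp
  also have "\<dots> = measure exp_law {0<..t}" by simp
  also have "\<dots> = measure exp_law ({0<..} - {t<..})"
    by (rule arg_cong[of _ _ "measure exp_law"]) auto
  also have "\<dots> = measure exp_law {0<..} - measure exp_law {t<..}"
    using assms by (intro exp_law.finite_measure_Diff) (auto simp: borel_sets_exp_law)
  also have "\<dots> = 1 - exp (- t)"
    using emeasure_exp_law_greaterThan[of t] emeasure_exp_law_greaterThan[of 0] assms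
    by (simp add: measure_def)
  finally show ?thesis using nn_integral_eq_integral[OF i] by simp
qed

lemma emeasure_exp_law_Ioc:
  assumes "0 \<le> t" shows "emeasure exp_law {0<..t} = ennreal (1 - exp (- t))"
proof -
  have "emeasure exp_law {0<..t} = emeasure exp_law ({0<..} - {t<..})"
    by (rule arg_cong[of _ _ "emeasure exp_law"]) auto
  also have "\<dots> = emeasure exp_law {0<..} - emeasure exp_law {t<..}"
    using assms by (intro emeasure_Diff) (auto simp: borel_sets_exp_law exp_law.emeasure_eq_measure)
  also have "\<dots> = ennreal 1 - ennreal (exp (- t))"
    using assms by (simp add: emeasure_exp_law_greaterThan)
  also have "\<dots> = ennreal (1 - exp (- t))" by (rule ennreal_minus) simp
  finally show ?thesis .
qed

text \<open>The supremum need not be attained, since r stays strictly below the lifetime. For a dead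
  path the index set is empty and the supremum is 0.\<close>

lemma SUP_ennreal_before:
  assumes "0 \<le> t"
  shows "(SUP r\<in>{r. 0 \<le> r \<and> r \<le> t \<and> ennreal r < ennreal \<omega>}. ennreal r) = ennreal (max 0 (min t \<omega>))"
proof (rule antisym)
  show "(SUP r\<in>{r. 0 \<le> r \<and> r \<le> t \<and> ennreal r < ennreal \<omega>}. ennreal r) \<le> ennreal (max 0 (min t \<omega>))"
    by (rule SUP_least) (auto simp: ennreal_less_iff intro!: ennreal_leI)
  show "ennreal (max 0 (min t \<omega>)) \<le> (SUP r\<in>{r. 0 \<le> r \<and> r \<le> t \<and> ennreal r < ennreal \<omega>}. ennreal r)"
  proof (rule dense_le)
    fix y assume "y < ennreal (max 0 (min t \<omega>))"
    then obtain r where r: "0 \<le> r" "y = ennreal r" "r < max 0 (min t \<omega>)"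
      by (cases y) (auto simp: ennreal_less_iff)
    hence "r \<in> {r. 0 \<le> r \<and> r \<le> t \<and> ennreal r < ennreal \<omega>}" by (auto simp: ennreal_less_iff)
    thus "y \<le> (SUP r\<in>{r. 0 \<le> r \<and> r \<le> t \<and> ennreal r < ennreal \<omega>}. ennreal r)"
      unfolding r(2) by (rule SUP_upper)
  qed
qed

lemma af_integral_clock:
  assumes t: "0 \<le> t" and g: "\<And>s. 0 < s \<Longrightarrow> s < \<omega> \<Longrightarrow> g s = a"
  shows "af_integral killed_point_process (clock 1) g t \<omega> = a * ennreal (max 0 (min t \<omega>))"
proof -
  have "(\<integral>\<^sup>+s\<in>{0<..r}. g s \<partial>interval_measure (\<lambda>s. real_of_ereal (clock 1 (min (max s 0) r) \<omega>))) = a * ennreal r"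
    if r: "0 \<le> r" "ennreal r < ennreal \<omega>" for r
  proof -
    have rw: "r < \<omega>" using r by (simp add: ennreal_less_iff)
    \<comment> \<open>As r < \<omega>, the clock has not been frozen by death, and its Stieltjes
      measure on (0,r] is length.\<close>
    have F: "(\<lambda>s. real_of_ereal (clock 1 (min (max s 0) r) \<omega>)) = (\<lambda>s. min (max s 0) r)"
      using r(1) rw by (auto simp: clock_def max_def min_def)
    have "(\<integral>\<^sup>+s\<in>{0<..r}. g s \<partial>interval_measure (\<lambda>s. min (max s 0) r)) =
        (\<integral>\<^sup>+s. a * indicator {0<..r} s \<partial>interval_measure (\<lambda>s. min (max s 0) r))"
      using rw by (intro nn_integral_cong) (auto simp: indicator_def g)
    also have "\<dots> = a * emeasure (interval_measure (\<lambda>s. min (max s 0) r)) {0<..r}"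
      by (rule nn_integral_cmult_indicator) simp
    also have "emeasure (interval_measure (\<lambda>s. min (max s 0) r)) {0<..r} = ennreal (min (max r 0) r - min (max 0 0) r)"
    proof (rule emeasure_interval_measure_Ioc[OF r(1)])
      fix b :: real
      have "isCont (\<lambda>s. min (max s 0) r) b" by (intro continuous_intros)
      thus "continuous (at_right b) (\<lambda>s. min (max s 0) r)" by (rule continuous_at_imp_continuous_at_within)
    qed auto
    finally show ?thesis unfolding F using r(1) by simp
  qed
  hence "af_integral killed_point_process (clock 1) g t \<omega> =
     (SUP r\<in>{r. 0 \<le> r \<and> r \<le> t \<and> ennreal r < ennreal \<omega>}. a * ennreal r)"
    unfolding af_integral_def lifetime_killed_point by (intro SUP_cong) auto
  also have "\<dots> = a * (SUP r\<in>{r. 0 \<le> r \<and> r \<le> t \<and> ennreal r < ennreal \<omega>}. ennreal r)"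
    by (rule SUP_mult_left_ennreal[symmetric])
  finally show ?thesis by (simp only: SUP_ennreal_before[OF t])
qed

lemma pcaf_clock: "pcaf killed_point_form killed_point_process (clock 1)"
  unfolding pcaf_def
proof (intro conjI bexI[of _ UNIV] exI[of _ "{}"] allI impI ballI)
  fix t \<omega> :: real
  show "0 \<le> t \<Longrightarrow> clock 1 t \<in> borel_measurable (filt (ftop killed_point_form) killed_point_process (ennreal t))"
    using clock_measurable by simp
  show "continuous_on {0..} (\<lambda>t. clock 1 t \<omega>)" using continuous_clock continuous_on_subset by blast
  show "0 \<le> clock 1 t \<omega>" unfolding clock_def zero_ereal_def ereal_less_eq(3) by simp
  obtain r where "clock 1 t \<omega> = ereal r" unfolding clock_def by blast
  thus "clock 1 t \<omega> < \<infinity>" by simp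
  show "clock 1 0 \<omega> = 0" by simp
  show "0 \<le> t \<Longrightarrow> lifetime killed_point_process \<omega> \<le> ennreal t \<Longrightarrow>
      clock 1 t \<omega> = clock 1 (enn2real (lifetime killed_point_process \<omega>)) \<omega>"
    by (simp only: lifetime_killed_point clock_after_lifetime)
  fix s :: real
  show "0 \<le> t \<Longrightarrow> 0 \<le> s \<Longrightarrow> clock 1 (t + s) \<omega> = clock 1 t \<omega> + clock 1 s (shift killed_point_process t \<omega>)"
    by (simp add: clock_add)
next
  fix x
  assume "x \<in> pts killed_point_form - {}"
  show "emeasure (law killed_point_process (Some x)) UNIV = 1"
    using exp_law.emeasure_space_1 by simp
qed (simp_all add: borel_sets_exp_law)

text \<open>Before \<omega> the left limit and the value are both alive, after \<omega> both dead; f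
  vanishes on such pairs. The one remaining time is \<omega>.\<close>

lemma jump_term_killed_point:
  assumes "0 < s" "\<forall>z. f (z, z) = 0"
  shows "jump_term point_top killed_point_process f \<omega> s = f (Some 0, None) * indicator {\<omega>} s"
proof -
  have ex: "\<exists>l. limitin (cem_top point_top) (\<lambda>r. path killed_point_process r \<omega>) l (at_left s)"
    unfolding limitin_killed_point_at_left[OF assms(1)] by blast
  have "(THE l. limitin (cem_top point_top) (\<lambda>r. path killed_point_process r \<omega>) l (at_left s))
      = (if s \<le> \<omega> then Some 0 else None)"
    unfolding limitin_killed_point_at_left[OF assms(1)] by (rule the_eq_trivial)
  hence "jump_term point_top killed_point_process f \<omega> s = f (if s \<le> \<omega> then Some 0 else None, if s < \<omega> then Some 0 else None)"
    unfolding jump_term_def using ex by (simp only: if_True killed_point_process_simps)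
  thus ?thesis using assms(2) by (cases s \<omega> rule: linorder_cases) simp_all
qed

lemma nn_integral_jump_term_killed_point:
  assumes "\<forall>z. f (z, z) = 0"
  shows "(\<integral>\<^sup>+s. jump_term point_top killed_point_process f \<omega> s \<partial>count_space {0<..t})
    = f (Some 0, None) * indicator {0<..t} \<omega>"
proof -
  have "(\<integral>\<^sup>+s. jump_term point_top killed_point_process f \<omega> s \<partial>count_space {0<..t})
    = (\<integral>\<^sup>+s. f (Some 0, None) * indicator ({\<omega>} \<inter> {0<..t}) s \<partial>count_space {0<..t})"
    by (intro nn_integral_cong) (auto simp: jump_term_killed_point[OF _ assms] indicator_def)
  also have "\<dots> = f (Some 0, None) * emeasure (count_space {0<..t}) ({\<omega>} \<inter> {0<..t})"
    by (rule nn_integral_cmult_indicator) simp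
  also have "emeasure (count_space {0<..t}) ({\<omega>} \<inter> {0<..t}) = indicator {0<..t} \<omega>"
    by (cases "\<omega> \<in> {0<..t}") simp_all
  finally show ?thesis .
qed

text \<open>Time is measured by \<open>clock 1\<close>, so the unit mass at the cemetery encodes
  killing at rate 1.\<close>

definition killing_kernel :: "real option \<Rightarrow> real option measure" where
  "killing_kernel x = (case x of None \<Rightarrow> null_measure (borel_of (cem_top point_top))
                              | Some _ \<Rightarrow> return (borel_of (cem_top point_top)) None)"

lemma killing_kernel_simps [simp]:
  "killing_kernel None = null_measure (borel_of (cem_top point_top))"
  "killing_kernel (Some x) = return (borel_of (cem_top point_top)) None"
  by (simp_all add: killing_kernel_def)

lemma nn_integral_killing_kernel:
  "(\<integral>\<^sup>+y. g y \<partial>killing_kernel (Some x)) = g None"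
  unfolding killing_kernel_simps
  by (rule nn_integral_return) (auto intro!: measurable_of_Pow)

text \<open>The two sides are f(Some 0, None) times P(0 < \<zeta> \<le> t) and times
  E[min t \<zeta>], and both factors are 1 - exp(-t).\<close>

lemma levy_system_killed_point:
  "levy_system killed_point_form killed_point_process killing_kernel (clock 1)"
  unfolding levy_system_def Let_def
proof (intro conjI ballI)
  show "pcaf killed_point_form killed_point_process (clock 1)" by (rule pcaf_clock)
next
  fix x assume "x \<in> topspace (cem_top (ftop killed_point_form))"
  hence x: "x = None \<or> x = Some 0" by (auto simp: topspace_cem_top)
  show "sets (killing_kernel x) = sets (borel_of (cem_top (ftop killed_point_form)))"
    using x by auto
  show "emeasure (killing_kernel x) {x} = 0"
    using x by auto
next
  fix A
  show "(\<lambda>x. emeasure (killing_kernel x) A) \<in> borel_measurable (borel_of (cem_top (ftop killed_point_form)))"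
    by (rule measurable_of_Pow) simp_all
next
  have "(\<integral>\<^sup>+\<omega>. (\<integral>\<^sup>+s. jump_term point_top killed_point_process f \<omega> s \<partial>count_space {0<..t}) \<partial>exp_law)
      = (\<integral>\<^sup>+\<omega>. af_integral killed_point_process (clock 1)
           (\<lambda>s. \<integral>\<^sup>+y. f (path killed_point_process s \<omega>, y) \<partial>killing_kernel (path killed_point_process s \<omega>)) t \<omega> \<partial>exp_law)"
    if f: "\<forall>z. f (z, z) = 0" and t: "0 \<le> t" for f t
  proof -
    have "(\<integral>\<^sup>+\<omega>. (\<integral>\<^sup>+s. jump_term point_top killed_point_process f \<omega> s \<partial>count_space {0<..t}) \<partial>exp_law)
      = f (Some 0, None) * ennreal (1 - exp (- t))"
      unfolding nn_integral_jump_term_killed_point[OF f] emeasure_exp_law_Ioc[OF t, symmetric]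
      by (rule nn_integral_cmult_indicator) (simp add: borel_sets_exp_law)
    moreover have "af_integral killed_point_process (clock 1)
           (\<lambda>s. \<integral>\<^sup>+y. f (path killed_point_process s \<omega>, y) \<partial>killing_kernel (path killed_point_process s \<omega>)) t \<omega>
        = f (Some 0, None) * ennreal (max 0 (min t \<omega>))" for \<omega>
    proof (rule af_integral_clock[OF t])
      fix s assume "s < \<omega>"
      hence p: "path killed_point_process s \<omega> = Some 0" by simp
      show "(\<integral>\<^sup>+y. f (path killed_point_process s \<omega>, y) \<partial>killing_kernel (path killed_point_process s \<omega>)) = f (Some 0, None)"
        unfolding p by (rule nn_integral_killing_kernel)
    qed
    moreover have "(\<integral>\<^sup>+\<omega>. f (Some 0, None) * ennreal (max 0 (min t \<omega>)) \<partial>exp_law) = f (Some 0, None) * ennreal (1 - exp (- t))"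
      unfolding nn_integral_clock[OF t, symmetric]
      by (intro nn_integral_cmult borel_measurable_exp_law) measurable
    ultimately show ?thesis by simp
  qed
  thus "qe killed_point_form (\<lambda>x. \<forall>f t. f \<in> borel_measurable (borel_of (cem_top (ftop killed_point_form)) \<Otimes>\<^sub>M borel_of (cem_top (ftop killed_point_form))) \<longrightarrow>
      (\<forall>z. f (z, z) = 0) \<longrightarrow> 0 \<le> t \<longrightarrow>
      (\<integral>\<^sup>+\<omega>. (\<integral>\<^sup>+s. jump_term (ftop killed_point_form) killed_point_process f \<omega> s \<partial>count_space {0<..t}) \<partial>law killed_point_process (Some x))
      = (\<integral>\<^sup>+\<omega>. af_integral killed_point_process (clock 1)
           (\<lambda>s. \<integral>\<^sup>+y. f (path killed_point_process s \<omega>, y) \<partial>killing_kernel (path killed_point_process s \<omega>)) t \<omega>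
         \<partial>law killed_point_process (Some x)))"
    unfolding qe_killed_point killed_point_form_simps killed_point_process_simps(4) by blast
qed

section \<open>Revuz measure and jump measure\<close>

lemma law_dens_killed_point:
  "law_dens killed_point_form killed_point_process h = scale_measure (h 0) exp_law"
proof (rule measure_eqI)
  let ?nu = "distr (density (count_space {0}) h) (borel_of (cem_top point_top)) Some"
  have s: "sets ?nu = Pow {None, Some 0}" by simp
  show sets: "sets (law_dens killed_point_form killed_point_process h) = sets (scale_measure (h 0) exp_law)"
    unfolding law_dens_def killed_point_form_simps by (simp add: sets_law_from[OF s])
  have d: "Some \<in> measurable (density (count_space {0}) h) (borel_of (cem_top point_top))"
    by (rule measurable_of_Pow) simp_all
  have "emeasure ?nu {None} = 0"
    by (subst emeasure_distr[OF d]) simp_all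
  moreover have "emeasure ?nu {Some 0} = h 0"
    by (subst emeasure_distr[OF d])
      (auto simp: emeasure_density nn_integral_count_space_finite vimage_def)
  moreover fix A assume "A \<in> sets (law_dens killed_point_form killed_point_process h)"
  hence "A \<in> sets exp_law" using sets by simp
  ultimately show "emeasure (law_dens killed_point_form killed_point_process h) A = emeasure (scale_measure (h 0) exp_law) A"
    unfolding law_dens_def killed_point_form_simps
    by (subst emeasure_law_from[OF s]) simp_all
qed

text \<open>The quotient equals h(0) f(0) (1 - exp(-t))/t, and the last factor tends to the
  derivative 1 of 1 - exp(-t) at 0. So the Revuz measure of the clock is the reference
  measure.\<close>

lemma revuz_measure_killed_point:
  "revuz_measure killed_point_form killed_point_process (clock 1) (count_space {0})"
  unfolding revuz_measure_def
proof (intro conjI allI impI ballI)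
  show "smooth_measure killed_point_form (count_space {0})" by (rule smooth_killed_point) simp_all
next
  fix h ht :: "real \<Rightarrow> real" and f :: "real \<Rightarrow> ennreal"
  assume ht: "qc_version killed_point_form h ht"
  let ?c = "ennreal (h 0) * f 0"
  have "(\<integral>\<^sup>+\<omega>. af_integral killed_point_process (clock 1) (\<lambda>s. ext0 f (path killed_point_process s \<omega>)) t \<omega>
      \<partial>law_dens killed_point_form killed_point_process (\<lambda>x. ennreal (h x))) / ennreal t = ?c * ennreal ((1 - exp (- t)) / t)"
    if t: "0 < t" for t
  proof -
    have "af_integral killed_point_process (clock 1) (\<lambda>s. ext0 f (path killed_point_process s \<omega>)) t \<omega>
      = f 0 * ennreal (max 0 (min t \<omega>))" for \<omega>
      using t by (intro af_integral_clock) simp_all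
    moreover have "(\<lambda>\<omega>. f 0 * ennreal (max 0 (min t \<omega>))) \<in> borel_measurable exp_law"
      by (rule borel_measurable_exp_law) measurable
    moreover have "(\<integral>\<^sup>+\<omega>. f 0 * ennreal (max 0 (min t \<omega>)) \<partial>exp_law) = f 0 * ennreal (1 - exp (- t))"
      unfolding nn_integral_clock[OF less_imp_le[OF t], symmetric]
      by (intro nn_integral_cmult borel_measurable_exp_law) measurable
    ultimately show ?thesis
      using t unfolding law_dens_killed_point
      by (simp add: nn_integral_scale_measure divide_ennreal[symmetric] ennreal_times_divide mult.assoc)
  qed
  hence ev: "eventually (\<lambda>t. ?c * ennreal ((1 - exp (- t)) / t) =
      (\<integral>\<^sup>+\<omega>. af_integral killed_point_process (clock 1) (\<lambda>s. ext0 f (path killed_point_process s \<omega>)) t \<omega>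
      \<partial>law_dens killed_point_form killed_point_process (\<lambda>x. ennreal (h x))) / ennreal t) (at_right 0)"
    using eventually_at_right_less[of "0::real"] by (auto elim!: eventually_mono)
  have "((\<lambda>t::real. (1 - exp (- t)) / t) \<longlongrightarrow> 1) (at_right 0)"
  proof -
    have "((\<lambda>t::real. 1 - exp (- t)) has_field_derivative 1) (at 0)"
      by (auto intro!: derivative_eq_intros)
    hence "((\<lambda>t::real. (1 - exp (- t)) / t) \<longlongrightarrow> 1) (at 0)"
      by (simp add: has_field_derivative_iff)
    thus ?thesis by (rule tendsto_mono[OF at_le, rotated]) simp
  qed
  hence "((\<lambda>t. ?c * ennreal ((1 - exp (- t)) / t)) \<longlongrightarrow> ?c * ennreal 1) (at_right 0)"
    by (intro tendsto_mult_ennreal tendsto_const tendsto_ennrealI) simp_all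
  hence "((\<lambda>t. (\<integral>\<^sup>+\<omega>. af_integral killed_point_process (clock 1) (\<lambda>s. ext0 f (path killed_point_process s \<omega>)) t \<omega>
      \<partial>law_dens killed_point_form killed_point_process (\<lambda>x. ennreal (h x))) / ennreal t) \<longlongrightarrow> ?c * ennreal 1) (at_right 0)"
    using ev by (rule Lim_transform_eventually)
  moreover have "?c * ennreal 1 = (\<integral>\<^sup>+x. f x * ennreal (ht x) \<partial>count_space {0})"
    using ht by (simp add: nn_integral_count_space_finite mult.commute)
  ultimately show "((\<lambda>t. (\<integral>\<^sup>+\<omega>. af_integral killed_point_process (clock 1) (\<lambda>s. ext0 f (path killed_point_process s \<omega>)) t \<omega>
      \<partial>law_dens killed_point_form killed_point_process (\<lambda>x. ennreal (h x))) / ennreal t) \<longlongrightarrow>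
        (\<integral>\<^sup>+x. f x * ennreal (ht x) \<partial>count_space {0})) (at_right 0)"
    by (simp only:)
qed

lemma jump_measure_killed_point:
  "jump_measure killed_point_form killed_point_process
     (null_measure (borel_of point_top \<Otimes>\<^sub>M borel_of point_top))"
  unfolding jump_measure_def
proof (intro conjI exI[of _ killing_kernel] exI[of _ "clock 1"] exI[of _ "count_space {0}"]
    levy_system_killed_point revuz_measure_killed_point ballI)
  fix C :: "(real \<times> real) set"
  have "emeasure (killing_kernel (Some x)) (Some ` Y) = 0" for x :: real and Y :: "real set"
    by (cases "Some ` Y \<in> Pow {None, Some (0::real)}") (auto simp: emeasure_notin_sets)
  thus "emeasure (null_measure (borel_of point_top \<Otimes>\<^sub>M borel_of point_top)) C =
      (\<integral>\<^sup>+x. emeasure (killing_kernel (Some x)) (Some ` {y. (y, x) \<in> C}) \<partial>count_space {0})"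
    by (simp del: killing_kernel_simps)
qed simp

lemma smooth_jump_energy_killed_point:
  "smooth_measure killed_point_form
     (jump_energy killed_point_form (null_measure (borel_of point_top \<Otimes>\<^sub>M borel_of point_top)) (\<lambda>_. 0))"
proof (rule smooth_killed_point)
  let ?J = "null_measure (borel_of point_top \<Otimes>\<^sub>M borel_of point_top)"
  show "sets (jump_energy killed_point_form ?J (\<lambda>_. 0)) = Pow {0}"
    by (simp add: jump_energy_def sets_borel_of_discrete)
  have m: "snd \<in> measurable (density ?J (\<lambda>(y, x). 0)) (borel_of point_top)"
    by measurable
  have "emeasure (distr (density ?J (\<lambda>(y, x). 0)) (borel_of point_top) snd) {0} = 0"
    by (subst emeasure_distr[OF m]) (simp_all add: sets_borel_of_discrete emeasure_density split_def)
  thus "emeasure (jump_energy killed_point_form ?J (\<lambda>_. 0)) {0} < \<infinity>"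
    by (simp add: jump_energy_def)
qed

theorem mainTheorem4:
  shows "\<exists>(S :: real form_space) (M :: (real, real) process) (u :: real \<Rightarrow> real) (ut :: real \<Rightarrow> real)
            (J :: (real \<times> real) measure)
            (Mt :: real \<Rightarrow> real \<Rightarrow> ereal) (Nt :: real \<Rightarrow> real \<Rightarrow> ereal)
            (Mt' :: real \<Rightarrow> real \<Rightarrow> ereal) (Nt' :: real \<Rightarrow> real \<Rightarrow> ereal).
     semi_dirichlet_form S \<and> quasi_regular S \<and>
     special_standard (ftop S) M \<and> m_tight S M \<and> properly_associated S M \<and>
     condition_A S \<and>
     u \<in> dom_loc S \<and>
     qc_version S u ut \<and> ut \<in> borel_measurable (borel_of (ftop S)) \<and>
     jump_measure S M J \<and> smooth_measure S (jump_energy S J ut) \<and>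
     Mt \<in> class_Mloc S M \<and> Nt \<in> class_Lc S M \<and> decomposition S M ut Mt Nt \<and>
     Mt' \<in> class_Mloc S M \<and> Nt' \<in> class_Lc S M \<and> decomposition S M ut Mt' Nt' \<and>
     \<not> af_equivalent S M Nt Nt'"
proof (intro exI conjI)
  let ?S = killed_point_form and ?M = killed_point_process
  show "semi_dirichlet_form ?S" by (rule semi_dirichlet_killed_point)
  show "quasi_regular ?S" by (rule quasi_regular_killed_point)
  show "special_standard (ftop ?S) ?M" using special_standard_killed_point by simp
  show "m_tight ?S ?M" by (rule m_tight_killed_point)
  show "properly_associated ?S ?M" by (rule properly_associated_killed_point)
  show "condition_A ?S" by (rule condition_A_killed_point)
  show "(\<lambda>_. 0) \<in> dom_loc ?S" by (rule dom_loc_killed_point)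
  show "qc_version ?S (\<lambda>_. 0) (\<lambda>_. 0)" by simp
  show "(\<lambda>_. 0) \<in> borel_measurable (borel_of (ftop ?S))" by simp
  show "jump_measure ?S ?M (null_measure (borel_of point_top \<Otimes>\<^sub>M borel_of point_top))"
    by (rule jump_measure_killed_point)
  show "smooth_measure ?S (jump_energy ?S (null_measure (borel_of point_top \<Otimes>\<^sub>M borel_of point_top)) (\<lambda>_. 0))"
    by (rule smooth_jump_energy_killed_point)
  \<comment> \<open>Both decompositions have the form \<open>clock (- c)\<close> plus
    \<open>clock c\<close>, with c = 1 and c = 0; \<open>clock 0\<close> is the zero
    functional.\<close>
  show "clock (-1) \<in> class_Mloc ?S ?M" "clock 0 \<in> class_Mloc ?S ?M" by (rule clock_in_Mloc)+
  show "clock 1 \<in> class_Lc ?S ?M" "clock 0 \<in> class_Lc ?S ?M" by (rule clock_in_Lc)+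
  have zero: "ext0 (\<lambda>_. 0 :: real) z = 0" for z :: "real option" by (cases z) simp_all
  have "clock (- c) t \<omega> + clock c t \<omega> = ereal (0 - 0)" for c t \<omega>
    unfolding clock_def plus_ereal.simps by simp
  hence dec: "decomposition ?S ?M (\<lambda>_. 0) (clock (- c)) (clock c)" for c
    unfolding decomposition_def zero by simp
  show "decomposition ?S ?M (\<lambda>_. 0) (clock (-1)) (clock 1)" by (rule dec)
  show "decomposition ?S ?M (\<lambda>_. 0) (clock 0) (clock 0)" using dec[of 0] by simp
  show "\<not> af_equivalent ?S ?M (clock 1) (clock 0)" by (rule clock_not_equivalent) simp
qed

end
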